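(* Let $\mathcal H$ be a separable Hilbert space, $N\in\mathbb N$, let $A_1,\dots,A_N$, $B_1,\dots,B_N$, $C_1,\dots,C_N$, $D_1,\dots,D_N\in B(\mathcal H)$, let $\lambda_1,\dots,\lambda_N,w_1,\dots,w_N\ge0$, and for $\varepsilon,\zeta,\eta,\theta>0$ define the (positive invertible) operators $$A^*_\eta=\Big(\eta I+\sum_{n=1}^N\lambda_nA_nA_n^*\Big)^{1/2},\quad B_\zeta=\Big(\zeta I+\sum_{n=1}^NB_n^*B_n\Big)^{1/2},\quad A_\varepsilon=\Big(\varepsilon I+\sum_{n=1}^NA_n^*A_n\Big)^{1/2},$$ $$B^*_\theta=\Big(\theta I+\sum_{n=1}^Nw_nB_nB_n^*\Big)^{1/2},\quad C_\eta=\Big(\eta I+\sum_{n=1}^NC_n^*C_n\Big)^{1/2},\quad D^*_\theta=\Big(\theta I+\sum_{n=1}^Nw_nD_nD_n^*\Big)^{1/2}.$$ Then for all $\varepsilon,\zeta,\eta,\theta>0$: (1) $\big\|(A^*_\eta)^{-1}\sum_{n=1}^N\lambda_n^{1/2}A_nC_nXD_nB_nB_\zeta^{-1}\big\|\le\max_{n}\|C_n\|\|D_n\|\,\|X\|$ for all $X\in B(\mathcal H)$; (2) $\big\|\sum_{n=1}^NA_nC_nC_\eta^{-1}XD_nB_nB_\zeta^{-1}\big\|_2\le\max_n\|A_n\|\max_n\|D_n\|\,\|X\|_2$ for all $X\in\mathcal C_2$; (3) $\big\|(A^*_\eta)^{-1}\sum_{n=1}^N\lambda_n^{1/2}w_n^{1/2}A_nC_nX(D^*_\theta)^{-1}D_nB_n\big\|_2\le\max_n\|B_n\|\max_n\|C_n\|\,\|X\|_2$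 for all $X\in\mathcal C_2$; (4) $\big\|\sum_{n=1}^Nw_n^{1/2}A_nC_nC_\eta^{-1}X(D^*_\theta)^{-1}D_nB_n\big\|_1\le\max_n\|A_n\|\|B_n\|\,\|X\|_1$ for all $X\in\mathcal C_1$. The family (1)–(4) (holding for all such data) is equivalent to the family (1') $\big\|\sum_{n=1}^N\lambda_n^{1/2}A_nC_nXD_nB_n\big\|\le\max_n\|C_n\|\|D_n\|\,\big\|\sum_{n=1}^N\lambda_nA_nA_n^*\big\|^{1/2}\big\|\sum_{n=1}^NB_n^*B_n\big\|^{1/2}\|X\|$ for all $X\in B(\mathcal H)$; (2') $\big\|\sum_{n=1}^NA_nC_nXD_nB_n\big\|_2\le\max_n\|A_n\|\max_n\|D_n\|\,\big\|\sum_{n=1}^NB_n^*B_n\big\|^{1/2}\big\|\big(\sum_{n=1}^NC_n^*C_n\big)^{1/2}X\big\|_2$ for all $X\in\mathcal C_2$; (3') $\big\|\sum_{n=1}^N\lambda_n^{1/2}w_n^{1/2}A_nC_nXD_nB_n\big\|_2\le\max_n\|B_n\|\max_n\|C_n\|\,\big\|\sum_{n=1}^N\lambda_nA_nA_n^*\big\|^{1/2}\big\|X\big(\sum_{n=1}^Nw_nD_nD_n^*\big)^{1/2}\big\|_2$ for all $X\in\mathcal C_2$; (4') $\big\|\sum_{n=1}^Nw_n^{1/2}A_nC_nXD_nB_n\big\|_1\le\max_n\|A_n\|\|B_n\|\,\big\|\big(\sum_{n=1}^NC_n^*C_n\big)^{1/2}X\big(\sum_{n=1}^Nw_nD_nD_n^*\big)^{1/2}\big\|_1$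 for all $X\in\mathcal C_1$; and all of (1')–(4') also hold. Moreover, either family implies, for all $\varepsilon,\zeta,\eta,\theta>0$: (5) $\big\|(A^*_\eta)^{-1}\sum_{n=1}^N\lambda_n^{1/2}A_nXB_nB_\zeta^{-1}\big\|\le\|X\|$ for all $X\in B(\mathcal H)$; (6) $\big\|\sum_{n=1}^NA_nA_\varepsilon^{-1}XB_nB_\zeta^{-1}\big\|_2\le\|X\|_2$ for all $X\in\mathcal C_2$; (7) $\big\|(A^*_\eta)^{-1}\sum_{n=1}^N\lambda_n^{1/2}w_n^{1/2}A_nX(B^*_\theta)^{-1}B_n\big\|_2\le\|X\|_2$ for all $X\in\mathcal C_2$; (8) $\big\|\sum_{n=1}^Nw_n^{1/2}A_nA_\varepsilon^{-1}X(B^*_\theta)^{-1}B_n\big\|_1\le\|X\|_1$ for all $X\in\mathcal C_1$.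
   Context: $B(\mathcal H)$ is the algebra of bounded operators on $\mathcal H$ with operator norm $\|\cdot\|$; $\mathcal C_1$ and $\mathcal C_2$ are the trace class and Hilbert–Schmidt class with norms $\|\cdot\|_1,\|\cdot\|_2$. Maxima are over $1\le n\le N$. Square roots and inverses of positive operators are taken via the functional calculus. *)

theory Defs
  imports "HOL-Analysis.Analysis"
begin

class complex_vector = real_vector +
  fixes scaleC :: "complex \<Rightarrow> 'a \<Rightarrow> 'a"
  assumes scaleC_add_right: "scaleC a (x + y) = scaleC a x + scaleC a y"
    and scaleC_add_left: "scaleC (a + b) x = scaleC a x + scaleC b x"
    and scaleC_scaleC: "scaleC a (scaleC b x) = scaleC (a * b) x"
    and scaleC_one: "scaleC 1 x = x"
    and scaleR_scaleC: "scaleR r x = scaleC (complex_of_real r) x"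

class complex_inner = complex_vector + real_normed_vector +
  fixes cinner :: "'a \<Rightarrow> 'a \<Rightarrow> complex"
  assumes cinner_commute: "cinner x y = cnj (cinner y x)"
    and cinner_add_left: "cinner (x + y) z = cinner x z + cinner y z"
    and cinner_scaleC_left: "cinner (scaleC r x) y = cnj r * cinner x y"
    and cinner_ge_zero: "Im (cinner x x) = 0 \<and> 0 \<le> Re (cinner x x)"
    and cinner_eq_zero_iff: "cinner x x = 0 \<longleftrightarrow> x = 0"
    and norm_eq_sqrt_cinner: "norm x = sqrt (Re (cinner x x))"

definition separable_space :: "'a::topological_space itself \<Rightarrow> bool" where
  "separable_space _ \<longleftrightarrow> (\<exists>D::'a set. countable D \<and> closure D = UNIV)"

definition bop :: "('a::complex_inner \<Rightarrow> 'a) \<Rightarrow> bool" where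
  "bop T \<longleftrightarrow> bounded_linear T \<and> (\<forall>c x. T (scaleC c x) = scaleC c (T x))"

definition adj :: "('a::complex_inner \<Rightarrow> 'a) \<Rightarrow> ('a \<Rightarrow> 'a)" where
  "adj T = (THE S. \<forall>x y. cinner (T x) y = cinner x (S y))"

definition pos_op :: "('a::complex_inner \<Rightarrow> 'a) \<Rightarrow> bool" where
  "pos_op T \<longleftrightarrow> bop T \<and> (\<forall>x. Im (cinner (T x) x) = 0 \<and> 0 \<le> Re (cinner (T x) x))"

text \<open>Positive square root of a positive operator (unique; this is the functional-calculus root).\<close>
definition sqrt_op :: "('a::complex_inner \<Rightarrow> 'a) \<Rightarrow> ('a \<Rightarrow> 'a)" where
  "sqrt_op T = (THE S. pos_op S \<and> S \<circ> S = T)"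

definition reg_sqrt :: "real \<Rightarrow> nat \<Rightarrow> (nat \<Rightarrow> real) \<Rightarrow> (nat \<Rightarrow> 'a::complex_inner \<Rightarrow> 'a) \<Rightarrow> ('a \<Rightarrow> 'a)" where
  "reg_sqrt c N w T = sqrt_op (\<lambda>x. c *\<^sub>R x + (\<Sum>n = 1..N. w n *\<^sub>R T n x))"

definition orthonormal :: "'a::complex_inner set \<Rightarrow> bool" where
  "orthonormal E \<longleftrightarrow> (\<forall>e\<in>E. norm e = 1) \<and> (\<forall>e\<in>E. \<forall>f\<in>E. e \<noteq> f \<longrightarrow> cinner e f = 0)"

text \<open>sum_e norm(T e)^2 over an orthonormal basis, written basis-free as the supremum over
  finite orthonormal sets (the sum of nonnegative terms over a basis).\<close>
definition hs_sums :: "('a::complex_inner \<Rightarrow> 'a) \<Rightarrow> real set" where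
  "hs_sums T = {\<Sum>e\<in>E. (norm (T e))\<^sup>2 | E. finite E \<and> orthonormal E}"

definition hs_class :: "('a::complex_inner \<Rightarrow> 'a) \<Rightarrow> bool" where
  "hs_class T \<longleftrightarrow> bop T \<and> bdd_above (hs_sums T)"

definition hs_norm :: "('a::complex_inner \<Rightarrow> 'a) \<Rightarrow> real" where
  "hs_norm T = sqrt (Sup (hs_sums T))"

definition abs_op :: "('a::complex_inner \<Rightarrow> 'a) \<Rightarrow> ('a \<Rightarrow> 'a)" where
  "abs_op T = sqrt_op (adj T \<circ> T)"

text \<open>tr |T| = sum_e <|T| e, e> over an orthonormal basis, written basis-free.\<close>
definition tr_sums :: "('a::complex_inner \<Rightarrow> 'a) \<Rightarrow> real set" where
  "tr_sums T = {\<Sum>e\<in>E. Re (cinner (abs_op T e) e) | E. finite E \<and> orthonormal E}"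

definition trace_class :: "('a::complex_inner \<Rightarrow> 'a) \<Rightarrow> bool" where
  "trace_class T \<longleftrightarrow> bop T \<and> bdd_above (tr_sums T)"

definition tr_norm :: "('a::complex_inner \<Rightarrow> 'a) \<Rightarrow> real" where
  "tr_norm T = Sup (tr_sums T)"

end

theory Submission
  imports Defs
begin

text \<open>
  After absorbing the weights into the coefficients, each inequality is a Cauchy--Schwarz estimate for
  a product of an operator row, a block-diagonal operator and an operator column.  The operator norm
  bounds combine a row and a column contraction.  For the Hilbert--Schmidt norm one of the two
  contractions is replaced by a column (or, after taking adjoints, a row) of Hilbert--Schmidt
  operators whose squared norms add up.  For the trace norm, \<open>X\<close> is split as
  \<open>(U h) h\<close> with \<open>h\<close> the square root of \<open>\<bar>X\<bar>\<close>, giving a column on one side and a row on the other.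

  No orthonormal basis of the whole space is needed: every comparison of Hilbert--Schmidt sums takes
  place in the span of finitely many vectors, where Gram--Schmidt and Bessel's inequality suffice.
\<close>

subsection \<open>Complex inner products and finite orthonormal sets\<close>

text \<open>The regularised and the plain family come from the same estimates, with no limit taken
  from one to the other. The regularised one rests on one identity: if \<open>S\<close> is the root
  of \<open>c I + P\<close> and \<open>y = inv S x\<close>, then the squared norm of
  \<open>x\<close> is \<open>c\<close> times that of \<open>y\<close> plus the form of
  \<open>P\<close> at \<open>y\<close>. So a column composed with the inverse root of its own
  shifted Gram operator is a contraction for every \<open>c > 0\<close>, and no shift parameter
  survives on a right-hand side. In the plain family a column has exactly the norm of its Gram root
  at each vector. That equality suffices for the Hilbert-Schmidt norm. In the trace norm the roots
  stand on both sides of \<open>X\<close> and need not be invertible, so they are replaced by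
  resolvents, at the price of an error that vanishes with the shift. Errors in the trace-norm
  arguments are merely bounded operators; they are controlled only because everything is tested on
  one fixed finite orthonormal set. \<open>adj\<close> and \<open>sqrt_op\<close> are definite
  descriptions, so existence and uniqueness of adjoints and positive roots must be settled before
  either can be used.\<close>

lemma cinner_add_right: "cinner x (y + z) = cinner x y + cinner x z"
  for x :: "'a::complex_inner"
  by (metis cinner_commute cinner_add_left complex_cnj_add)

lemma cinner_scaleC_right: "cinner x (scaleC r y) = r * cinner x y"
  for x :: "'a::complex_inner"
  by (metis cinner_commute cinner_scaleC_left complex_cnj_mult complex_cnj_cnj)

lemma cinner_scaleR_left: "cinner (r *\<^sub>R x) y = r *\<^sub>R cinner x y"
  for x :: "'a::complex_inner"
  by (simp add: scaleR_scaleC cinner_scaleC_left scaleR_conv_of_real)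

lemma cinner_scaleR_right: "cinner x (r *\<^sub>R y) = r *\<^sub>R cinner x y"
  for x :: "'a::complex_inner"
  by (simp add: scaleR_scaleC cinner_scaleC_right scaleR_conv_of_real)

lemma Re_cinner_self: "Re (cinner x x) = (norm x)\<^sup>2"
  for x :: "'a::complex_inner"
  using cinner_ge_zero[of x] by (simp add: norm_eq_sqrt_cinner)

lemma cinner_self: "cinner x x = complex_of_real ((norm x)\<^sup>2)"
  for x :: "'a::complex_inner"
  using cinner_ge_zero[of x] by (simp add: complex_eq_iff Re_cinner_self)

lemma cinner_diff_right: "cinner x (y - z) = cinner x y - cinner x z"
  for x :: "'a::complex_inner"
  using cinner_add_right[of x "y - z" z] by simp

lemma cinner_diff_left: "cinner (x - y) z = cinner x z - cinner y z"
  for x :: "'a::complex_inner"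
  using cinner_add_left[of "x - y" y z] by simp

lemma Re_cinner_commute: "Re (cinner x y) = Re (cinner y x)"
  for x :: "'a::complex_inner"
  by (subst cinner_commute) simp

lemma norm_cinner_commute: "norm (cinner x y) = norm (cinner y x)"
  for x :: "'a::complex_inner"
  by (subst cinner_commute) simp

lemma norm_diff_sq: "(norm (x - y))\<^sup>2 = (norm x)\<^sup>2 - 2 * Re (cinner x y) + (norm y)\<^sup>2"
  for x :: "'a::complex_inner"
  unfolding Re_cinner_self[symmetric]
  by (simp add: cinner_diff_left cinner_diff_right Re_cinner_commute[of y x])

lemma norm_add_sq: "(norm (x + y))\<^sup>2 = (norm x)\<^sup>2 + 2 * Re (cinner x y) + (norm y)\<^sup>2"
  for x :: "'a::complex_inner"
  unfolding Re_cinner_self[symmetric]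
  by (simp add: cinner_add_left cinner_add_right Re_cinner_commute[of y x])

lemma norm_scaleC: "norm (scaleC c x) = norm c * norm x"
  for x :: "'a::complex_inner"
proof -
  have "(norm (scaleC c x))\<^sup>2 = Re (cnj c * c) * (norm x)\<^sup>2"
  proof -
    have "cinner (scaleC c x) (scaleC c x) = cnj c * c * cinner x x"
      by (simp add: cinner_scaleC_left cinner_scaleC_right)
    from arg_cong[OF this, of Re] show ?thesis
      by (simp add: Re_cinner_self cinner_self[of x] del: of_real_power)
  qed
  also have "\<dots> = (norm c * norm x)\<^sup>2"
    by (simp add: power_mult_distrib cmod_power2 power2_eq_square[of "Re c"] power2_eq_square[of "Im c"])
  finally show ?thesis by (simp add: power2_eq_iff_nonneg)
qed

lemma Cauchy_Schwarz_cinner: "norm (cinner x y) \<le> norm x * norm y"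
  for x :: "'a::complex_inner"
proof (cases "y = 0")
  case True
  have "cinner x (0 *\<^sub>R y) = 0" by (simp only: cinner_scaleR_right) simp
  then show ?thesis using True by simp
next
  case False
  \<comment> \<open>\<open>scaleC c y\<close> is the orthogonal projection of \<open>x\<close> onto
    the line of \<open>y\<close>; the inequality is the nonnegativity of the squared norm of the
    residual.\<close>
  define c where "c = cinner y x / of_real ((norm y)\<^sup>2)"
  have ny: "norm y > 0" using False by simp
  have nc: "norm c = norm (cinner x y) / (norm y)\<^sup>2"
    by (simp add: c_def norm_divide norm_cinner_commute[of y x] norm_power)
  have "c * cinner x y = of_real ((norm (cinner x y))\<^sup>2 / (norm y)\<^sup>2)"
    unfolding c_def by (subst (1) cinner_commute)
      (simp add: complex_norm_square mult.commute del: of_real_power)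
  then have re: "Re (cinner x (scaleC c y)) = (norm (cinner x y))\<^sup>2 / (norm y)\<^sup>2"
    by (simp only: cinner_scaleC_right Re_complex_of_real)
  have "0 \<le> (norm (x - scaleC c y))\<^sup>2" by simp
  also have "\<dots> = (norm x)\<^sup>2 - (norm (cinner x y))\<^sup>2 / (norm y)\<^sup>2"
    unfolding norm_diff_sq re norm_scaleC nc using ny
    by (simp add: power2_eq_square field_simps)
  finally have "(norm (cinner x y))\<^sup>2 \<le> (norm x * norm y)\<^sup>2"
    using ny by (simp add: field_simps power_mult_distrib)
  then show ?thesis by (simp add: power2_le_iff_abs_le)
qed

text \<open>Real bilinearity supplies the rules for sums, zero and limits in both arguments; complex
  scalars are handled by the two \<open>scaleC\<close> lemmas.\<close>

interpretation cinner: bounded_bilinear "cinner :: 'a::complex_inner \<Rightarrow> 'a \<Rightarrow> complex"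
proof
  show "\<exists>K. \<forall>a b::'a. norm (cinner a b) \<le> norm a * norm b * K"
    by (rule exI[of _ 1]) (simp add: Cauchy_Schwarz_cinner)
qed (simp_all add: cinner_add_left cinner_add_right cinner_scaleR_left cinner_scaleR_right)

lemma Re_cinner_le: "Re (cinner x y) \<le> norm x * norm y"
  for x :: "'a::complex_inner"
  using Cauchy_Schwarz_cinner[of x y] complex_Re_le_cmod[of "cinner x y"] by linarith

lemma cinner_ext_right: "(\<And>z. cinner z x = cinner z y) \<Longrightarrow> x = y"
  for x :: "'a::complex_inner"
  by (metis cinner_diff_right cinner_eq_zero_iff right_minus_eq)

lemma scaleC_of_real: "scaleC (complex_of_real r) x = r *\<^sub>R x"
  by (simp add: scaleR_scaleC)

lemma scaleC_zero_left [simp]: "scaleC 0 x = (0::'a::complex_inner)"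
  using scaleC_of_real[of 0 x] by simp

lemma scaleC_sum_right: "scaleC c (\<Sum>i\<in>I. f i) = (\<Sum>i\<in>I. scaleC c (f i))"
  for f :: "_ \<Rightarrow> 'a::complex_inner"
proof (induction I rule: infinite_finite_induct)
  case (infinite A)
  have "norm (scaleC c (0::'a)) = 0" by (simp add: norm_scaleC)
  then show ?case using infinite by simp
next
  case empty
  have "norm (scaleC c (0::'a)) = 0" by (simp add: norm_scaleC)
  then show ?case by simp
qed (simp add: scaleC_add_right)

lemma scaleC_scaleR_commute: "scaleC c (r *\<^sub>R x) = r *\<^sub>R scaleC c x"
  by (simp add: scaleR_scaleC scaleC_scaleC mult.commute)

lemma scaleC_diff_right: "scaleC c (x - y) = scaleC c x - scaleC c y"
  using scaleC_add_right[of c "x - y" y] by simp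

text \<open>For a finite orthonormal \<open>E\<close> this is the orthogonal projection onto its
  span, and the equation \<open>proj E v = v\<close> serves throughout as "v lies in the span of
  E".\<close>

definition proj :: "'a::complex_inner set \<Rightarrow> 'a \<Rightarrow> 'a" where
  "proj E x = (\<Sum>e\<in>E. scaleC (cinner e x) e)"

lemma cinner_proj_orthonormal:
  fixes E :: "'a::complex_inner set"
  assumes "finite E" "orthonormal E" "e \<in> E"
  shows "cinner e (proj E x) = cinner e x"
proof -
  have "cinner e (proj E x) = (\<Sum>f\<in>E. cinner f x * cinner e f)"
    by (simp add: proj_def cinner.sum_right cinner_scaleC_right)
  also have "\<dots> = (\<Sum>f\<in>E. if f = e then cinner e x else 0)"
    using assms by (intro sum.cong) (auto simp: orthonormal_def cinner_self)
  finally show ?thesis using assms by simp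
qed

lemma cinner_proj_left:
  "cinner (proj E x) y = (\<Sum>e\<in>E. cnj (cinner e x) * cinner e y)"
  by (simp add: proj_def cinner.sum_left cinner_scaleC_left)

lemma norm_proj_sq:
  fixes E :: "'a::complex_inner set"
  assumes "finite E" "orthonormal E"
  shows "(norm (proj E x))\<^sup>2 = (\<Sum>e\<in>E. (norm (cinner e x))\<^sup>2)"
proof -
  have "cinner (proj E x) (proj E x) = (\<Sum>e\<in>E. cnj (cinner e x) * cinner e x)"
    using assms by (simp add: cinner_proj_left cinner_proj_orthonormal)
  also have "\<dots> = of_real (\<Sum>e\<in>E. (norm (cinner e x))\<^sup>2)"
    by (simp add: mult.commute[of "cnj _"] complex_norm_square del: of_real_power)
  finally show ?thesis by (simp only: cinner_self of_real_eq_iff)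
qed

text \<open>The residual \<open>x - proj E x\<close> is orthogonal to \<open>proj E x\<close>, so
  its squared norm is the difference of the two sides.\<close>

lemma Bessel_inequality:
  fixes E :: "'a::complex_inner set"
  assumes "finite E" "orthonormal E"
  shows "(\<Sum>e\<in>E. (norm (cinner e x))\<^sup>2) \<le> (norm x)\<^sup>2"
proof -
  have "cinner (proj E x) x = cinner (proj E x) (proj E x)"
    using assms by (simp add: cinner_proj_left cinner_proj_orthonormal)
  then have "Re (cinner x (proj E x)) = (norm (proj E x))\<^sup>2"
    by (simp add: Re_cinner_commute[of x] Re_cinner_self)
  moreover have "0 \<le> (norm (x - proj E x))\<^sup>2" by simp
  ultimately show ?thesis
    unfolding norm_diff_sq norm_proj_sq[OF assms, symmetric] by simp
qed

text \<open>Provides the finite set on which sums over different orthonormal sets can be compared. A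
  new vector contributes its normalised residual, or nothing when the residual is zero.\<close>

lemma finite_Gram_Schmidt:
  fixes V :: "'a::complex_inner set"
  assumes "finite V"
  shows "\<exists>E. finite E \<and> orthonormal E \<and> (\<forall>v\<in>V. proj E v = v)"
  using assms
proof (induction V rule: finite_induct)
  case empty
  show ?case by (intro exI[of _ "{}"]) (simp add: orthonormal_def)
next
  case (insert v V)
  then obtain E where E: "finite E" "orthonormal E" and V: "\<And>v. v \<in> V \<Longrightarrow> proj E v = v"
    by blast
  define r where "r = v - proj E v"
  show ?case
  proof (cases "r = 0")
    case True
    then show ?thesis using E V by (intro exI[of _ E]) (auto simp: r_def)
  next
    case False
    define u where "u = (1 / norm r) *\<^sub>R r"
    have nu: "norm u = 1" using False by (simp add: u_def)
    have er: "cinner e r = 0" if "e \<in> E" for e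
      using that E by (simp add: r_def cinner_diff_right cinner_proj_orthonormal)
    then have eu: "cinner e u = 0" if "e \<in> E" for e
      using that by (simp add: u_def cinner_scaleR_right)
    then have ue: "cinner u e = 0" if "e \<in> E" for e
      using that by (metis cinner_commute complex_cnj_zero)
    have "u \<notin> E" using eu[of u] nu by (auto simp: cinner_self)
    then have ins: "proj (insert u E) x = scaleC (cinner u x) u + proj E x" for x
      using E by (simp add: proj_def)
    have up: "cinner u (proj E x) = 0" for x
      by (simp add: proj_def cinner.sum_right cinner_scaleC_right ue)
    have "orthonormal (insert u E)"
      using E eu ue nu by (auto simp: orthonormal_def)
    moreover have "proj (insert u E) x = x" if "x \<in> V" for x
      using up[of x] V[OF that] by (simp add: ins)
    moreover have "proj (insert u E) v = v"
    proof -
      have "v = r + proj E v" by (simp add: r_def)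
      then have "cinner u v = cinner u r" using up[of v] cinner_add_right[of u r "proj E v"] by simp
      also have "\<dots> = of_real (norm r)"
        using False by (simp add: u_def cinner_scaleR_left cinner_self scaleR_conv_of_real power2_eq_square)
      finally have "scaleC (cinner u v) u = r"
        using False by (simp add: scaleC_of_real u_def)
      then show ?thesis by (simp add: ins r_def)
    qed
    ultimately show ?thesis
      using E by (intro exI[of _ "insert u E"]) auto
  qed
qed

lemma norm_sq_finite_expansion:
  fixes E :: "'a::complex_inner set"
  assumes "finite E" "orthonormal E" "proj E x = x"
  shows "(norm x)\<^sup>2 = (\<Sum>e\<in>E. (norm (cinner e x))\<^sup>2)"
  using norm_proj_sq[OF assms(1,2), of x] assms(3) by simp

subsection \<open>Bounded operators and adjoints\<close>

lemma bop_bounded_linear: "bop T \<Longrightarrow> bounded_linear T"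
  by (simp add: bop_def)

lemma bop_scaleC: "bop T \<Longrightarrow> T (scaleC c x) = scaleC c (T x)"
  by (simp add: bop_def)

lemma bop_add: "bop T \<Longrightarrow> T (x + y) = T x + T y"
  by (simp add: bop_def linear_add bounded_linear.linear)

lemma bop_diff: "bop T \<Longrightarrow> T (x - y) = T x - T y"
  by (simp add: bop_def linear_diff bounded_linear.linear)

lemma bop_scaleR: "bop T \<Longrightarrow> T (r *\<^sub>R x) = r *\<^sub>R T x"
  by (simp add: bop_def linear_scale bounded_linear.linear)

lemma bop_zero: "bop T \<Longrightarrow> T 0 = 0"
  by (simp add: bop_def linear_0 bounded_linear.linear)

lemma bop_sum: "bop T \<Longrightarrow> T (\<Sum>i\<in>I. f i) = (\<Sum>i\<in>I. T (f i))"
  by (simp add: bop_def linear_sum bounded_linear.linear)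

lemma bop_norm_le: "bop T \<Longrightarrow> norm (T x) \<le> onorm T * norm x"
  by (simp add: bop_def onorm)

lemma bop_onorm_pos: "bop T \<Longrightarrow> 0 \<le> onorm T"
  by (simp add: bop_def onorm_pos_le)

lemma bop_intro:
  assumes "\<And>x y. T (x + y) = T x + T y" "\<And>c x. T (scaleC c x) = scaleC c (T x)"
    and "\<And>x. norm (T x) \<le> K * norm x"
  shows "bop T"
  unfolding bop_def
proof (intro conjI allI)
  show "bounded_linear T"
    using assms by (intro bounded_linear_intro[where K = K]) (auto simp: scaleR_scaleC mult.commute)
qed (rule assms)

lemma bop_id: "bop (\<lambda>x. x)"
  by (simp add: bop_def bounded_linear_ident)

lemma bop_compose: "bop S \<Longrightarrow> bop T \<Longrightarrow> bop (\<lambda>x. S (T x))"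
  by (simp add: bop_def bounded_linear_compose)

lemma bop_plus: "bop S \<Longrightarrow> bop T \<Longrightarrow> bop (\<lambda>x. S x + T x)"
  by (simp add: bop_def bounded_linear_add scaleC_add_right)

lemma bop_minus: "bop S \<Longrightarrow> bop T \<Longrightarrow> bop (\<lambda>x. S x - T x)"
  by (simp add: bop_def bounded_linear_sub scaleC_diff_right)

lemma bop_scale: "bop T \<Longrightarrow> bop (\<lambda>x. r *\<^sub>R T x)"
  by (simp add: bop_def bounded_linear_const_scaleR scaleC_scaleR_commute)

lemma bop_Sum: "(\<And>i. i \<in> I \<Longrightarrow> bop (T i)) \<Longrightarrow> bop (\<lambda>x. \<Sum>i\<in>I. T i x)"
  by (auto simp: bop_def scaleC_sum_right intro!: bounded_linear_sum)

lemmas bop_intros = bop_id bop_compose bop_plus bop_minus bop_scale bop_Sum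

lemma nonneg_quadratic_linear_coeff_zero:
  fixes a b :: real
  assumes "a \<ge> 0" and q: "\<And>t. 0 \<le> t\<^sup>2 * a + 2 * t * b"
  shows "b = 0"
proof -
  \<comment> \<open>The minimising argument would be \<open>- b / a\<close>; the denominator
    \<open>a + 1\<close> also covers \<open>a = 0\<close>.\<close>
  define t where "t = b / (a + 1)"
  have b: "b = t * (a + 1)" using assms(1) by (simp add: t_def)
  have "0 \<le> - (t\<^sup>2 * (a + 2))"
    using q[of "- t"] by (simp add: b power2_eq_square algebra_simps)
  then have "t = 0" using assms(1) by (auto simp: mult_le_0_iff)
  then show ?thesis by (simp add: b)
qed

text \<open>The representing vector is the minimiser of \<open>\<parallel>x\<parallel>\<^sup>2 - 2 Re (f x)\<close>.\<close>

lemma Riesz_representation: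
  fixes f :: "'a::{complex_inner, complete_space} \<Rightarrow> complex"
  assumes f: "bounded_linear f" and fC: "\<And>c x. f (scaleC c x) = c * f x"
  shows "\<exists>z. \<forall>x. f x = cinner z x"
proof -
  interpret f: bounded_linear f by fact
  define g where "g x = (norm x)\<^sup>2 - 2 * Re (f x)" for x
  define m where "m = Inf (range g)"
  obtain K where K: "\<And>x. norm (f x) \<le> norm x * K" using f.bounded by blast
  \<comment> \<open>Completing the square: \<open>g x\<close> is at least
    \<open>(norm x - K)\<^sup>2 - K\<^sup>2\<close>.\<close>
  have "- K\<^sup>2 \<le> g x" for x
  proof -
    have "Re (f x) \<le> norm x * K" using K[of x] complex_Re_le_cmod[of "f x"] by linarith
    moreover have "0 \<le> (norm x - K)\<^sup>2" by simp
    ultimately show ?thesis by (simp add: g_def power2_diff)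
  qed
  then have bdd: "bdd_below (range g)" by (intro bdd_belowI[of _ "- K\<^sup>2"]) auto
  have m_le: "m \<le> g x" for x unfolding m_def using bdd by (intro cInf_lower) auto
  have "\<exists>x. g x < m + 1 / Suc n" for n
  proof -
    have "Inf (range g) < m + 1 / Suc n" by (simp add: m_def)
    then show ?thesis using cInf_lessD[of "range g"] by blast
  qed
  then obtain X where X: "\<And>n. g (X n) < m + 1 / Suc n" by metis
  \<comment> \<open>Parallelogram law for \<open>g\<close>; the linear part cancels. As
    \<open>g\<close> at the midpoint is at least \<open>m\<close>, a minimising sequence is
    Cauchy.\<close>
  have par: "(norm (x - y))\<^sup>2 = 2 * g x + 2 * g y - 4 * g ((1/2) *\<^sub>R (x + y))" for x y
  proof -
    have "(norm ((1/2) *\<^sub>R (x + y)))\<^sup>2 = (norm (x + y))\<^sup>2 / 4"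
      by (simp add: power_mult_distrib power2_eq_square)
    moreover have "Re (f ((1/2) *\<^sub>R (x + y))) = (Re (f x) + Re (f y)) / 2"
      by (simp only: f.scaleR f.add) simp
    ultimately show ?thesis
      unfolding g_def by (simp add: norm_diff_sq norm_add_sq algebra_simps)
  qed
  have dist_le: "(norm (X i - X j))\<^sup>2 \<le> 2 / Suc i + 2 / Suc j" for i j
    using par[of "X i" "X j"] X[of i] X[of j] m_le[of "(1/2) *\<^sub>R (X i + X j)"] by simp
  have "Cauchy X"
  proof (rule metric_CauchyI)
    fix e :: real assume "e > 0"
    then have "4 / e\<^sup>2 > 0" by simp
    obtain M :: nat where M: "4 / e\<^sup>2 < M" using reals_Archimedean2 by blast
    have MS: "4 / Suc M < e\<^sup>2"
    proof -
      have "4 < real M * e\<^sup>2" using M \<open>e > 0\<close> by (simp add: field_simps)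
      also have "\<dots> \<le> real (Suc M) * e\<^sup>2" by (simp add: mult_right_mono)
      finally show ?thesis by (simp add: field_simps del: of_nat_Suc)
    qed
    show "\<exists>M. \<forall>i\<ge>M. \<forall>j\<ge>M. dist (X i) (X j) < e"
    proof (intro exI[of _ M] allI impI)
      fix i j assume "M \<le> i" "M \<le> j"
      then have "2 / real (Suc i) \<le> 2 / Suc M" "2 / real (Suc j) \<le> 2 / Suc M"
        by (auto intro!: divide_left_mono)
      then have "(norm (X i - X j))\<^sup>2 < e\<^sup>2" using dist_le[of i j] MS by simp
      then show "dist (X i) (X j) < e"
        using \<open>e > 0\<close> by (simp add: dist_norm power2_less_imp_less)
    qed
  qed
  then obtain z where z: "X \<longlonglongrightarrow> z" using Cauchy_convergent convergent_def by blast
  have "(\<lambda>n. g (X n)) \<longlonglongrightarrow> g z"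
    unfolding g_def by (intro tendsto_intros z f.tendsto)
  moreover have "(\<lambda>n. m + 1 / Suc n) \<longlonglongrightarrow> m + 0"
    by (intro tendsto_intros LIMSEQ_Suc lim_1_over_n)
  ultimately have "g z \<le> m + 0"
    using X by (intro LIMSEQ_le[of "\<lambda>n. g (X n)" _ "\<lambda>n. m + 1 / Suc n"]) (auto intro: less_imp_le)
  then have min: "g z \<le> g x" for x using m_le[of x] by simp
  have re: "Re (cinner z h) = Re (f h)" for h
  proof -
    have "Re (cinner z h) - Re (f h) = 0"
    proof (rule nonneg_quadratic_linear_coeff_zero[where a = "(norm h)\<^sup>2"])
      show "0 \<le> t\<^sup>2 * (norm h)\<^sup>2 + 2 * t * (Re (cinner z h) - Re (f h))" for t
        using min[of "z + t *\<^sub>R h"]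
        by (simp add: g_def norm_add_sq f.add f.scaleR cinner_scaleR_right power_mult_distrib algebra_simps)
    qed simp
    then show ?thesis by simp
  qed
  \<comment> \<open>The first variation gives only real parts; testing it on
    \<open>scaleC \<i> h\<close> recovers the imaginary part.\<close>
  have "f h = cinner z h" for h
    using re[of h] re[of "scaleC \<i> h"] by (simp add: complex_eq_iff cinner_scaleC_right fC)
  then show ?thesis by blast
qed

text \<open>Adjoints are computed by exhibiting a candidate: uniqueness needs only that vectors are
  separated by the inner product, not completeness.\<close>

lemma adj_unique:
  fixes T :: "'a::complex_inner \<Rightarrow> 'a"
  assumes "\<And>x y. cinner (T x) y = cinner x (S y)"
  shows "adj T = S"
  unfolding adj_def
proof (rule the_equality)
  show "\<forall>x y. cinner (T x) y = cinner x (S y)" using assms by blast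
next
  fix R assume R: "\<forall>x y. cinner (T x) y = cinner x (R y)"
  show "R = S"
    by (rule ext, rule cinner_ext_right) (metis R assms)
qed

text \<open>Riesz applied to \<open>cinner y (T x)\<close>, which is complex linear in
  \<open>x\<close> because the inner product is linear in its second argument.\<close>

lemma cinner_adj_right:
  fixes T :: "'a::{complex_inner, complete_space} \<Rightarrow> 'a"
  assumes T: "bop T"
  shows "cinner (T x) y = cinner x (adj T y)"
proof -
  have "\<exists>z. \<forall>x. cinner y (T x) = cinner z x" for y
    using bop_bounded_linear[OF T]
    by (intro Riesz_representation cinner.bounded_linear_right
        bounded_linear_compose[of "cinner y" T, OF cinner.bounded_linear_right])
      (auto simp: bop_scaleC[OF T] cinner_scaleC_right)
  then obtain S where S: "\<And>x y. cinner y (T x) = cinner (S y) x" by metis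
  then have "cinner (T x) y = cinner x (S y)" for x y by (metis cinner_commute)
  then show ?thesis using adj_unique[of T S] by simp
qed

lemma cinner_adj_left:
  fixes T :: "'a::{complex_inner, complete_space} \<Rightarrow> 'a"
  assumes T: "bop T"
  shows "cinner (adj T x) y = cinner x (T y)"
  by (metis T cinner_adj_right cinner_commute)

lemma norm_adj_le:
  fixes T :: "'a::{complex_inner, complete_space} \<Rightarrow> 'a"
  assumes T: "bop T"
  shows "norm (adj T x) \<le> onorm T * norm x"
proof -
  have "(norm (adj T x))\<^sup>2 = Re (cinner x (T (adj T x)))"
    by (simp add: Re_cinner_self[symmetric] cinner_adj_left[OF T])
  also have "\<dots> \<le> norm x * (onorm T * norm (adj T x))"
    by (rule order_trans[OF Re_cinner_le]) (simp add: mult_left_mono bop_norm_le[OF T])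
  finally have "norm (adj T x) * norm (adj T x) \<le> (onorm T * norm x) * norm (adj T x)"
    by (simp add: power2_eq_square algebra_simps)
  then show ?thesis
    using bop_onorm_pos[OF T] by (cases "norm (adj T x) = 0") auto
qed

lemma bop_adj:
  fixes T :: "'a::{complex_inner, complete_space} \<Rightarrow> 'a"
  assumes T: "bop T"
  shows "bop (adj T)"
proof (rule bop_intro)
  show "adj T (x + y) = adj T x + adj T y" for x y
    by (rule cinner_ext_right) (simp add: cinner_adj_right[OF T, symmetric] cinner_add_right)
  show "adj T (scaleC c x) = scaleC c (adj T x)" for c x
    by (rule cinner_ext_right) (simp add: cinner_adj_right[OF T, symmetric] cinner_scaleC_right)
qed (rule norm_adj_le[OF T])

lemma onorm_adj_le:
  fixes T :: "'a::{complex_inner, complete_space} \<Rightarrow> 'a"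
  assumes T: "bop T"
  shows "onorm (adj T) \<le> onorm T"
  using norm_adj_le[OF T] bop_onorm_pos[OF T] by (intro onorm_bound) auto

lemma adj_adj:
  fixes T :: "'a::{complex_inner, complete_space} \<Rightarrow> 'a"
  assumes "bop T" shows "adj (adj T) = T"
  by (rule adj_unique) (rule cinner_adj_left[OF assms])

lemma adj_compose:
  fixes T :: "'a::{complex_inner, complete_space} \<Rightarrow> 'a"
  assumes "bop S" "bop T"
  shows "adj (\<lambda>x. S (T x)) = (\<lambda>x. adj T (adj S x))"
  by (rule adj_unique) (simp add: cinner_adj_right[OF assms(1)] cinner_adj_right[OF assms(2)])

lemma adj_scaleR:
  fixes T :: "'a::{complex_inner, complete_space} \<Rightarrow> 'a"
  assumes "bop T"
  shows "adj (\<lambda>x. r *\<^sub>R T x) = (\<lambda>x. r *\<^sub>R adj T x)"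
  by (rule adj_unique) (simp add: cinner_scaleR_left cinner_scaleR_right cinner_adj_right[OF assms])

lemma adj_Sum:
  fixes T :: "'i \<Rightarrow> 'a::{complex_inner, complete_space} \<Rightarrow> 'a"
  assumes "\<And>i. i \<in> I \<Longrightarrow> bop (T i)"
  shows "adj (\<lambda>x. \<Sum>i\<in>I. T i x) = (\<lambda>x. \<Sum>i\<in>I. adj (T i) x)"
  by (rule adj_unique) (simp add: cinner.sum_left cinner.sum_right cinner_adj_right[OF assms])

subsection \<open>Positive operators and square roots\<close>

lemma pos_op_bop: "pos_op T \<Longrightarrow> bop T"
  by (simp add: pos_op_def)

lemma pos_op_nonneg: "pos_op T \<Longrightarrow> 0 \<le> Re (cinner (T x) x)"
  by (simp add: pos_op_def)

text \<open>\<open>pos_op\<close> only asks for a real quadratic form. Symmetry follows by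
  polarisation: \<open>x + y\<close> yields the imaginary part and \<open>x + scaleC \<i> y\<close>
  the real part.\<close>

lemma pos_op_selfadjoint:
  assumes T: "pos_op T"
  shows "cinner (T x) y = cinner x (T y)"
proof -
  have b: "bop T" using T by (rule pos_op_bop)
  have im: "Im (cinner (T u) u) = 0" for u using T by (simp add: pos_op_def)
  have "Im (cinner (T x) y + cinner (T y) x) = 0"
    using im[of "x + y"] im[of x] im[of y]
    by (simp add: bop_add[OF b] cinner_add_left cinner_add_right)
  moreover have "Re (cinner (T x) y) = Re (cinner (T y) x)"
    using im[of "x + scaleC \<i> y"] im[of x] im[of y]
    by (simp add: bop_add[OF b] bop_scaleC[OF b] cinner_add_left cinner_add_right
        cinner_scaleC_left cinner_scaleC_right)
  moreover have "cinner x (T y) = cnj (cinner (T y) x)" by (rule cinner_commute)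
  ultimately show ?thesis by (simp add: complex_eq_iff)
qed

lemma pos_opI:
  assumes "bop T" "\<And>x y. cinner (T x) y = cinner x (T y)" "\<And>x. 0 \<le> Re (cinner (T x) x)"
  shows "pos_op T"
  unfolding pos_op_def
proof (intro conjI allI)
  fix x
  have "cinner (T x) x = cnj (cinner (T x) x)" by (metis assms(2) cinner_commute)
  from arg_cong[OF this, of Im] show "Im (cinner (T x) x) = 0" by simp
qed (use assms in auto)

lemma adj_pos_op: "pos_op T \<Longrightarrow> adj T = T"
  by (rule adj_unique) (rule pos_op_selfadjoint)

lemma pos_op_scale: "pos_op T \<Longrightarrow> 0 \<le> r \<Longrightarrow> pos_op (\<lambda>x. r *\<^sub>R T x)"
  by (auto simp: pos_op_def cinner_scaleR_left intro: bop_scale)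

lemma pos_op_shift:
  assumes "pos_op T" "0 \<le> r"
  shows "pos_op (\<lambda>x. r *\<^sub>R x + T x)"
  using assms bop_plus[OF bop_scale[OF bop_id, of r], of T]
  by (auto simp: pos_op_def cinner_scaleR_left cinner_add_left cinner_self)

lemma pos_op_Sum:
  assumes "\<And>i. i \<in> I \<Longrightarrow> pos_op (T i)"
  shows "pos_op (\<lambda>x. \<Sum>i\<in>I. T i x)"
  using assms by (auto simp: pos_op_def cinner.sum_left sum_nonneg intro!: bop_Sum)

lemma pos_op_adj_comp:
  fixes T :: "'a::{complex_inner, complete_space} \<Rightarrow> 'a"
  assumes "bop T"
  shows "pos_op (\<lambda>x. adj T (T x))"
  using assms
  by (auto simp: pos_op_def cinner_adj_left Re_cinner_self cinner_self intro: bop_compose bop_adj)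

text \<open>The operator inequality "T squared is at most T", read off from positivity of the form
  at \<open>x - T x\<close>.\<close>

lemma pos_contraction_norm_sq_le:
  assumes T: "pos_op T" and c: "\<And>x. norm (T x) \<le> norm x"
  shows "(norm (T x))\<^sup>2 \<le> Re (cinner (T x) x)"
proof -
  note b = pos_op_bop[OF T]
  have "0 \<le> Re (cinner (T (x - T x)) (x - T x))" by (rule pos_op_nonneg[OF T])
  also have "\<dots> = Re (cinner (T x) x) - 2 * (norm (T x))\<^sup>2 + Re (cinner (T (T x)) (T x))"
    by (simp add: bop_diff[OF b] cinner_diff_left cinner_diff_right
        pos_op_selfadjoint[OF T, of "T x" x] Re_cinner_self)
  also have "Re (cinner (T (T x)) (T x)) \<le> norm (T x) * norm (T x)"
    by (rule order_trans[OF Re_cinner_le]) (simp add: c mult_right_mono)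
  finally show ?thesis by (simp add: power2_eq_square)
qed

lemma pos_op_normalize:
  assumes T: "pos_op T"
  shows "\<exists>M>0. pos_op (\<lambda>x. (1 / M) *\<^sub>R T x) \<and> (\<forall>x. norm ((1 / M) *\<^sub>R T x) \<le> norm x)"
proof (intro exI[of _ "onorm T + 1"] conjI allI)
  note b = pos_op_bop[OF T]
  show M: "onorm T + 1 > 0" using bop_onorm_pos[OF b] by simp
  then show "pos_op (\<lambda>x. (1 / (onorm T + 1)) *\<^sub>R T x)" by (intro pos_op_scale T) auto
  fix x
  have "norm (T x) \<le> (onorm T + 1) * norm x"
    using bop_norm_le[OF b, of x] by (simp add: distrib_right add_increasing2)
  then show "norm ((1 / (onorm T + 1)) *\<^sub>R T x) \<le> norm x"
    using M by (simp add: field_simps)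
qed

text \<open>After rescaling to a contraction, the form dominates the squared norm of the image. This
  is what makes square roots unique.\<close>

lemma pos_op_kernel:
  assumes T: "pos_op T" and "Re (cinner (T x) x) = 0"
  shows "T x = 0"
proof -
  obtain M where M: "M > 0" "pos_op (\<lambda>x. (1 / M) *\<^sub>R T x)" "\<And>x. norm ((1 / M) *\<^sub>R T x) \<le> norm x"
    using pos_op_normalize[OF T] by blast
  have "(norm ((1 / M) *\<^sub>R T x))\<^sup>2 \<le> Re (cinner ((1 / M) *\<^sub>R T x) x)"
    by (rule pos_contraction_norm_sq_le[OF M(2,3)])
  also have "\<dots> = 0" by (simp add: cinner_scaleR_left assms(2))
  finally show ?thesis using M(1) by simp
qed

text \<open>For a positive contraction \<open>T\<close> the iterates converge to a solution of
  \<open>2 Y = (I - T) + Y\<^sup>2\<close>, i.e. \<open>(I - Y)\<^sup>2 = T\<close>.  The scalar sequence is the same iteration with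
  \<open>I - T\<close> replaced by \<open>1\<close>; it majorises the increments in norm.\<close>

primrec sqrt_iter :: "('a::complex_inner \<Rightarrow> 'a) \<Rightarrow> nat \<Rightarrow> 'a \<Rightarrow> 'a" where
  "sqrt_iter T 0 = (\<lambda>x. 0)"
| "sqrt_iter T (Suc n) = (\<lambda>x. (1/2) *\<^sub>R ((x - T x) + sqrt_iter T n (sqrt_iter T n x)))"

primrec sqrt_majorant :: "nat \<Rightarrow> real" where
  "sqrt_majorant 0 = 0"
| "sqrt_majorant (Suc n) = (1 + (sqrt_majorant n)\<^sup>2) / 2"

lemma sqrt_majorant_nonneg: "0 \<le> sqrt_majorant n"
  by (cases n) auto

lemma sqrt_majorant_le_1: "sqrt_majorant n \<le> 1"
proof (induction n)
  case (Suc n)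
  then have "(sqrt_majorant n)\<^sup>2 \<le> 1" using sqrt_majorant_nonneg[of n] by (simp add: power_le_one)
  then show ?case by simp
qed simp

lemma sqrt_majorant_Suc_ge: "sqrt_majorant n \<le> sqrt_majorant (Suc n)"
proof -
  have "0 \<le> (1 - sqrt_majorant n)\<^sup>2" by simp
  then show ?thesis by (simp add: power2_diff)
qed

lemma sqrt_majorant_convergent: "convergent sqrt_majorant"
proof -
  have "incseq sqrt_majorant" using sqrt_majorant_Suc_ge by (rule incseq_SucI)
  moreover have "Bseq sqrt_majorant"
    using sqrt_majorant_nonneg sqrt_majorant_le_1 by (intro BseqI'[of _ 1]) auto
  ultimately show ?thesis by (simp add: Bseq_monoseq_convergent monoseq_iff)
qed

text \<open>The commutation clause is carried along for the sake of uniqueness: whatever commutes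
  with \<open>T\<close> commutes with every iterate, hence with the limit.\<close>

lemma pos_contraction_sqrt:
  fixes T :: "'a::{complex_inner, complete_space} \<Rightarrow> 'a"
  assumes T: "pos_op T" and c: "\<And>x. norm (T x) \<le> norm x"
  shows "\<exists>S. pos_op S \<and> S \<circ> S = T \<and>
    (\<forall>R. bop R \<longrightarrow> (\<forall>x. R (T x) = T (R x)) \<longrightarrow> (\<forall>x. R (S x) = S (R x)))"
proof -
  note b = pos_op_bop[OF T]
  let ?Y = "sqrt_iter T" and ?y = sqrt_majorant
  have Yb: "bop (?Y n)" for n
  proof (induction n)
    case 0
    then show ?case by (auto intro: bop_intro[where K = 0] simp: norm_scaleC simp flip: norm_le_zero_iff)
  next
    case (Suc n)
    have "bop (\<lambda>x. x - T x)" by (rule bop_minus[OF bop_id b])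
    then show ?case using Suc by (simp del: scaleR_half_double add: bop_intros)
  qed
  \<comment> \<open>Expanding the square, \<open>norm (T x)\<close> squared is absorbed by one of
    the two copies of the form of \<open>T\<close>.\<close>
  have I_T: "norm (x - T x) \<le> norm x" for x
  proof -
    have "(norm (x - T x))\<^sup>2 \<le> (norm x)\<^sup>2"
      unfolding norm_diff_sq using pos_contraction_norm_sq_le[OF T c, of x] pos_op_nonneg[OF T, of x]
      by (simp add: Re_cinner_commute[of x])
    then show ?thesis by simp
  qed
  have Yn: "norm (?Y n x) \<le> ?y n * norm x" for n x
  proof (induction n arbitrary: x)
    case (Suc n)
    have "norm (?Y n (?Y n x)) \<le> ?y n * (?y n * norm x)"
      using Suc[of "?Y n x"] Suc[of x] sqrt_majorant_nonneg[of n]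
      by (meson mult_left_mono order_trans)
    then have "norm ((x - T x) + ?Y n (?Y n x)) \<le> norm x + ?y n * (?y n * norm x)"
      using I_T[of x] by (intro norm_triangle_le) simp
    then show ?case
      by (simp add: power2_eq_square distrib_right mult.assoc divide_right_mono del: scaleR_right_diff_distrib)
  qed simp
  have step: "norm (?Y (Suc n) x - ?Y n x) \<le> (?y (Suc n) - ?y n) * norm x" for n x
  proof (induction n arbitrary: x)
    case 0
    then show ?case using I_T[of x] by simp
  next
    case (Suc n)
    let ?d = "?y (Suc n) - ?y n"
    have d: "0 \<le> ?d" using sqrt_majorant_Suc_ge[of n] by simp
    \<comment> \<open>The difference of squares is factored without commuting the iterates, as
      \<open>Y' (Y' - Y) + (Y' - Y) Y\<close>. Its bound reproduces the scalar factorisation of the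
      majorant.\<close>
    have split: "?Y (Suc (Suc n)) x - ?Y (Suc n) x =
      (1/2) *\<^sub>R (?Y (Suc n) (?Y (Suc n) x - ?Y n x) + (?Y (Suc n) (?Y n x) - ?Y n (?Y n x)))"
      by (simp only: bop_diff[OF Yb] sqrt_iter.simps(2)[of T "Suc n"])
        (simp add: scaleR_diff_right[symmetric] scaleR_add_right[symmetric] del: sqrt_iter.simps(2),
          simp add: scaleR_diff_right scaleR_add_right)
    have "norm (?Y (Suc n) (?Y (Suc n) x - ?Y n x)) \<le> ?y (Suc n) * (?d * norm x)"
      using Yn[of "Suc n" "?Y (Suc n) x - ?Y n x"] Suc[of x] sqrt_majorant_nonneg[of "Suc n"]
      by (meson mult_left_mono order_trans)
    moreover have "norm (?Y (Suc n) (?Y n x) - ?Y n (?Y n x)) \<le> ?d * (?y n * norm x)"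
      using Suc[of "?Y n x"] Yn[of n x] d by (meson mult_left_mono order_trans)
    ultimately have "norm (?Y (Suc n) (?Y (Suc n) x - ?Y n x) + (?Y (Suc n) (?Y n x) - ?Y n (?Y n x)))
        \<le> ?y (Suc n) * (?d * norm x) + ?d * (?y n * norm x)"
      by (rule norm_triangle_mono)
    also have "\<dots> = 2 * ((?y (Suc (Suc n)) - ?y (Suc n)) * norm x)"
    proof -
      have "?y (Suc (Suc n)) - ?y (Suc n) = ((?y (Suc n))\<^sup>2 - (?y n)\<^sup>2) / 2"
        unfolding sqrt_majorant.simps(2)[of "Suc n"] by (subst (2) sqrt_majorant.simps(2)) (simp add: field_simps)
      then show ?thesis by (simp only:) (simp add: power2_eq_square algebra_simps del: sqrt_majorant.simps)
    qed
    finally show ?case unfolding split by simp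
  qed
  have dist_le: "norm (?Y m x - ?Y n x) \<le> (?y m - ?y n) * norm x" if "n \<le> m" for m n x
    using that
  proof (induction m rule: dec_induct)
    case (step m)
    have "norm (?Y (Suc m) x - ?Y n x) \<le> norm (?Y (Suc m) x - ?Y m x) + norm (?Y m x - ?Y n x)"
      using norm_triangle_ineq[of "?Y (Suc m) x - ?Y m x" "?Y m x - ?Y n x"] by (simp del: sqrt_iter.simps)
    also have "\<dots> \<le> (?y (Suc m) - ?y m) * norm x + (?y m - ?y n) * norm x"
      using \<open>\<And>n x. norm (?Y (Suc n) x - ?Y n x) \<le> (?y (Suc n) - ?y n) * norm x\<close>[of m x] step.IH
      by (rule add_mono)
    finally show ?case by (simp only: distrib_right[symmetric]) (simp del: sqrt_iter.simps sqrt_majorant.simps)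
  qed simp
  have "convergent (\<lambda>n. ?Y n x)" for x
  proof -
    have "Cauchy (\<lambda>n. ?Y n x)"
    proof (rule metric_CauchyI)
      fix e :: real assume "e > 0"
      have "convergent (\<lambda>n. ?y n * norm x)"
        using sqrt_majorant_convergent by (auto simp: convergent_def intro: tendsto_mult_right)
      then have "Cauchy (\<lambda>n. ?y n * norm x)" by (rule convergent_Cauchy)
      then obtain M where M: "\<And>m n. m \<ge> M \<Longrightarrow> n \<ge> M \<Longrightarrow> dist (?y m * norm x) (?y n * norm x) < e"
        using \<open>e > 0\<close> by (meson metric_CauchyD)
      have *: "dist (?Y m x) (?Y n x) < e" if "m \<ge> n" "n \<ge> M" for m n
        using dist_le[OF that(1), of x] M[of m n] that
        by (simp add: dist_norm left_diff_distrib abs_less_iff)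
      show "\<exists>M. \<forall>m\<ge>M. \<forall>n\<ge>M. dist (?Y m x) (?Y n x) < e"
        using * by (metis dist_commute nle_le)
    qed
    then show ?thesis by (rule Cauchy_convergent)
  qed
  then obtain Z where Z: "\<And>x. (\<lambda>n. ?Y n x) \<longlonglongrightarrow> Z x"
    unfolding convergent_def by metis
  have Zn: "norm (Z x) \<le> norm x" for x
  proof (rule LIMSEQ_le_const2[OF tendsto_norm[OF Z]], intro exI allI impI)
    show "norm (?Y n x) \<le> norm x" for n
      using Yn[of n x] mult_right_mono[OF sqrt_majorant_le_1[of n], of "norm x"] by simp
  qed
  have Zb: "bop Z"
  proof (rule bop_intro)
    show "Z (x + y) = Z x + Z y" for x y
      using tendsto_add[OF Z[of x] Z[of y]] Z[of "x + y"]
      by (simp add: bop_add[OF Yb] LIMSEQ_unique)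
    show "Z (scaleC r x) = scaleC r (Z x)" for r x
    proof -
      have "bounded_linear (scaleC r :: 'a \<Rightarrow> 'a)"
        by (rule bounded_linear_intro[where K = "norm r"])
          (auto simp: scaleC_add_right scaleC_scaleR_commute norm_scaleC mult.commute)
      from bounded_linear.tendsto[OF this Z[of x]] show ?thesis
        using Z[of "scaleC r x"] by (simp add: bop_scaleC[OF Yb] LIMSEQ_unique)
    qed
    show "norm (Z x) \<le> 1 * norm x" for x using Zn by simp
  qed
  \<comment> \<open>Pointwise convergence passes to the product because the iterates are uniformly
    contractive: split \<open>?Y n x\<close> into its error against \<open>Z x\<close> and
    \<open>Z x\<close> itself.\<close>
  have YY: "(\<lambda>n. ?Y n (?Y n x)) \<longlonglongrightarrow> Z (Z x)" for x
  proof -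
    have "(\<lambda>n. ?Y n (?Y n x - Z x)) \<longlonglongrightarrow> 0"
    proof (rule tendsto_norm_zero_cancel, rule tendsto_0_le[where K = 1])
      show "(\<lambda>n. norm (?Y n x - Z x)) \<longlonglongrightarrow> 0"
        using Z[of x] by (simp add: LIM_zero tendsto_norm_zero)
      have "norm (?Y n (?Y n x - Z x)) \<le> norm (?Y n x - Z x)" for n
        using Yn[of n "?Y n x - Z x"]
          mult_right_mono[OF sqrt_majorant_le_1[of n], of "norm (?Y n x - Z x)"] by simp
      then show "\<forall>\<^sub>F n in sequentially.
          norm (norm (?Y n (?Y n x - Z x))) \<le> norm (norm (?Y n x - Z x)) * 1" by simp
    qed
    from tendsto_add[OF this Z[of "Z x"]] show ?thesis by (simp add: bop_diff[OF Yb])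
  qed
  have fixpt: "Z x = (1/2) *\<^sub>R ((x - T x) + Z (Z x))" for x
  proof (rule LIMSEQ_unique)
    show "(\<lambda>n. ?Y (Suc n) x) \<longlonglongrightarrow> Z x" using Z by (rule LIMSEQ_Suc)
    show "(\<lambda>n. ?Y (Suc n) x) \<longlonglongrightarrow> (1/2) *\<^sub>R ((x - T x) + Z (Z x))"
      unfolding sqrt_iter.simps(2) by (intro tendsto_intros YY)
  qed
  have Ysa: "cinner (?Y n x) y = cinner x (?Y n y)" for n x y
  proof (induction n arbitrary: x y)
    case (Suc n)
    then show ?case
      by (simp add: cinner_scaleR_left cinner_scaleR_right cinner_add_left cinner_add_right
          cinner_diff_left cinner_diff_right pos_op_selfadjoint[OF T])
  qed (simp add: cinner.zero_left cinner.zero_right)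
  have Zsa: "cinner (Z x) y = cinner x (Z y)" for x y
    by (rule LIMSEQ_unique[OF cinner.tendsto[OF Z[of x] tendsto_const[of y]]])
      (use cinner.tendsto[OF tendsto_const[of x] Z[of y]] in \<open>simp add: Ysa\<close>)
  define S where "S x = x - Z x" for x
  have "pos_op S"
  proof (rule pos_opI)
    show "bop S" unfolding S_def by (rule bop_minus[OF bop_id Zb])
    show "cinner (S x) y = cinner x (S y)" for x y
      by (simp add: S_def cinner_diff_left cinner_diff_right Zsa)
    \<comment> \<open>Cauchy-Schwarz with \<open>norm (Z x) \<le> norm x\<close> keeps
      \<open>I - Z\<close> positive.\<close>
    show "0 \<le> Re (cinner (S x) x)" for x
      using Re_cinner_le[of "Z x" x] mult_right_mono[OF Zn[of x] norm_ge_zero[of x]]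
      by (simp add: S_def cinner_diff_left Re_cinner_self power2_eq_square)
  qed
  moreover have "S \<circ> S = T"
  proof
    fix x
    have "2 *\<^sub>R Z x = (x - T x) + Z (Z x)"
      using fixpt[of x] by (metis (no_types, lifting) scaleR_half_double scaleR_scaleR scaleR_2 scaleR_add_right scaleR_left.add)
    then show "(S \<circ> S) x = T x"
      by (simp add: S_def bop_diff[OF Zb] scaleR_2 algebra_simps)
  qed
  moreover have "R (S x) = S (R x)" if R: "bop R" "\<And>x. R (T x) = T (R x)" for R x
  proof -
    have "R (?Y n x) = ?Y n (R x)" for n x
      by (induction n arbitrary: x)
        (simp_all add: bop_zero[OF R(1)] bop_scaleR[OF R(1)] bop_add[OF R(1)] bop_diff[OF R(1)] R(2))
    then have "R (Z x) = Z (R x)"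
      using bounded_linear.tendsto[OF bop_bounded_linear[OF R(1)] Z[of x]] Z[of "R x"]
      by (simp add: LIMSEQ_unique)
    then show ?thesis by (simp add: S_def bop_diff[OF R(1)])
  qed
  ultimately show ?thesis by blast
qed

lemma pos_op_sqrt_exists:
  fixes T :: "'a::{complex_inner, complete_space} \<Rightarrow> 'a"
  assumes T: "pos_op T"
  shows "\<exists>S. pos_op S \<and> S \<circ> S = T \<and>
    (\<forall>R. bop R \<longrightarrow> (\<forall>x. R (T x) = T (R x)) \<longrightarrow> (\<forall>x. R (S x) = S (R x)))"
proof -
  obtain M where M: "M > 0" "pos_op (\<lambda>x. (1 / M) *\<^sub>R T x)" "\<And>x. norm ((1 / M) *\<^sub>R T x) \<le> norm x"
    using pos_op_normalize[OF T] by blast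
  obtain S where S: "pos_op S" "S \<circ> S = (\<lambda>x. (1 / M) *\<^sub>R T x)"
    and comm: "\<And>R x. bop R \<Longrightarrow> (\<And>x. R ((1 / M) *\<^sub>R T x) = (1 / M) *\<^sub>R T (R x)) \<Longrightarrow> R (S x) = S (R x)"
    using pos_contraction_sqrt[OF M(2,3)] by blast
  have SS: "S (S x) = (1 / M) *\<^sub>R T x" for x using fun_cong[OF S(2), of x] by simp
  show ?thesis
  proof (intro exI conjI allI impI)
    show "pos_op (\<lambda>x. sqrt M *\<^sub>R S x)" using M(1) by (intro pos_op_scale S(1)) simp
    show "(\<lambda>x. sqrt M *\<^sub>R S x) \<circ> (\<lambda>x. sqrt M *\<^sub>R S x) = T"
      using M(1) by (auto simp: fun_eq_iff bop_scaleR[OF pos_op_bop[OF S(1)]] SS)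
    show "R (sqrt M *\<^sub>R S x) = sqrt M *\<^sub>R S (R x)"
      if R: "bop R" "\<forall>x. R (T x) = T (R x)" for R x
      using comm[of R x] R by (simp add: bop_scaleR[OF R(1)])
  qed
qed

text \<open>Any root \<open>R\<close> commutes with \<open>T\<close>, hence with the constructed
  root \<open>S\<close>. On \<open>y = S x - R x\<close> the sum \<open>S + R\<close> vanishes; both
  forms are nonnegative, so \<open>S y\<close> and \<open>R y\<close> vanish and \<open>y\<close> is
  orthogonal to itself.\<close>

lemma pos_op_sqrt_unique:
  fixes T :: "'a::{complex_inner, complete_space} \<Rightarrow> 'a"
  assumes T: "pos_op T"
  shows "\<exists>!S. pos_op S \<and> S \<circ> S = T"
proof -
  obtain S where S: "pos_op S" "S \<circ> S = T"
    and comm: "\<And>R x. bop R \<Longrightarrow> (\<And>x. R (T x) = T (R x)) \<Longrightarrow> R (S x) = S (R x)"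
    using pos_op_sqrt_exists[OF T] by blast
  have SS: "S (S x) = T x" for x using fun_cong[OF S(2), of x] by simp
  have "R = S" if R: "pos_op R" "R \<circ> R = T" for R
  proof
    fix x
    note bS = pos_op_bop[OF S(1)] and bR = pos_op_bop[OF R(1)]
    have RR: "R (R x) = T x" for x using fun_cong[OF R(2), of x] by simp
    have "R (T x) = T (R x)" for x by (simp flip: RR)
    then have RS: "R (S x) = S (R x)" for x using comm[OF bR] by blast
    define y where "y = S x - R x"
    have "S y + R y = 0"
      by (simp add: y_def bop_diff[OF bS] bop_diff[OF bR] SS RR RS)
    then have "Re (cinner (S y) y) + Re (cinner (R y) y) = 0"
      by (metis cinner_add_left cinner.zero_left plus_complex.simps(1) zero_complex.simps(1))
    then have "Re (cinner (S y) y) = 0" "Re (cinner (R y) y) = 0"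
      using pos_op_nonneg[OF S(1), of y] pos_op_nonneg[OF R(1), of y] by linarith+
    then have z: "S y = 0" "R y = 0" using pos_op_kernel S(1) R(1) by blast+
    have "cinner y y = cinner x (S y) - cinner x (R y)"
      by (subst (1) y_def)
        (simp add: cinner_diff_left pos_op_selfadjoint[OF S(1)] pos_op_selfadjoint[OF R(1)])
    then have "y = 0" using z by (simp add: cinner.zero_right cinner_eq_zero_iff)
    then show "R x = S x" by (simp add: y_def)
  qed
  then show ?thesis using S by blast
qed

lemma
  fixes T :: "'a::{complex_inner, complete_space} \<Rightarrow> 'a"
  assumes T: "pos_op T"
  shows pos_op_sqrt_op: "pos_op (sqrt_op T)"
    and sqrt_op_sqrt_op: "sqrt_op T (sqrt_op T x) = T x"
proof -
  have *: "pos_op (sqrt_op T) \<and> sqrt_op T \<circ> sqrt_op T = T"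
    unfolding sqrt_op_def by (rule theI'[OF pos_op_sqrt_unique[OF T]])
  then show "pos_op (sqrt_op T)" by blast
  show "sqrt_op T (sqrt_op T x) = T x" using fun_cong[OF conjunct2[OF *], of x] by simp
qed

lemma norm_sqrt_op_sq:
  fixes T :: "'a::{complex_inner, complete_space} \<Rightarrow> 'a"
  assumes T: "pos_op T"
  shows "(norm (sqrt_op T x))\<^sup>2 = Re (cinner (T x) x)"
  by (metis Re_cinner_self T pos_op_selfadjoint pos_op_sqrt_op sqrt_op_sqrt_op)

lemma
  fixes T :: "'a::{complex_inner, complete_space} \<Rightarrow> 'a"
  assumes T: "bop T"
  shows pos_op_abs_op: "pos_op (abs_op T)"
    and norm_abs_op: "norm (abs_op T x) = norm (T x)"
    and abs_op_abs_op: "abs_op T (abs_op T x) = adj T (T x)"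
proof -
  have p: "pos_op (adj T \<circ> T)" using pos_op_adj_comp[OF T] by (simp add: comp_def)
  show "pos_op (abs_op T)" unfolding abs_op_def by (rule pos_op_sqrt_op[OF p])
  show "abs_op T (abs_op T x) = adj T (T x)" unfolding abs_op_def by (simp add: sqrt_op_sqrt_op[OF p])
  have "(norm (abs_op T x))\<^sup>2 = (norm (T x))\<^sup>2"
    unfolding abs_op_def by (simp add: norm_sqrt_op_sq[OF p] cinner_adj_left[OF T] Re_cinner_self)
  then show "norm (abs_op T x) = norm (T x)" by simp
qed

section \<open>Invertibility of shifted positive operators and of their roots\<close>

lemma pos_op_coercive_bij:
  fixes T :: "'a::{complex_inner, complete_space} \<Rightarrow> 'a"
  assumes T: "pos_op T" and e: "\<epsilon> > 0" and coerc: "\<And>x. \<epsilon> * (norm x)\<^sup>2 \<le> Re (cinner (T x) x)"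
  shows "bij T"
proof -
  obtain M where M: "M > 0" "pos_op (\<lambda>x. (1 / M) *\<^sub>R T x)" "\<And>x. norm ((1 / M) *\<^sub>R T x) \<le> norm x"
    using pos_op_normalize[OF T] by blast
  note b = pos_op_bop[OF T]
  \<comment> \<open>Coercivity of \<open>T / M\<close>, capped at 1 so that
    \<open>sqrt (1 - d)\<close> is a legitimate contraction factor.\<close>
  define d where "d = min (\<epsilon> / M) 1"
  have d: "0 < d" "d \<le> 1" using M e by (auto simp: d_def)
  have contr: "norm (x - (1 / M) *\<^sub>R T x) \<le> sqrt (1 - d) * norm x" for x
  proof -
    have "(norm (x - (1 / M) *\<^sub>R T x))\<^sup>2 \<le> (norm x)\<^sup>2 - Re (cinner ((1 / M) *\<^sub>R T x) x)"
      unfolding norm_diff_sq using pos_contraction_norm_sq_le[OF M(2,3), of x]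
      by (simp add: Re_cinner_commute[of x])
    also have "\<dots> \<le> (norm x)\<^sup>2 - d * (norm x)\<^sup>2"
    proof -
      have "d * (norm x)\<^sup>2 \<le> (\<epsilon> / M) * (norm x)\<^sup>2" by (rule mult_right_mono) (auto simp: d_def)
      also have "\<dots> \<le> Re (cinner ((1 / M) *\<^sub>R T x) x)"
        using coerc[of x] M(1) by (simp add: cinner_scaleR_left divide_right_mono)
      finally show ?thesis by simp
    qed
    also have "\<dots> = (sqrt (1 - d) * norm x)\<^sup>2" using d by (simp add: power_mult_distrib algebra_simps)
    finally show ?thesis using d by (simp add: power2_le_iff_abs_le)
  qed
  have "\<exists>!x. T x = y" for y
  proof -
    \<comment> \<open>Solutions of \<open>T x = y\<close> are the fixed points of a damped
      iteration, whose linear part is the contraction \<open>I - T / M\<close>.\<close>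
    have "\<exists>!x. x - (1 / M) *\<^sub>R (T x - y) = x"
    proof (rule banach_fix_type)
      show "0 \<le> sqrt (1 - d)" "sqrt (1 - d) < 1" using d by auto
      show "\<forall>u v. dist (u - (1 / M) *\<^sub>R (T u - y)) (v - (1 / M) *\<^sub>R (T v - y)) \<le> sqrt (1 - d) * dist u v"
      proof (intro allI)
        fix u v
        have "(u - (1 / M) *\<^sub>R (T u - y)) - (v - (1 / M) *\<^sub>R (T v - y)) = (u - v) - (1 / M) *\<^sub>R T (u - v)"
          by (simp add: bop_diff[OF b] algebra_simps)
        then show "dist (u - (1 / M) *\<^sub>R (T u - y)) (v - (1 / M) *\<^sub>R (T v - y)) \<le> sqrt (1 - d) * dist u v"
          unfolding dist_norm using contr[of "u - v"] by (simp only:)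
      qed
    qed
    then show ?thesis using M(1) by simp
  qed
  then show ?thesis by (rule bij_iff[THEN iffD2, OF allI])
qed

lemma bop_inv:
  assumes S: "bop S" "bij S" and d: "\<delta> > 0" "\<And>x. \<delta> * norm x \<le> norm (S x)"
  shows "bop (inv S)"
proof (rule bop_intro)
  have r: "S (inv S x) = x" for x using S(2) by (simp add: bij_is_surj surj_f_inv_f)
  have inj: "inj S" using S(2) by (rule bij_is_inj)
  show "inv S (x + y) = inv S x + inv S y" for x y
    by (rule injD[OF inj]) (simp add: r bop_add[OF S(1)])
  show "inv S (scaleC c x) = scaleC c (inv S x)" for c x
    by (rule injD[OF inj]) (simp add: r bop_scaleC[OF S(1)])
  show "norm (inv S x) \<le> (1 / \<delta>) * norm x" for x
    using d(2)[of "inv S x"] d(1) by (simp add: r field_simps)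
qed

lemma pos_op_inv_selfadjoint:
  assumes S: "pos_op S" "bij S"
  shows "cinner (inv S x) y = cinner x (inv S y)"
proof -
  have r: "S (inv S x) = x" for x using S(2) by (simp add: bij_is_surj surj_f_inv_f)
  show ?thesis using pos_op_selfadjoint[OF S(1), of "inv S x" "inv S y"] by (simp add: r)
qed

lemma adj_inv_pos_op: "pos_op S \<Longrightarrow> bij S \<Longrightarrow> adj (inv S) = inv S"
  by (rule adj_unique) (rule pos_op_inv_selfadjoint)

text \<open>The root is bijective because its square is. At \<open>y = inv S x\<close> the squared
  norm of \<open>x\<close> splits into \<open>\<epsilon>\<close> times that of \<open>y\<close> and
  the form of \<open>P\<close>. Dropping the first term gives the last claim, which is the source of
  all contractions in the regularised family.\<close>

lemma
  fixes P :: "'a::{complex_inner, complete_space} \<Rightarrow> 'a"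
  assumes P: "pos_op P" and e: "\<epsilon> > 0"
  shows bij_sqrt_shift: "bij (sqrt_op (\<lambda>x. \<epsilon> *\<^sub>R x + P x))" (is "bij ?S")
    and bop_inv_sqrt_shift: "bop (inv (sqrt_op (\<lambda>x. \<epsilon> *\<^sub>R x + P x)))"
    and inv_sqrt_shift_le:
      "Re (cinner (P (inv (sqrt_op (\<lambda>x. \<epsilon> *\<^sub>R x + P x)) x)) (inv (sqrt_op (\<lambda>x. \<epsilon> *\<^sub>R x + P x)) x)) \<le> (norm x)\<^sup>2"
proof -
  let ?T = "\<lambda>x. \<epsilon> *\<^sub>R x + P x"
  have T: "pos_op ?T" using P e by (intro pos_op_shift) auto
  have S: "pos_op ?S" by (rule pos_op_sqrt_op[OF T])
  have form: "Re (cinner (?T x) x) = \<epsilon> * (norm x)\<^sup>2 + Re (cinner (P x) x)" for x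
    by (simp add: cinner_add_left cinner_scaleR_left Re_cinner_self)
  have "bij ?T" using T e by (rule pos_op_coercive_bij) (simp add: form pos_op_nonneg[OF P])
  moreover have SS: "?S (?S x) = ?T x" for x by (rule sqrt_op_sqrt_op[OF T])
  then have "?S \<circ> ?S = ?T" by auto
  ultimately have bij2: "bij (?S \<circ> ?S)" by simp
  show bij: "bij ?S"
  proof (rule bijI)
    show "inj ?S" by (rule inj_on_imageI2[OF bij_is_inj[OF bij2]])
    show "surj ?S" using bij_is_surj[OF bij2] by (auto simp: surj_def)
  qed
  have nS: "(norm (?S x))\<^sup>2 = \<epsilon> * (norm x)\<^sup>2 + Re (cinner (P x) x)" for x
    by (simp only: norm_sqrt_op_sq[OF T] form)
  have "sqrt \<epsilon> * norm x \<le> norm (?S x)" for x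
  proof (rule power2_le_imp_le)
    show "(sqrt \<epsilon> * norm x)\<^sup>2 \<le> (norm (?S x))\<^sup>2"
      unfolding nS using e pos_op_nonneg[OF P, of x] by (simp add: power_mult_distrib)
  qed simp
  then show "bop (inv ?S)" using e by (intro bop_inv[OF pos_op_bop[OF S] bij, of "sqrt \<epsilon>"]) auto
  have "?S (inv ?S x) = x" using bij by (simp add: bij_is_surj surj_f_inv_f)
  then have "(norm x)\<^sup>2 = \<epsilon> * (norm (inv ?S x))\<^sup>2 + Re (cinner (P (inv ?S x)) (inv ?S x))"
    using nS[of "inv ?S x"] by simp
  then show "Re (cinner (P (inv ?S x)) (inv ?S x)) \<le> (norm x)\<^sup>2"
    using e by simp
qed

text \<open>\<open>W\<close> inverts \<open>\<epsilon> I + H\<close>. Here \<open>H\<close> itself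
  is shifted, not its square; expanding the squared norm of \<open>\<epsilon> y + H y\<close>, with
  a nonnegative cross term, shows that \<open>H W\<close> is a contraction. It is applied to moduli
  and to Gram roots, which may fail to be invertible.\<close>

lemma pos_op_resolvent:
  fixes H :: "'a::{complex_inner, complete_space} \<Rightarrow> 'a"
  assumes H: "pos_op H" and e: "\<epsilon> > 0"
  obtains W where "bop W" "\<And>x y. cinner (W x) y = cinner x (W y)"
    "\<And>x. H (W x) + \<epsilon> *\<^sub>R W x = x" "\<And>x. W (H x) + \<epsilon> *\<^sub>R W x = x"
    "\<And>x. norm (H (W x)) \<le> norm x"
proof -
  let ?T = "\<lambda>x. \<epsilon> *\<^sub>R x + H x"
  have T: "pos_op ?T" using H e by (intro pos_op_shift) auto
  have form: "Re (cinner (?T x) x) = \<epsilon> * (norm x)\<^sup>2 + Re (cinner (H x) x)" for x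
    by (simp add: cinner_add_left cinner_scaleR_left Re_cinner_self)
  have bij: "bij ?T" using T e by (rule pos_op_coercive_bij) (simp add: form pos_op_nonneg[OF H])
  have sq: "(norm (?T x))\<^sup>2 = \<epsilon>\<^sup>2 * (norm x)\<^sup>2 + 2 * \<epsilon> * Re (cinner (H x) x) + (norm (H x))\<^sup>2" for x
    by (simp add: norm_add_sq cinner_scaleR_left Re_cinner_commute[of x] power_mult_distrib)
  have low: "\<epsilon> * norm x \<le> norm (?T x)" for x
  proof (rule power2_le_imp_le)
    show "(\<epsilon> * norm x)\<^sup>2 \<le> (norm (?T x))\<^sup>2"
      unfolding sq using e pos_op_nonneg[OF H, of x] by (simp add: power_mult_distrib)
  qed simp
  have b: "bop (inv ?T)" by (rule bop_inv[OF pos_op_bop[OF T] bij e low])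
  have r: "?T (inv ?T x) = x" for x by (rule surj_f_inv_f[OF bij_is_surj[OF bij]])
  show thesis
  proof
    show "bop (inv ?T)" by (rule b)
    show "cinner (inv ?T x) y = cinner x (inv ?T y)" for x y by (rule pos_op_inv_selfadjoint[OF T bij])
    show "H (inv ?T x) + \<epsilon> *\<^sub>R inv ?T x = x" for x using r[of x] by (simp add: add.commute)
    have "inv ?T (?T x) = x" for x by (rule inv_f_f[OF bij_is_inj[OF bij]])
    then have "\<epsilon> *\<^sub>R inv ?T x + inv ?T (H x) = x" for x
      by (simp only: bop_add[OF b] bop_scaleR[OF b])
    then show "inv ?T (H x) + \<epsilon> *\<^sub>R inv ?T x = x" for x
      by (subst add.commute)
    show "norm (H (inv ?T x)) \<le> norm x" for x
    proof (rule power2_le_imp_le)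
      show "(norm (H (inv ?T x)))\<^sup>2 \<le> (norm x)\<^sup>2"
        using sq[of "inv ?T x"] e pos_op_nonneg[OF H, of "inv ?T x"] unfolding r by simp
    qed simp
  qed
qed

subsection \<open>The Hilbert--Schmidt norm\<close>

lemma hs_sums_nonempty: "0 \<in> hs_sums T"
  unfolding hs_sums_def by (auto intro!: exI[of _ "{}"] simp: orthonormal_def)

lemma hs_class_bop: "hs_class T \<Longrightarrow> bop T"
  by (simp add: hs_class_def)

lemma Sup_hs_sums_nonneg: "hs_class T \<Longrightarrow> 0 \<le> Sup (hs_sums T)"
  by (simp add: hs_class_def cSup_upper hs_sums_nonempty)

lemma hs_norm_nonneg: "hs_class T \<Longrightarrow> 0 \<le> hs_norm T"
  by (simp add: hs_norm_def Sup_hs_sums_nonneg)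

lemma hs_norm_sq: "hs_class T \<Longrightarrow> (hs_norm T)\<^sup>2 = Sup (hs_sums T)"
  by (simp add: hs_norm_def Sup_hs_sums_nonneg)

lemma hs_sum_le:
  assumes "hs_class T" "finite E" "orthonormal E"
  shows "(\<Sum>e\<in>E. (norm (T e))\<^sup>2) \<le> (hs_norm T)\<^sup>2"
  unfolding hs_norm_sq[OF assms(1)]
  using assms by (intro cSup_upper) (auto simp: hs_class_def hs_sums_def)

lemma
  assumes "bop T" "0 \<le> M"
    and "\<And>E. finite E \<Longrightarrow> orthonormal E \<Longrightarrow> (\<Sum>e\<in>E. (norm (T e))\<^sup>2) \<le> M\<^sup>2"
  shows hs_classI: "hs_class T" and hs_norm_leI: "hs_norm T \<le> M"
proof -
  have *: "x \<le> M\<^sup>2" if "x \<in> hs_sums T" for x using that assms(3) by (auto simp: hs_sums_def)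
  from bdd_aboveI[OF this] show hs: "hs_class T" using assms(1) by (simp add: hs_class_def)
  have "Sup (hs_sums T) \<le> M\<^sup>2" using hs_sums_nonempty[of T] * by (intro cSup_least) auto
  then show "hs_norm T \<le> M"
    using assms(2) by (simp add: hs_norm_def real_le_lsqrt Sup_hs_sums_nonneg[OF hs])
qed

text \<open>Expand the finitely many vectors \<open>adj T e\<close> in an orthonormal set
  \<open>F\<close>, exchange the sums, and apply Bessel with respect to \<open>E\<close>; what
  remains is a sum for \<open>T\<close> over \<open>F\<close>.\<close>

lemma
  fixes T :: "'a::{complex_inner, complete_space} \<Rightarrow> 'a"
  assumes T: "hs_class T"
  shows hs_class_adj: "hs_class (adj T)" and hs_norm_adj_le: "hs_norm (adj T) \<le> hs_norm T"
proof -
  note b = hs_class_bop[OF T]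
  have *: "(\<Sum>e\<in>E. (norm (adj T e))\<^sup>2) \<le> (hs_norm T)\<^sup>2" if E: "finite E" "orthonormal E" for E
  proof -
    obtain F where F: "finite F" "orthonormal F" "\<And>e. e \<in> E \<Longrightarrow> proj F (adj T e) = adj T e"
      using finite_Gram_Schmidt[of "adj T ` E"] E by auto
    have "(\<Sum>e\<in>E. (norm (adj T e))\<^sup>2) = (\<Sum>e\<in>E. \<Sum>f\<in>F. (norm (cinner f (adj T e)))\<^sup>2)"
      using F by (intro sum.cong norm_sq_finite_expansion) auto
    also have "\<dots> = (\<Sum>f\<in>F. \<Sum>e\<in>E. (norm (cinner e (T f)))\<^sup>2)"
      by (subst sum.swap) (simp add: cinner_adj_right[OF b, symmetric] norm_cinner_commute)
    also have "\<dots> \<le> (\<Sum>f\<in>F. (norm (T f))\<^sup>2)"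
      using E by (intro sum_mono Bessel_inequality)
    also have "\<dots> \<le> (hs_norm T)\<^sup>2" using T F by (intro hs_sum_le)
    finally show ?thesis .
  qed
  show "hs_class (adj T)" "hs_norm (adj T) \<le> hs_norm T"
    using hs_classI[OF bop_adj[OF b] hs_norm_nonneg[OF T] *]
      hs_norm_leI[OF bop_adj[OF b] hs_norm_nonneg[OF T] *] by auto
qed

lemma hs_norm_adj:
  fixes T :: "'a::{complex_inner, complete_space} \<Rightarrow> 'a"
  assumes T: "hs_class T"
  shows "hs_norm (adj T) = hs_norm T"
  using hs_norm_adj_le[OF T] hs_norm_adj_le[OF hs_class_adj[OF T]]
  by (simp add: adj_adj[OF hs_class_bop[OF T]])

lemma
  assumes A: "bop A" and T: "hs_class T"
  shows hs_class_comp_left: "hs_class (\<lambda>x. A (T x))"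
    and hs_norm_comp_left: "hs_norm (\<lambda>x. A (T x)) \<le> onorm A * hs_norm T"
proof -
  have *: "(\<Sum>e\<in>E. (norm (A (T e)))\<^sup>2) \<le> (onorm A * hs_norm T)\<^sup>2"
    if E: "finite E" "orthonormal E" for E
  proof -
    have "(\<Sum>e\<in>E. (norm (A (T e)))\<^sup>2) \<le> (\<Sum>e\<in>E. (onorm A)\<^sup>2 * (norm (T e))\<^sup>2)"
      using bop_norm_le[OF A] by (intro sum_mono) (simp add: power_mono flip: power_mult_distrib)
    also have "\<dots> = (onorm A)\<^sup>2 * (\<Sum>e\<in>E. (norm (T e))\<^sup>2)" by (simp add: sum_distrib_left)
    also have "\<dots> \<le> (onorm A)\<^sup>2 * (hs_norm T)\<^sup>2"
      using T E by (intro mult_left_mono hs_sum_le) auto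
    finally show ?thesis by (simp add: power_mult_distrib)
  qed
  have "0 \<le> onorm A * hs_norm T" using bop_onorm_pos[OF A] hs_norm_nonneg[OF T] by simp
  then show "hs_class (\<lambda>x. A (T x))" "hs_norm (\<lambda>x. A (T x)) \<le> onorm A * hs_norm T"
    using hs_classI[OF bop_compose[OF A hs_class_bop[OF T]] _ *]
      hs_norm_leI[OF bop_compose[OF A hs_class_bop[OF T]] _ *] by auto
qed

text \<open>The adjoint turns composition on the right into composition on the left.\<close>

lemma
  fixes T :: "'a::{complex_inner, complete_space} \<Rightarrow> 'a"
  assumes B: "bop B" and T: "hs_class T"
  shows hs_class_comp_right: "hs_class (\<lambda>x. T (B x))"
    and hs_norm_comp_right: "hs_norm (\<lambda>x. T (B x)) \<le> hs_norm T * onorm B"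
proof -
  note bT = hs_class_bop[OF T]
  have hs: "hs_class (\<lambda>x. adj B (adj T x))"
    by (rule hs_class_comp_left[OF bop_adj[OF B] hs_class_adj[OF T]])
  have eq: "adj (\<lambda>x. adj B (adj T x)) = (\<lambda>x. T (B x))"
    by (simp add: adj_compose bop_adj B bT adj_adj)
  show "hs_class (\<lambda>x. T (B x))" using hs_class_adj[OF hs] unfolding eq .
  have "hs_norm (\<lambda>x. T (B x)) = hs_norm (\<lambda>x. adj B (adj T x))"
    using hs_norm_adj[OF hs] unfolding eq .
  also have "\<dots> \<le> onorm (adj B) * hs_norm (adj T)"
    by (rule hs_norm_comp_left[OF bop_adj[OF B] hs_class_adj[OF T]])
  also have "\<dots> \<le> onorm B * hs_norm T"
    using hs_norm_nonneg[OF T] by (simp add: hs_norm_adj[OF T] onorm_adj_le[OF B] mult_right_mono)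
  finally show "hs_norm (\<lambda>x. T (B x)) \<le> hs_norm T * onorm B" by (simp add: mult.commute)
qed

text \<open>Enlarging the span never decreases the sum. It lets several unrelated orthonormal sets
  be replaced by a single one.\<close>

lemma hs_sum_mono_span:
  fixes K :: "'a::{complex_inner, complete_space} \<Rightarrow> 'a"
  assumes K: "bop K" and E: "finite E" "orthonormal E" and F: "finite F" "orthonormal F"
    and span: "\<And>e. e \<in> E \<Longrightarrow> proj F e = e"
  shows "(\<Sum>e\<in>E. (norm (K e))\<^sup>2) \<le> (\<Sum>f\<in>F. (norm (K f))\<^sup>2)"
proof -
  obtain G where G: "finite G" "orthonormal G" "\<And>e. e \<in> E \<Longrightarrow> proj G (K e) = K e"
    using finite_Gram_Schmidt[of "K ` E"] E by auto
  \<comment> \<open>As \<open>e\<close> lies in the span of \<open>F\<close>, it sees only the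
    \<open>F\<close>-projection of a vector; Bessel over \<open>E\<close> can then be applied to
    that projection.\<close>
  have P: "cinner e (adj K g) = cinner e (proj F (adj K g))" if "e \<in> E" for e g
  proof -
    have "cinner e (adj K g) = cinner (proj F e) (adj K g)" using span[OF that] by simp
    also have "\<dots> = cinner (proj F e) (proj F (adj K g))"
      using F by (simp add: cinner_proj_left cinner_proj_orthonormal)
    finally show ?thesis using span[OF that] by simp
  qed
  have "(\<Sum>e\<in>E. (norm (K e))\<^sup>2) = (\<Sum>e\<in>E. \<Sum>g\<in>G. (norm (cinner g (K e)))\<^sup>2)"
    using G by (intro sum.cong norm_sq_finite_expansion) auto
  also have "\<dots> = (\<Sum>g\<in>G. \<Sum>e\<in>E. (norm (cinner e (proj F (adj K g))))\<^sup>2)"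
    by (subst sum.swap) (simp add: norm_cinner_commute[of _ "K _"] cinner_adj_right[OF K] P)
  also have "\<dots> \<le> (\<Sum>g\<in>G. (norm (proj F (adj K g)))\<^sup>2)"
    using E by (intro sum_mono Bessel_inequality)
  also have "\<dots> = (\<Sum>f\<in>F. \<Sum>g\<in>G. (norm (cinner g (K f)))\<^sup>2)"
    using F by (simp add: norm_proj_sq sum.swap[of _ G F] cinner_adj_right[OF K, symmetric] norm_cinner_commute)
  also have "\<dots> \<le> (\<Sum>f\<in>F. (norm (K f))\<^sup>2)"
    using G by (intro sum_mono Bessel_inequality)
  finally show ?thesis .
qed

lemma hs_class_dominated:
  assumes T: "bop T" and K: "hs_class K" and le: "\<And>x. norm (T x) \<le> norm (K x)"
  shows "hs_class T"
proof (rule hs_classI[OF T hs_norm_nonneg[OF K]])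
  fix E :: "'a set" assume E: "finite E" "orthonormal E"
  have "(\<Sum>e\<in>E. (norm (T e))\<^sup>2) \<le> (\<Sum>e\<in>E. (norm (K e))\<^sup>2)"
    using le by (intro sum_mono power_mono) auto
  also have "\<dots> \<le> (hs_norm K)\<^sup>2" by (rule hs_sum_le[OF K E])
  finally show "(\<Sum>e\<in>E. (norm (T e))\<^sup>2) \<le> (hs_norm K)\<^sup>2" .
qed

text \<open>The suprema for different \<open>i\<close> are approached along different orthonormal
  sets, so the pointwise hypothesis cannot be summed directly. One \<open>F\<close> spanning all of
  them makes it applicable.\<close>

lemma
  fixes K :: "'a::{complex_inner, complete_space} \<Rightarrow> 'a"
  assumes I: "finite I" and K: "hs_class K" and T: "\<And>i. i \<in> I \<Longrightarrow> bop (T i)"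
    and le: "\<And>x. (\<Sum>i\<in>I. (norm (T i x))\<^sup>2) \<le> (norm (K x))\<^sup>2"
  shows hs_class_column: "i \<in> I \<Longrightarrow> hs_class (T i)"
    and hs_norm_column: "(\<Sum>i\<in>I. (hs_norm (T i))\<^sup>2) \<le> (hs_norm K)\<^sup>2"
proof -
  have hsT: "hs_class (T i)" if "i \<in> I" for i
  proof (rule hs_class_dominated[OF T[OF that] K])
    fix x
    have "(norm (T i x))\<^sup>2 \<le> (\<Sum>i\<in>I. (norm (T i x))\<^sup>2)"
      using I that by (intro member_le_sum) auto
    also have "\<dots> \<le> (norm (K x))\<^sup>2" by (rule le)
    finally show "norm (T i x) \<le> norm (K x)" by simp
  qed
  then show "i \<in> I \<Longrightarrow> hs_class (T i)" .
  show "(\<Sum>i\<in>I. (hs_norm (T i))\<^sup>2) \<le> (hs_norm K)\<^sup>2"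
  proof (rule field_le_epsilon)
    fix d :: real assume "d > 0"
    \<comment> \<open>Chosen so that \<open>card I\<close> errors of size \<open>\<delta>\<close>
      add up to at most \<open>d\<close>; the \<open>+ 1\<close> covers an empty
      \<open>I\<close>.\<close>
    define \<delta> where "\<delta> = d / (card I + 1)"
    have \<delta>: "\<delta> > 0" using \<open>d > 0\<close> by (simp add: \<delta>_def)
    have "\<exists>E. finite E \<and> orthonormal E \<and> (hs_norm (T i))\<^sup>2 - \<delta> < (\<Sum>e\<in>E. (norm (T i e))\<^sup>2)"
      if "i \<in> I" for i
    proof -
      have "(hs_norm (T i))\<^sup>2 - \<delta> < Sup (hs_sums (T i))"
        using \<delta> by (simp add: hs_norm_sq[OF hsT[OF that]])
      then obtain s where "s \<in> hs_sums (T i)" "(hs_norm (T i))\<^sup>2 - \<delta> < s"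
        using less_cSupD[of "hs_sums (T i)"] hs_sums_nonempty[of "T i"] by auto
      then show ?thesis by (auto simp: hs_sums_def)
    qed
    then obtain E where E: "\<And>i. i \<in> I \<Longrightarrow> finite (E i)" "\<And>i. i \<in> I \<Longrightarrow> orthonormal (E i)"
      "\<And>i. i \<in> I \<Longrightarrow> (hs_norm (T i))\<^sup>2 - \<delta> < (\<Sum>e\<in>E i. (norm (T i e))\<^sup>2)" by metis
    obtain F where F: "finite F" "orthonormal F" "\<And>e i. i \<in> I \<Longrightarrow> e \<in> E i \<Longrightarrow> proj F e = e"
      using finite_Gram_Schmidt[of "\<Union>(E ` I)"] I E(1) by auto
    have "(\<Sum>i\<in>I. (hs_norm (T i))\<^sup>2) \<le> (\<Sum>i\<in>I. (\<Sum>f\<in>F. (norm (T i f))\<^sup>2) + \<delta>)"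
    proof (rule sum_mono)
      fix i assume i: "i \<in> I"
      have "(\<Sum>e\<in>E i. (norm (T i e))\<^sup>2) \<le> (\<Sum>f\<in>F. (norm (T i f))\<^sup>2)"
        using i E F T by (intro hs_sum_mono_span) auto
      then show "(hs_norm (T i))\<^sup>2 \<le> (\<Sum>f\<in>F. (norm (T i f))\<^sup>2) + \<delta>" using E(3)[OF i] by simp
    qed
    also have "\<dots> = (\<Sum>f\<in>F. \<Sum>i\<in>I. (norm (T i f))\<^sup>2) + card I * \<delta>"
      by (simp add: sum.distrib sum.swap[of _ I F])
    also have "(\<Sum>f\<in>F. \<Sum>i\<in>I. (norm (T i f))\<^sup>2) \<le> (\<Sum>f\<in>F. (norm (K f))\<^sup>2)"
      by (intro sum_mono le)
    also have "\<dots> \<le> (hs_norm K)\<^sup>2" by (rule hs_sum_le[OF K F(1,2)])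
    also have "card I * \<delta> \<le> d" using \<open>d > 0\<close> by (simp add: \<delta>_def field_simps)
    finally show "(\<Sum>i\<in>I. (hs_norm (T i))\<^sup>2) \<le> (hs_norm K)\<^sup>2 + d" by simp
  qed
qed

section \<open>Cauchy-Schwarz estimates for rows and columns\<close>

lemma sum_mult_le_sqrt:
  fixes f g :: "'i \<Rightarrow> real"
  assumes "\<And>i. i \<in> I \<Longrightarrow> 0 \<le> f i" "\<And>i. i \<in> I \<Longrightarrow> 0 \<le> g i"
    and "(\<Sum>i\<in>I. (f i)\<^sup>2) \<le> a\<^sup>2" "(\<Sum>i\<in>I. (g i)\<^sup>2) \<le> b\<^sup>2" "0 \<le> a" "0 \<le> b"
  shows "(\<Sum>i\<in>I. f i * g i) \<le> a * b"
proof -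
  have "(\<Sum>i\<in>I. f i * g i) = (\<Sum>i\<in>I. \<bar>f i\<bar> * \<bar>g i\<bar>)"
    using assms by (intro sum.cong) auto
  also have "\<dots> \<le> L2_set f I * L2_set g I" by (rule L2_set_mult_ineq)
  also have "\<dots> \<le> a * b"
    unfolding L2_set_def using assms by (intro mult_mono real_le_lsqrt) (auto intro: sum_nonneg)
  finally show ?thesis .
qed

text \<open>A row has the norm of its adjoint column: pair the result \<open>z\<close> with itself,
  move each \<open>A i\<close> across, and divide by \<open>norm z\<close>.\<close>

lemma norm_row_le:
  fixes A :: "'i \<Rightarrow> 'a::{complex_inner, complete_space} \<Rightarrow> 'a"
  assumes A: "\<And>i. i \<in> I \<Longrightarrow> bop (A i)"
    and a: "\<And>y. (\<Sum>i\<in>I. (norm (adj (A i) y))\<^sup>2) \<le> a\<^sup>2 * (norm y)\<^sup>2" "0 \<le> a"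
  shows "(norm (\<Sum>i\<in>I. A i (y i)))\<^sup>2 \<le> a\<^sup>2 * (\<Sum>i\<in>I. (norm (y i))\<^sup>2)"
proof -
  define z where "z = (\<Sum>i\<in>I. A i (y i))"
  define s where "s = sqrt (\<Sum>i\<in>I. (norm (y i))\<^sup>2)"
  have s: "0 \<le> s" "s\<^sup>2 = (\<Sum>i\<in>I. (norm (y i))\<^sup>2)" by (auto simp: s_def sum_nonneg)
  have "(norm z)\<^sup>2 = Re (cinner (\<Sum>i\<in>I. A i (y i)) z)"
    by (simp add: Re_cinner_self flip: z_def)
  also have "\<dots> = (\<Sum>i\<in>I. Re (cinner (y i) (adj (A i) z)))"
    by (simp add: cinner.sum_left cinner_adj_right[OF A])
  also have "\<dots> \<le> (\<Sum>i\<in>I. norm (y i) * norm (adj (A i) z))"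
    by (intro sum_mono Re_cinner_le)
  also have "\<dots> \<le> s * (a * norm z)"
    using a s by (intro sum_mult_le_sqrt) (auto simp: power_mult_distrib)
  finally have "norm z * norm z \<le> (a * s) * norm z" by (simp add: power2_eq_square algebra_simps)
  then have "norm z \<le> a * s" using a s by (cases "norm z = 0") auto
  then have "(norm z)\<^sup>2 \<le> (a * s)\<^sup>2" by (simp add: power_mono)
  then show ?thesis by (simp add: z_def power_mult_distrib s)
qed

lemma onorm_row_diag_column_le:
  fixes A :: "'i \<Rightarrow> 'a::{complex_inner, complete_space} \<Rightarrow> 'a"
  assumes A: "\<And>i. i \<in> I \<Longrightarrow> bop (A i)"
    and a: "\<And>y. (\<Sum>i\<in>I. (norm (adj (A i) y))\<^sup>2) \<le> a\<^sup>2 * (norm y)\<^sup>2" "0 \<le> a"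
    and b: "\<And>y. (\<Sum>i\<in>I. (norm (B i y))\<^sup>2) \<le> b\<^sup>2 * (norm y)\<^sup>2" "0 \<le> b"
    and G: "\<And>i y. i \<in> I \<Longrightarrow> norm (G i y) \<le> m * norm y" "0 \<le> m"
  shows "onorm (\<lambda>x. \<Sum>i\<in>I. A i (G i (B i x))) \<le> m * a * b"
proof (rule onorm_bound)
  show "0 \<le> m * a * b" using a b G by simp
  fix x
  have "(norm (\<Sum>i\<in>I. A i (G i (B i x))))\<^sup>2 \<le> a\<^sup>2 * (\<Sum>i\<in>I. (norm (G i (B i x)))\<^sup>2)"
    by (rule norm_row_le[OF A a])
  also have "\<dots> \<le> a\<^sup>2 * (\<Sum>i\<in>I. m\<^sup>2 * (norm (B i x))\<^sup>2)"
    using G by (intro mult_left_mono sum_mono) (auto simp flip: power_mult_distrib intro: power_mono)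
  also have "\<dots> = a\<^sup>2 * m\<^sup>2 * (\<Sum>i\<in>I. (norm (B i x))\<^sup>2)" by (simp add: sum_distrib_left mult.assoc)
  also have "\<dots> \<le> a\<^sup>2 * m\<^sup>2 * (b\<^sup>2 * (norm x)\<^sup>2)" by (intro mult_left_mono b) auto
  also have "\<dots> = (m * a * b * norm x)\<^sup>2" by (simp add: power_mult_distrib algebra_simps)
  finally show "norm (\<Sum>i\<in>I. A i (G i (B i x))) \<le> m * a * b * norm x"
    using a b G by (simp add: power2_le_iff_abs_le)
qed

text \<open>The row estimate is applied at each \<open>e\<close> of a finite orthonormal set, and
  the two finite sums are exchanged.\<close>

lemma
  fixes A :: "'i \<Rightarrow> 'a::{complex_inner, complete_space} \<Rightarrow> 'a"
  assumes A: "\<And>i. i \<in> I \<Longrightarrow> bop (A i)"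
    and a: "\<And>y. (\<Sum>i\<in>I. (norm (adj (A i) y))\<^sup>2) \<le> a\<^sup>2 * (norm y)\<^sup>2" "0 \<le> a"
    and H: "\<And>i. i \<in> I \<Longrightarrow> hs_class (H i)" and k: "(\<Sum>i\<in>I. (hs_norm (H i))\<^sup>2) \<le> k\<^sup>2" "0 \<le> k"
  shows hs_class_row: "hs_class (\<lambda>x. \<Sum>i\<in>I. A i (H i x))"
    and hs_norm_row: "hs_norm (\<lambda>x. \<Sum>i\<in>I. A i (H i x)) \<le> a * k"
proof -
  have b: "bop (\<lambda>x. \<Sum>i\<in>I. A i (H i x))"
    by (rule bop_Sum, rule bop_compose[OF A hs_class_bop[OF H]])
  have *: "(\<Sum>e\<in>E. (norm (\<Sum>i\<in>I. A i (H i e)))\<^sup>2) \<le> (a * k)\<^sup>2"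
    if E: "finite E" "orthonormal E" for E
  proof -
    have "(\<Sum>e\<in>E. (norm (\<Sum>i\<in>I. A i (H i e)))\<^sup>2) \<le> (\<Sum>e\<in>E. a\<^sup>2 * (\<Sum>i\<in>I. (norm (H i e))\<^sup>2))"
      by (intro sum_mono norm_row_le[OF A a])
    also have "\<dots> = a\<^sup>2 * (\<Sum>i\<in>I. \<Sum>e\<in>E. (norm (H i e))\<^sup>2)"
      by (simp add: sum_distrib_left sum.swap[of _ I E])
    also have "\<dots> \<le> a\<^sup>2 * (\<Sum>i\<in>I. (hs_norm (H i))\<^sup>2)"
      using H E by (intro mult_left_mono sum_mono hs_sum_le) auto
    also have "\<dots> \<le> a\<^sup>2 * k\<^sup>2" using k by (intro mult_left_mono) auto
    finally show ?thesis by (simp add: power_mult_distrib)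
  qed
  show "hs_class (\<lambda>x. \<Sum>i\<in>I. A i (H i x))" "hs_norm (\<lambda>x. \<Sum>i\<in>I. A i (H i x)) \<le> a * k"
    using hs_classI[OF b _ *] hs_norm_leI[OF b _ *] a(2) k(2) by auto
qed

text \<open>The adjoint image of the preceding estimate: the bounded column becomes a bounded row,
  and the Hilbert-Schmidt norms are unchanged.\<close>

lemma hs_norm_row_times_column:
  fixes B :: "'i \<Rightarrow> 'a::{complex_inner, complete_space} \<Rightarrow> 'a"
  assumes B: "\<And>i. i \<in> I \<Longrightarrow> bop (B i)"
    and b: "\<And>y. (\<Sum>i\<in>I. (norm (B i y))\<^sup>2) \<le> b\<^sup>2 * (norm y)\<^sup>2" "0 \<le> b"
    and H: "\<And>i. i \<in> I \<Longrightarrow> hs_class (H i)" and k: "(\<Sum>i\<in>I. (hs_norm (H i))\<^sup>2) \<le> k\<^sup>2" "0 \<le> k"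
  shows "hs_norm (\<lambda>x. \<Sum>i\<in>I. H i (B i x)) \<le> k * b"
proof -
  let ?Z = "\<lambda>x. \<Sum>i\<in>I. adj (B i) (adj (H i) x)"
  have adjB: "\<And>i. i \<in> I \<Longrightarrow> bop (adj (B i))" using B by (auto intro: bop_adj)
  have adjH: "\<And>i. i \<in> I \<Longrightarrow> hs_class (adj (H i))" using H by (auto intro: hs_class_adj)
  have b': "(\<Sum>i\<in>I. (norm (adj (adj (B i)) y))\<^sup>2) \<le> b\<^sup>2 * (norm y)\<^sup>2" for y
    using b(1)[of y] by (simp add: adj_adj[OF B])
  have k': "(\<Sum>i\<in>I. (hs_norm (adj (H i)))\<^sup>2) \<le> k\<^sup>2"
    using k(1) by (simp add: hs_norm_adj[OF H])
  have hs: "hs_class ?Z" "hs_norm ?Z \<le> b * k"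
    using hs_class_row[OF adjB b' b(2) adjH k' k(2)] hs_norm_row[OF adjB b' b(2) adjH k' k(2)] by auto
  have "adj ?Z = (\<lambda>x. \<Sum>i\<in>I. adj (\<lambda>x. adj (B i) (adj (H i) x)) x)"
    by (rule adj_Sum, rule bop_compose[OF adjB hs_class_bop[OF adjH]])
  also have "\<dots> = (\<lambda>x. \<Sum>i\<in>I. H i (B i x))"
    by (intro ext sum.cong)
      (auto simp: adj_compose[OF adjB hs_class_bop[OF adjH]] adj_adj[OF B] adj_adj[OF hs_class_bop[OF H]])
  finally have "hs_norm (\<lambda>x. \<Sum>i\<in>I. H i (B i x)) = hs_norm ?Z"
    using hs_norm_adj[OF hs(1)] by simp
  then show ?thesis using hs(2) by (simp add: mult.commute)
qed

subsection \<open>The trace norm\<close>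

text \<open>The form of \<open>abs_op T\<close> at \<open>e\<close> is the squared norm of its root
  at \<open>e\<close>; this brings the trace norm under the Hilbert-Schmidt theory.\<close>

lemma tr_sums_eq_hs_sums:
  fixes T :: "'a::{complex_inner, complete_space} \<Rightarrow> 'a"
  assumes "bop T"
  shows "tr_sums T = hs_sums (sqrt_op (abs_op T))"
  unfolding tr_sums_def hs_sums_def by (simp add: norm_sqrt_op_sq[OF pos_op_abs_op[OF assms]])

lemma
  fixes T :: "'a::{complex_inner, complete_space} \<Rightarrow> 'a"
  assumes "trace_class T"
  shows hs_class_sqrt_abs: "hs_class (sqrt_op (abs_op T))"
    and tr_norm_eq_hs_norm: "tr_norm T = (hs_norm (sqrt_op (abs_op T)))\<^sup>2"
proof -
  have T: "bop T" using assms by (simp add: trace_class_def)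
  show hs: "hs_class (sqrt_op (abs_op T))"
    using assms pos_op_bop[OF pos_op_sqrt_op[OF pos_op_abs_op[OF T]]]
    by (simp add: trace_class_def hs_class_def tr_sums_eq_hs_sums[OF T])
  show "tr_norm T = (hs_norm (sqrt_op (abs_op T)))\<^sup>2"
    by (simp add: tr_norm_def tr_sums_eq_hs_sums[OF T] hs_norm_sq[OF hs])
qed

text \<open>Instead of the partial isometry of the polar decomposition, \<open>U = T (\<epsilon> I + \<bar>T\<bar>)\<^sup>-\<^sup>1\<close> is used:
  a contraction with \<open>T = U \<bar>T\<bar> + \<epsilon> U\<close>.\<close>

lemma approximate_polar_decomposition:
  fixes T :: "'a::{complex_inner, complete_space} \<Rightarrow> 'a"
  assumes T: "bop T" and e: "\<epsilon> > 0"
  obtains U where "bop U" "\<And>x. norm (U x) \<le> norm x" "\<And>x. T x = U (abs_op T x) + \<epsilon> *\<^sub>R U x"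
    "\<And>x. Re (cinner (abs_op T x) x) \<le> Re (cinner (T x) (U x)) + \<epsilon> * (norm x)\<^sup>2"
proof -
  note P = pos_op_abs_op[OF T]
  obtain W where W: "bop W" "\<And>x y. cinner (W x) y = cinner x (W y)"
    "\<And>x. abs_op T (W x) + \<epsilon> *\<^sub>R W x = x" "\<And>x. W (abs_op T x) + \<epsilon> *\<^sub>R W x = x"
    "\<And>x. norm (abs_op T (W x)) \<le> norm x"
    by (rule pos_op_resolvent[OF P e]) blast
  show thesis
  proof
    show "bop (\<lambda>x. T (W x))" by (rule bop_compose[OF T W(1)])
    show "norm (T (W x)) \<le> norm x" for x using W(5)[of x] by (simp add: norm_abs_op[OF T])
    show "T x = T (W (abs_op T x)) + \<epsilon> *\<^sub>R T (W x)" for x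
      using arg_cong[OF W(4)[of x], of T] by (simp add: bop_add[OF T] bop_scaleR[OF T])
    show "Re (cinner (abs_op T x) x) \<le> Re (cinner (T x) (T (W x))) + \<epsilon> * (norm x)\<^sup>2" for x
    proof -
      \<comment> \<open>Both entries carry \<open>T\<close>, so only \<open>adj T\<close> after
        \<open>T\<close> matters and \<open>T\<close> may be replaced by its modulus. Splitting
        \<open>x\<close> by the resolvent identity leaves an error of at most
        \<open>\<epsilon> * (norm x)\<^sup>2\<close>, since the modulus after \<open>W\<close> is a
        contraction.\<close>
      have "cinner (T x) (T (W x)) = cinner (abs_op T x) (abs_op T (W x))"
        by (simp add: cinner_adj_left[OF T, symmetric] pos_op_selfadjoint[OF P, symmetric] abs_op_abs_op[OF T])
      moreover have "cinner (abs_op T x) x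
          = cinner (abs_op T x) (abs_op T (W x)) + \<epsilon> *\<^sub>R cinner (abs_op T x) (W x)"
        using arg_cong[OF W(3)[of x], of "cinner (abs_op T x)"]
        by (simp add: cinner_add_right cinner_scaleR_right)
      moreover have "Re (cinner (abs_op T x) (W x)) \<le> (norm x)\<^sup>2"
        using Re_cinner_le[of x "abs_op T (W x)"] mult_left_mono[OF W(5)[of x] norm_ge_zero[of x]]
        by (simp add: pos_op_selfadjoint[OF P] power2_eq_square)
      ultimately show ?thesis using e by simp
    qed
  qed
qed

text \<open>Trace duality: the contraction from the approximate polar decomposition of
  \<open>Y\<close> serves as \<open>V\<close>. Bounds on these pairings are linear in
  \<open>Y\<close>, so sums of operators can be treated without computing a modulus.\<close>

lemma
  fixes Y :: "'a::{complex_inner, complete_space} \<Rightarrow> 'a"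
  assumes Y: "bop Y"
    and le: "\<And>E V. finite E \<Longrightarrow> orthonormal E \<Longrightarrow> bop V \<Longrightarrow> (\<And>x. norm (V x) \<le> norm x) \<Longrightarrow>
      (\<Sum>e\<in>E. Re (cinner (Y e) (V e))) \<le> M"
  shows trace_class_dualI: "trace_class Y" and tr_norm_le_dualI: "tr_norm Y \<le> M"
proof -
  have *: "s \<le> M" if sY: "s \<in> tr_sums Y" for s
  proof -
    obtain E where E: "finite E" "orthonormal E" and s: "s = (\<Sum>e\<in>E. Re (cinner (abs_op Y e) e))"
      using sY by (auto simp: tr_sums_def)
    have "s \<le> M + d" if d: "d > 0" for d
    proof -
      \<comment> \<open>Each unit vector of \<open>E\<close> costs one \<open>\<epsilon>\<close>, so
        the total error stays within \<open>d\<close>.\<close>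
      define \<epsilon> where "\<epsilon> = d / (card E + 1)"
      have e: "\<epsilon> > 0" using d by (simp add: \<epsilon>_def)
      obtain U where U: "bop U" "\<And>x. norm (U x) \<le> norm x"
        "\<And>x. Re (cinner (abs_op Y x) x) \<le> Re (cinner (Y x) (U x)) + \<epsilon> * (norm x)\<^sup>2"
        by (rule approximate_polar_decomposition[OF Y e]) blast
      have "s \<le> (\<Sum>e\<in>E. Re (cinner (Y e) (U e)) + \<epsilon>)"
        unfolding s
      proof (rule sum_mono)
        fix e assume "e \<in> E"
        then have "norm e = 1" using E by (simp add: orthonormal_def)
        then show "Re (cinner (abs_op Y e) e) \<le> Re (cinner (Y e) (U e)) + \<epsilon>" using U(3)[of e] by simp
      qed
      also have "\<dots> = (\<Sum>e\<in>E. Re (cinner (Y e) (U e))) + card E * \<epsilon>" by (simp add: sum.distrib)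
      also have "\<dots> \<le> M + d"
        using le[OF E U(1,2)] d by (intro add_mono) (auto simp: \<epsilon>_def field_simps)
      finally show ?thesis .
    qed
    then show ?thesis by (rule field_le_epsilon)
  qed
  from bdd_aboveI[OF this] show "trace_class Y" using Y by (simp add: trace_class_def)
  have "tr_sums Y \<noteq> {}" using hs_sums_nonempty by (auto simp: tr_sums_eq_hs_sums[OF Y])
  then show "tr_norm Y \<le> M" unfolding tr_norm_def using * by (rule cSup_least)
qed

lemma sum_cinner_le_hs_norm:
  assumes "hs_class P" "hs_class Q" "finite E" "orthonormal E"
  shows "(\<Sum>e\<in>E. Re (cinner (P e) (Q e))) \<le> hs_norm P * hs_norm Q"
proof -
  have "(\<Sum>e\<in>E. Re (cinner (P e) (Q e))) \<le> (\<Sum>e\<in>E. norm (P e) * norm (Q e))"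
    by (intro sum_mono Re_cinner_le)
  also have "\<dots> \<le> hs_norm P * hs_norm Q"
    using assms by (intro sum_mult_le_sqrt hs_sum_le hs_norm_nonneg) auto
  finally show ?thesis .
qed

text \<open>Up to \<open>\<epsilon> U\<close>, the middle \<open>T i X S i\<close> factors as
  \<open>P i = T i U h\<close> times \<open>Q i = h S i\<close>. The hypotheses on \<open>T\<close>
  and \<open>S\<close> bound both the column \<open>P\<close> and the row \<open>Q\<close> by
  \<open>h\<close> in Hilbert-Schmidt norm, and the square of that norm is
  \<open>tr_norm X\<close>.\<close>

lemma trace_dual_bound:
  fixes A B S T :: "'i \<Rightarrow> 'a::{complex_inner, complete_space} \<Rightarrow> 'a"
  assumes I: "finite I" and X: "trace_class X"
    and bops: "\<And>i. i \<in> I \<Longrightarrow> bop (A i)" "\<And>i. i \<in> I \<Longrightarrow> bop (B i)"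
      "\<And>i. i \<in> I \<Longrightarrow> bop (S i)" "\<And>i. i \<in> I \<Longrightarrow> bop (T i)"
    and T1: "\<And>x. (\<Sum>i\<in>I. (norm (T i x))\<^sup>2) \<le> (norm x)\<^sup>2"
    and S1: "\<And>x. (\<Sum>i\<in>I. (norm (adj (S i) x))\<^sup>2) \<le> (norm x)\<^sup>2"
    and m: "\<And>i. i \<in> I \<Longrightarrow> onorm (A i) * onorm (B i) \<le> m" "0 \<le> m"
    and E: "finite E" "orthonormal E" and V: "bop V" "\<And>x. norm (V x) \<le> norm x"
  shows "(\<Sum>e\<in>E. Re (cinner (\<Sum>i\<in>I. A i (T i (X (S i (B i e))))) (V e))) \<le> m * tr_norm X"
proof -
  have bX: "bop X" using X by (simp add: trace_class_def)
  define h where "h = sqrt_op (abs_op X)"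
  have hs: "hs_class h" and tr: "tr_norm X = (hs_norm h)\<^sup>2"
    unfolding h_def using hs_class_sqrt_abs[OF X] tr_norm_eq_hs_norm[OF X] by auto
  have bh: "bop h" by (rule hs_class_bop[OF hs])
  have ph: "pos_op h" unfolding h_def by (rule pos_op_sqrt_op[OF pos_op_abs_op[OF bX]])
  have hh: "h (h x) = abs_op X x" for x
    unfolding h_def by (rule sqrt_op_sqrt_op[OF pos_op_abs_op[OF bX]])
  \<comment> \<open>Coefficient of the \<open>\<epsilon>\<close> error. It depends on the finite set
    \<open>E\<close> but not on \<open>\<epsilon>\<close>, so the error can be made arbitrarily
    small.\<close>
  define K where "K = (\<Sum>e\<in>E. \<Sum>i\<in>I. onorm (A i) * (onorm (T i) * norm (S i (B i e))))"
  have K0: "0 \<le> K"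
    unfolding K_def using bops by (intro sum_nonneg mult_nonneg_nonneg) (auto intro: bop_onorm_pos)
  have Ve: "norm (V e) \<le> 1" if "e \<in> E" for e
    using V(2)[of e] E that by (simp add: orthonormal_def)
  have V1: "onorm V \<le> 1" using V by (intro onorm_bound) auto
  have main: "(\<Sum>e\<in>E. Re (cinner (\<Sum>i\<in>I. A i (T i (X (S i (B i e))))) (V e))) \<le> m * tr_norm X + \<epsilon> * K"
    if e: "\<epsilon> > 0" for \<epsilon>
  proof -
    obtain U where U: "bop U" "\<And>x. norm (U x) \<le> norm x" "\<And>x. X x = U (abs_op X x) + \<epsilon> *\<^sub>R U x"
      by (rule approximate_polar_decomposition[OF bX e]) blast
    define P where "P i x = T i (U (h x))" for i x
    define Q where "Q i x = h (S i x)" for i x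
    have bUh: "bop (\<lambda>x. U (h x))" by (rule bop_compose[OF U(1) bh])
    have bP: "bop (P i)" if "i \<in> I" for i
      unfolding P_def by (rule bop_compose[OF bops(4)[OF that] bUh])
    have Ple: "(\<Sum>i\<in>I. (norm (P i x))\<^sup>2) \<le> (norm (h x))\<^sup>2" for x
      unfolding P_def using T1[of "U (h x)"] power_mono[OF U(2)[of "h x"] norm_ge_zero, of 2]
      by (rule order_trans)
    have hP: "hs_class (P i)" if "i \<in> I" for i by (rule hs_class_column[OF I hs bP Ple that])
    have sP: "(\<Sum>i\<in>I. (hs_norm (P i))\<^sup>2) \<le> (hs_norm h)\<^sup>2" by (rule hs_norm_column[OF I hs bP Ple])
    have hQ: "hs_class (Q i)" if "i \<in> I" for i
      unfolding Q_def by (rule hs_class_comp_right[OF bops(3)[OF that] hs])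
    have adjQ: "adj (Q i) = (\<lambda>x. adj (S i) (h x))" if "i \<in> I" for i
      unfolding Q_def by (simp add: adj_compose[OF bh bops(3)[OF that]] adj_pos_op[OF ph])
    have bQ': "bop (adj (Q i))" if "i \<in> I" for i using hQ[OF that] by (intro bop_adj hs_class_bop)
    have Qle: "(\<Sum>i\<in>I. (norm (adj (Q i) x))\<^sup>2) \<le> (norm (h x))\<^sup>2" for x
      using S1[of "h x"] by (simp add: adjQ)
    have "(\<Sum>i\<in>I. (hs_norm (adj (Q i)))\<^sup>2) \<le> (hs_norm h)\<^sup>2" by (rule hs_norm_column[OF I hs bQ' Qle])
    then have sQ: "(\<Sum>i\<in>I. (hs_norm (Q i))\<^sup>2) \<le> (hs_norm h)\<^sup>2" by (simp add: hs_norm_adj[OF hQ])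
    \<comment> \<open>The part of \<open>X\<close> coming from \<open>\<epsilon> U\<close> need not
      be Hilbert-Schmidt; it is bounded by operator norms at each single \<open>e\<close>.\<close>
    have split: "Re (cinner (A i (T i (X (S i (B i e))))) (V e))
        \<le> Re (cinner (Q i (B i e)) (adj (P i) (adj (A i) (V e))))
          + \<epsilon> * (onorm (A i) * (onorm (T i) * norm (S i (B i e))))" if "i \<in> I" "e \<in> E" for i e
    proof -
      let ?y = "S i (B i e)"
      have "A i (T i (X ?y)) = A i (P i (Q i (B i e))) + \<epsilon> *\<^sub>R A i (T i (U ?y))"
        using that by (simp add: U(3)[of ?y] P_def Q_def hh bop_add bop_scaleR bops)
      moreover have "norm (A i (T i (U ?y))) \<le> onorm (A i) * (onorm (T i) * norm ?y)"
      proof -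
        have "norm (A i (T i (U ?y))) \<le> onorm (A i) * norm (T i (U ?y))"
          by (rule bop_norm_le[OF bops(1)[OF that(1)]])
        also have "norm (T i (U ?y)) \<le> onorm (T i) * norm (U ?y)"
          by (rule bop_norm_le[OF bops(4)[OF that(1)]])
        also have "norm (U ?y) \<le> norm ?y" by (rule U(2))
        finally show ?thesis using that bops by (simp add: mult_left_mono bop_onorm_pos)
      qed
      then have "norm (A i (T i (U ?y))) * norm (V e) \<le> onorm (A i) * (onorm (T i) * norm ?y)"
        using mult_mono[OF _ Ve[OF that(2)], of "norm (A i (T i (U ?y)))"]
          order_trans[OF norm_ge_zero] by fastforce
      then have "Re (cinner (A i (T i (U ?y))) (V e)) \<le> onorm (A i) * (onorm (T i) * norm ?y)"
        using Re_cinner_le order_trans by blast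
      moreover have "cinner (A i (P i (Q i (B i e)))) (V e)
          = cinner (Q i (B i e)) (adj (P i) (adj (A i) (V e)))"
        by (simp add: cinner_adj_right[OF bops(1)[OF that(1)]] cinner_adj_right[OF bP[OF that(1)]])
      ultimately show ?thesis using e
        by (simp add: cinner_add_left cinner_scaleR_left mult_left_mono)
    qed
    \<comment> \<open>Moving \<open>A i\<close> and \<open>P i\<close> across leaves a pairing of
      two Hilbert-Schmidt operators. The norms of \<open>A i\<close> and \<open>B i\<close> meet at
      the same index, so \<open>m\<close> need only bound their product.\<close>
    have summand: "(\<Sum>e\<in>E. Re (cinner (Q i (B i e)) (adj (P i) (adj (A i) (V e)))))
        \<le> m * (hs_norm (Q i) * hs_norm (P i))" if i: "i \<in> I" for i
    proof -
      note bA = bops(1)[OF i] and bB = bops(2)[OF i]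
      have hAP: "hs_class (\<lambda>x. A i (P i x))" by (rule hs_class_comp_left[OF bA hP[OF i]])
      have adjAP: "adj (\<lambda>x. A i (P i x)) = (\<lambda>x. adj (P i) (adj (A i) x))"
        by (rule adj_compose[OF bA bP[OF i]])
      have h1: "hs_class (\<lambda>x. adj (P i) (adj (A i) x))" using hs_class_adj[OF hAP] unfolding adjAP .
      have n1: "hs_norm (\<lambda>x. adj (P i) (adj (A i) x)) \<le> onorm (A i) * hs_norm (P i)"
        using hs_norm_adj[OF hAP] hs_norm_comp_left[OF bA hP[OF i]] unfolding adjAP by simp
      have h2: "hs_class (\<lambda>x. adj (P i) (adj (A i) (V x)))" by (rule hs_class_comp_right[OF V(1) h1])
      have n2: "hs_norm (\<lambda>x. adj (P i) (adj (A i) (V x))) \<le> onorm (A i) * hs_norm (P i)"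
        using hs_norm_comp_right[OF V(1) h1] mult_left_mono[OF V1 hs_norm_nonneg[OF h1]] n1 by simp
      have h3: "hs_class (\<lambda>x. Q i (B i x))" by (rule hs_class_comp_right[OF bB hQ[OF i]])
      have "(\<Sum>e\<in>E. Re (cinner (Q i (B i e)) (adj (P i) (adj (A i) (V e)))))
        \<le> hs_norm (\<lambda>x. Q i (B i x)) * hs_norm (\<lambda>x. adj (P i) (adj (A i) (V x)))"
        by (rule sum_cinner_le_hs_norm[OF h3 h2 E])
      also have "\<dots> \<le> (hs_norm (Q i) * onorm (B i)) * (onorm (A i) * hs_norm (P i))"
        using hs_norm_comp_right[OF bB hQ[OF i]] n2 hs_norm_nonneg[OF h2]
          hs_norm_nonneg[OF hQ[OF i]] bop_onorm_pos[OF bB] by (intro mult_mono) auto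
      also have "\<dots> = (onorm (A i) * onorm (B i)) * (hs_norm (Q i) * hs_norm (P i))"
        by (simp add: algebra_simps)
      also have "\<dots> \<le> m * (hs_norm (Q i) * hs_norm (P i))"
        using m(1)[OF i] hs_norm_nonneg[OF hQ[OF i]] hs_norm_nonneg[OF hP[OF i]]
        by (intro mult_right_mono) auto
      finally show ?thesis .
    qed
    have "(\<Sum>e\<in>E. Re (cinner (\<Sum>i\<in>I. A i (T i (X (S i (B i e))))) (V e)))
        \<le> (\<Sum>e\<in>E. \<Sum>i\<in>I. Re (cinner (Q i (B i e)) (adj (P i) (adj (A i) (V e))))
          + \<epsilon> * (onorm (A i) * (onorm (T i) * norm (S i (B i e)))))"
      unfolding cinner.sum_left Re_sum by (intro sum_mono split)
    also have "\<dots> = (\<Sum>i\<in>I. \<Sum>e\<in>E. Re (cinner (Q i (B i e)) (adj (P i) (adj (A i) (V e))))) + \<epsilon> * K"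
      by (simp add: sum.distrib K_def sum_distrib_left sum.swap[of _ I E])
    also have "\<dots> \<le> (\<Sum>i\<in>I. m * (hs_norm (Q i) * hs_norm (P i))) + \<epsilon> * K"
      by (intro add_mono sum_mono summand order_refl)
    also have "\<dots> = m * (\<Sum>i\<in>I. hs_norm (Q i) * hs_norm (P i)) + \<epsilon> * K" by (simp add: sum_distrib_left)
    also have "\<dots> \<le> m * (hs_norm h * hs_norm h) + \<epsilon> * K"
      using sP sQ hP hQ hs m(2)
      by (intro add_mono mult_left_mono sum_mult_le_sqrt order_refl hs_norm_nonneg) auto
    finally show ?thesis by (simp add: tr power2_eq_square)
  qed
  show ?thesis
  proof (rule field_le_epsilon)
    fix d :: real assume d: "d > 0"
    have "d / (K + 1) * K \<le> d" using d K0 by (simp add: field_simps)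
    then show "(\<Sum>e\<in>E. Re (cinner (\<Sum>i\<in>I. A i (T i (X (S i (B i e))))) (V e))) \<le> m * tr_norm X + d"
      using main[of "d / (K + 1)"] d K0 by simp
  qed
qed

text \<open>The dual bound with a one-element index set and identities for \<open>T\<close> and
  \<open>S\<close>. It is needed to apply that bound to \<open>X\<close> surrounded by Gram
  roots.\<close>

lemma trace_class_comp:
  fixes X :: "'a::{complex_inner, complete_space} \<Rightarrow> 'a"
  assumes X: "trace_class X" and L: "bop L" and R: "bop R"
  shows "trace_class (\<lambda>x. L (X (R x)))"
proof (rule trace_class_dualI)
  have bX: "bop X" using X by (simp add: trace_class_def)
  show "bop (\<lambda>x. L (X (R x)))" by (rule bop_compose[OF L bop_compose[OF bX R]])
  have id: "adj (\<lambda>x. x :: 'a) = (\<lambda>x. x)" by (rule adj_unique) simp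
  fix E :: "'a set" and V :: "'a \<Rightarrow> 'a"
  assume "finite E" "orthonormal E" "bop V" "\<And>x. norm (V x) \<le> norm x"
  from trace_dual_bound[OF _ X _ _ _ _ _ _ _ _ this, of "{()}" "\<lambda>_. L" "\<lambda>_. R" "\<lambda>_ x. x" "\<lambda>_ x. x"
      "onorm L * onorm R"] L R
  show "(\<Sum>e\<in>E. Re (cinner (L (X (R e))) (V e))) \<le> (onorm L * onorm R) * tr_norm X"
    by (simp add: bop_id id bop_onorm_pos)
qed

subsection \<open>Rows and columns of operators\<close>

lemma ball_bop_adj:
  fixes K :: "'i \<Rightarrow> 'a::{complex_inner, complete_space} \<Rightarrow> 'a"
  shows "\<forall>i\<in>I. bop (K i) \<Longrightarrow> \<forall>i\<in>I. bop (adj (K i))"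
  by (simp add: bop_adj)

text \<open>For \<open>\<epsilon> = 0\<close> this is the modulus of the column with entries
  \<open>K i\<close>, regarded as one operator into a direct sum that is never formed; for
  \<open>\<epsilon> > 0\<close> it is its invertible regularisation.\<close>

definition col_sqrt :: "'i set \<Rightarrow> real \<Rightarrow> ('i \<Rightarrow> 'a::complex_inner \<Rightarrow> 'a) \<Rightarrow> 'a \<Rightarrow> 'a" where
  "col_sqrt I \<epsilon> K = sqrt_op (\<lambda>x. \<epsilon> *\<^sub>R x + (\<Sum>i\<in>I. adj (K i) (K i x)))"

definition row_sqrt :: "'i set \<Rightarrow> real \<Rightarrow> ('i \<Rightarrow> 'a::complex_inner \<Rightarrow> 'a) \<Rightarrow> 'a \<Rightarrow> 'a" where
  "row_sqrt I \<epsilon> K = sqrt_op (\<lambda>x. \<epsilon> *\<^sub>R x + (\<Sum>i\<in>I. K i (adj (K i) x)))"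

context
  fixes I :: "'i set" and K :: "'i \<Rightarrow> 'a::{complex_inner, complete_space} \<Rightarrow> 'a"
  assumes K: "\<forall>i\<in>I. bop (K i)"
begin

lemma row_sqrt_eq_col_sqrt: "row_sqrt I \<epsilon> K = col_sqrt I \<epsilon> (\<lambda>i. adj (K i))"
  unfolding row_sqrt_def col_sqrt_def using adj_adj[OF K[rule_format]] by simp

lemma pos_op_gram: "pos_op (\<lambda>x. \<Sum>i\<in>I. adj (K i) (K i x))"
  by (rule pos_op_Sum) (rule pos_op_adj_comp[OF K[rule_format]])

lemma Re_cinner_gram: "Re (cinner (\<Sum>i\<in>I. adj (K i) (K i x)) x) = (\<Sum>i\<in>I. (norm (K i x))\<^sup>2)"
  by (simp add: cinner.sum_left cinner_adj_left[OF K[rule_format]] Re_cinner_self)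

text \<open>Cauchy-Schwarz for the form of the Gram operator. The constant is written as the square
  of a root to fit the \<open>b\<^sup>2\<close> of the row and column estimates.\<close>

lemma column_norm_sq_le_onorm_gram:
  "(\<Sum>i\<in>I. (norm (K i x))\<^sup>2) \<le> (sqrt (onorm (\<lambda>x. \<Sum>i\<in>I. adj (K i) (K i x))))\<^sup>2 * (norm x)\<^sup>2"
proof -
  note b = pos_op_bop[OF pos_op_gram]
  have "(\<Sum>i\<in>I. (norm (K i x))\<^sup>2) \<le> norm (\<Sum>i\<in>I. adj (K i) (K i x)) * norm x"
    unfolding Re_cinner_gram[symmetric] by (rule Re_cinner_le)
  also have "\<dots> \<le> onorm (\<lambda>x. \<Sum>i\<in>I. adj (K i) (K i x)) * norm x * norm x"
    by (intro mult_right_mono bop_norm_le[OF b]) auto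
  finally show ?thesis using bop_onorm_pos[OF b] by (simp add: power2_eq_square mult.assoc)
qed

lemma pos_op_col_sqrt: "0 \<le> \<epsilon> \<Longrightarrow> pos_op (col_sqrt I \<epsilon> K)"
  unfolding col_sqrt_def by (intro pos_op_sqrt_op pos_op_shift pos_op_gram)

lemma norm_col_sqrt_0: "(norm (col_sqrt I 0 K x))\<^sup>2 = (\<Sum>i\<in>I. (norm (K i x))\<^sup>2)"
  unfolding col_sqrt_def by (simp add: norm_sqrt_op_sq[OF pos_op_gram] Re_cinner_gram)

context
  fixes \<epsilon> :: real assumes e: "0 < \<epsilon>"
begin

lemma bij_col_sqrt: "bij (col_sqrt I \<epsilon> K)"
  unfolding col_sqrt_def by (rule bij_sqrt_shift[OF pos_op_gram e])

lemma bop_inv_col_sqrt: "bop (inv (col_sqrt I \<epsilon> K))"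
  unfolding col_sqrt_def by (rule bop_inv_sqrt_shift[OF pos_op_gram e])

lemma adj_inv_col_sqrt: "adj (inv (col_sqrt I \<epsilon> K)) = inv (col_sqrt I \<epsilon> K)"
  using e by (intro adj_inv_pos_op pos_op_col_sqrt bij_col_sqrt) simp

lemma column_inv_col_sqrt_le: "(\<Sum>i\<in>I. (norm (K i (inv (col_sqrt I \<epsilon> K) x)))\<^sup>2) \<le> (norm x)\<^sup>2"
  unfolding col_sqrt_def Re_cinner_gram[symmetric] by (rule inv_sqrt_shift_le[OF pos_op_gram e])

end

end

context
  fixes I :: "'i set" and K :: "'i \<Rightarrow> 'a::{complex_inner, complete_space} \<Rightarrow> 'a" and \<epsilon> :: real
  assumes K: "\<forall>i\<in>I. bop (K i)" and e: "0 < \<epsilon>"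
begin

lemma bop_inv_row_sqrt: "bop (inv (row_sqrt I \<epsilon> K))"
  unfolding row_sqrt_eq_col_sqrt[OF K] by (rule bop_inv_col_sqrt[OF ball_bop_adj[OF K] e])

lemma adj_inv_row_sqrt: "adj (inv (row_sqrt I \<epsilon> K)) = inv (row_sqrt I \<epsilon> K)"
  unfolding row_sqrt_eq_col_sqrt[OF K] by (rule adj_inv_col_sqrt[OF ball_bop_adj[OF K] e])

lemma row_inv_row_sqrt_le: "(\<Sum>i\<in>I. (norm (adj (K i) (inv (row_sqrt I \<epsilon> K) x)))\<^sup>2) \<le> (norm x)\<^sup>2"
  unfolding row_sqrt_eq_col_sqrt[OF K] by (rule column_inv_col_sqrt_le[OF ball_bop_adj[OF K] e])

end

lemma row_norm_sq_le_onorm_gram: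
  fixes K :: "'i \<Rightarrow> 'a::{complex_inner, complete_space} \<Rightarrow> 'a"
  assumes K: "\<forall>i\<in>I. bop (K i)"
  shows "(\<Sum>i\<in>I. (norm (adj (K i) x))\<^sup>2) \<le> (sqrt (onorm (\<lambda>x. \<Sum>i\<in>I. K i (adj (K i) x))))\<^sup>2 * (norm x)\<^sup>2"
  using column_norm_sq_le_onorm_gram[OF ball_bop_adj[OF K], of x] by (simp add: adj_adj[OF K[rule_format]])

lemma norm_row_sqrt_0:
  fixes K :: "'i \<Rightarrow> 'a::{complex_inner, complete_space} \<Rightarrow> 'a"
  assumes K: "\<forall>i\<in>I. bop (K i)"
  shows "(norm (row_sqrt I 0 K x))\<^sup>2 = (\<Sum>i\<in>I. (norm (adj (K i) x))\<^sup>2)"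
  unfolding row_sqrt_eq_col_sqrt[OF K] by (rule norm_col_sqrt_0[OF ball_bop_adj[OF K]])

lemma pos_op_row_sqrt:
  fixes K :: "'i \<Rightarrow> 'a::{complex_inner, complete_space} \<Rightarrow> 'a"
  assumes K: "\<forall>i\<in>I. bop (K i)" and "0 \<le> \<epsilon>"
  shows "pos_op (row_sqrt I \<epsilon> K)"
  unfolding row_sqrt_eq_col_sqrt[OF K] by (rule pos_op_col_sqrt[OF ball_bop_adj[OF K] assms(2)])

text \<open>Common core of two bounds: \<open>T i\<close> is \<open>C i\<close> after
  \<open>X\<close>, dominated by the Gram root after \<open>X\<close>, or \<open>C i\<close> after
  the inverse root and \<open>X\<close>, dominated by \<open>X\<close> itself. The factors
  \<open>A i\<close> and \<open>D i\<close> act diagonally, and the column \<open>B\<close> is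
  applied last.\<close>

lemma hs_norm_column_mult_le:
  fixes A B D T :: "'i \<Rightarrow> 'a::{complex_inner, complete_space} \<Rightarrow> 'a"
  assumes I: "finite I" and K: "hs_class K"
    and bops: "\<And>i. i \<in> I \<Longrightarrow> bop (A i)" "\<And>i. i \<in> I \<Longrightarrow> bop (B i)"
      "\<And>i. i \<in> I \<Longrightarrow> bop (D i)" "\<And>i. i \<in> I \<Longrightarrow> bop (T i)"
    and T: "\<And>x. (\<Sum>i\<in>I. (norm (T i x))\<^sup>2) \<le> (norm (K x))\<^sup>2"
    and b: "\<And>y. (\<Sum>i\<in>I. (norm (B i y))\<^sup>2) \<le> b\<^sup>2 * (norm y)\<^sup>2" "0 \<le> b"
    and m: "\<And>i. i \<in> I \<Longrightarrow> onorm (A i) \<le> m" "0 \<le> m"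
    and k: "\<And>i. i \<in> I \<Longrightarrow> onorm (D i) \<le> k" "0 \<le> k"
  shows "hs_norm (\<lambda>x. \<Sum>i\<in>I. A i (T i (D i (B i x)))) \<le> m * k * b * hs_norm K"
proof -
  have hT: "hs_class (T i)" if "i \<in> I" for i by (rule hs_class_column[OF I K bops(4) T that])
  have hTD: "hs_class (\<lambda>x. T i (D i x))" if "i \<in> I" for i
    by (rule hs_class_comp_right[OF bops(3) hT, OF that that])
  have hH: "hs_class (\<lambda>x. A i (T i (D i x)))" if "i \<in> I" for i
    by (rule hs_class_comp_left[OF bops(1) hTD, OF that that])
  have nH: "hs_norm (\<lambda>x. A i (T i (D i x))) \<le> m * k * hs_norm (T i)" if i: "i \<in> I" for i
  proof -
    have "hs_norm (\<lambda>x. A i (T i (D i x))) \<le> onorm (A i) * hs_norm (\<lambda>x. T i (D i x))"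
      by (rule hs_norm_comp_left[OF bops(1)[OF i] hTD[OF i]])
    also have "\<dots> \<le> m * (hs_norm (T i) * k)"
      using hs_norm_comp_right[OF bops(3)[OF i] hT[OF i]]
        mult_left_mono[OF k(1)[OF i] hs_norm_nonneg[OF hT[OF i]]] hs_norm_nonneg[OF hTD[OF i]] m(2)
      by (intro mult_mono m(1)[OF i]) auto
    finally show ?thesis by (simp add: algebra_simps)
  qed
  have "(\<Sum>i\<in>I. (hs_norm (\<lambda>x. A i (T i (D i x))))\<^sup>2) \<le> (\<Sum>i\<in>I. (m * k)\<^sup>2 * (hs_norm (T i))\<^sup>2)"
    unfolding power_mult_distrib[symmetric] by (intro sum_mono power_mono nH hs_norm_nonneg hH)
  also have "\<dots> \<le> (m * k)\<^sup>2 * (hs_norm K)\<^sup>2"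
    unfolding sum_distrib_left[symmetric]
    by (intro mult_left_mono hs_norm_column[OF I K bops(4) T]) auto
  finally have "(\<Sum>i\<in>I. (hs_norm (\<lambda>x. A i (T i (D i x))))\<^sup>2) \<le> (m * k * hs_norm K)\<^sup>2"
    by (simp add: power_mult_distrib)
  then have "hs_norm (\<lambda>x. \<Sum>i\<in>I. A i (T i (D i (B i x)))) \<le> m * k * hs_norm K * b"
    using hs_norm_row_times_column[of I B b "\<lambda>i x. A i (T i (D i x))" "m * k * hs_norm K"]
      bops(2) b hH m k hs_norm_nonneg[OF K] by simp
  then show ?thesis by (simp add: algebra_simps)
qed

text \<open>Mirror image of the column version: domination is stated for adjoints because the
  entries \<open>T i\<close> now form a row, with the root of \<open>D\<close> to the right of
  \<open>X\<close>.\<close>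

lemma hs_norm_row_mult_le:
  fixes A B C T :: "'i \<Rightarrow> 'a::{complex_inner, complete_space} \<Rightarrow> 'a"
  assumes I: "finite I" and K: "hs_class K"
    and bops: "\<And>i. i \<in> I \<Longrightarrow> bop (A i)" "\<And>i. i \<in> I \<Longrightarrow> bop (B i)"
      "\<And>i. i \<in> I \<Longrightarrow> bop (C i)" "\<And>i. i \<in> I \<Longrightarrow> bop (T i)"
    and T: "\<And>x. (\<Sum>i\<in>I. (norm (adj (T i) x))\<^sup>2) \<le> (norm (adj K x))\<^sup>2"
    and a: "\<And>y. (\<Sum>i\<in>I. (norm (adj (A i) y))\<^sup>2) \<le> a\<^sup>2 * (norm y)\<^sup>2" "0 \<le> a"
    and m: "\<And>i. i \<in> I \<Longrightarrow> onorm (B i) \<le> m" "0 \<le> m"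
    and k: "\<And>i. i \<in> I \<Longrightarrow> onorm (C i) \<le> k" "0 \<le> k"
  shows "hs_norm (\<lambda>x. \<Sum>i\<in>I. A i (C i (T i (B i x)))) \<le> m * k * a * hs_norm K"
proof -
  have hT': "hs_class (adj (T i))" if "i \<in> I" for i
    by (rule hs_class_column[OF I hs_class_adj[OF K] bop_adj[OF bops(4)] T that])
  have hT: "hs_class (T i)" if "i \<in> I" for i
    using hs_class_adj[OF hT'[OF that]] by (simp add: adj_adj[OF bops(4)[OF that]])
  have hCT: "hs_class (\<lambda>x. C i (T i x))" if "i \<in> I" for i
    by (rule hs_class_comp_left[OF bops(3) hT, OF that that])
  have hH: "hs_class (\<lambda>x. C i (T i (B i x)))" if "i \<in> I" for i
    by (rule hs_class_comp_right[OF bops(2) hCT, OF that that])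
  have nH: "hs_norm (\<lambda>x. C i (T i (B i x))) \<le> m * k * hs_norm (adj (T i))" if i: "i \<in> I" for i
  proof -
    have "hs_norm (\<lambda>x. C i (T i (B i x))) \<le> hs_norm (\<lambda>x. C i (T i x)) * onorm (B i)"
      by (rule hs_norm_comp_right[OF bops(2)[OF i] hCT[OF i]])
    also have "\<dots> \<le> (k * hs_norm (T i)) * m"
      using hs_norm_comp_left[OF bops(3)[OF i] hT[OF i]]
        mult_right_mono[OF k(1)[OF i] hs_norm_nonneg[OF hT[OF i]]] hs_norm_nonneg[OF hT[OF i]] k(2)
        bop_onorm_pos[OF bops(2)[OF i]]
      by (intro mult_mono m(1)[OF i]) auto
    finally show ?thesis by (simp add: algebra_simps hs_norm_adj[OF hT[OF i]])
  qed
  have "(\<Sum>i\<in>I. (hs_norm (\<lambda>x. C i (T i (B i x))))\<^sup>2) \<le> (\<Sum>i\<in>I. (m * k)\<^sup>2 * (hs_norm (adj (T i)))\<^sup>2)"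
    unfolding power_mult_distrib[symmetric] by (intro sum_mono power_mono nH hs_norm_nonneg hH)
  also have "\<dots> \<le> (m * k)\<^sup>2 * (hs_norm (adj K))\<^sup>2"
    unfolding sum_distrib_left[symmetric]
    by (intro mult_left_mono hs_norm_column[OF I hs_class_adj[OF K] bop_adj[OF bops(4)] T]) auto
  finally have "(\<Sum>i\<in>I. (hs_norm (\<lambda>x. C i (T i (B i x))))\<^sup>2) \<le> (m * k * hs_norm K)\<^sup>2"
    by (simp add: power_mult_distrib hs_norm_adj[OF K])
  then have "hs_norm (\<lambda>x. \<Sum>i\<in>I. A i (C i (T i (B i x)))) \<le> a * (m * k * hs_norm K)"
    using hs_norm_row[of I A a "\<lambda>i x. C i (T i (B i x))" "m * k * hs_norm K"]
      bops(1) a hH m k hs_norm_nonneg[OF K] by simp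
  then show ?thesis by (simp add: algebra_simps)
qed

section \<open>Elementary operator bounds with the weights already absorbed\<close>

context
  fixes I :: "'i set" and A B C D :: "'i \<Rightarrow> 'a::{complex_inner, complete_space} \<Rightarrow> 'a"
  assumes I: "finite I"
    and ball: "\<forall>i\<in>I. bop (A i)" "\<forall>i\<in>I. bop (B i)" "\<forall>i\<in>I. bop (C i)" "\<forall>i\<in>I. bop (D i)"
begin

private lemmas bops = ball[rule_format]

lemma middle_factor_bound:
  assumes X: "bop X" and m: "\<And>i. i \<in> I \<Longrightarrow> onorm (C i) * onorm (D i) \<le> m" and i: "i \<in> I"
  shows "norm (C i (X (D i y))) \<le> m * onorm X * norm y"
proof -
  have "norm (C i (X (D i y))) \<le> onorm (C i) * norm (X (D i y))" by (rule bop_norm_le[OF bops(3)[OF i]])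
  also have "\<dots> \<le> onorm (C i) * (onorm X * (onorm (D i) * norm y))"
    using bop_norm_le[OF X, of "D i y"]
      mult_left_mono[OF bop_norm_le[OF bops(4)[OF i], of y] bop_onorm_pos[OF X]]
    by (intro mult_left_mono bop_onorm_pos[OF bops(3)[OF i]]) linarith
  also have "\<dots> = (onorm (C i) * onorm (D i)) * (onorm X * norm y)" by (simp add: algebra_simps)
  also have "\<dots> \<le> m * (onorm X * norm y)"
    using m[OF i] bop_onorm_pos[OF X] by (intro mult_right_mono) auto
  finally show ?thesis by (simp add: mult.assoc)
qed

lemma onorm_elementary_le:
  assumes X: "bop X" and m: "\<And>i. i \<in> I \<Longrightarrow> onorm (C i) * onorm (D i) \<le> m" "0 \<le> m"
  shows "onorm (\<lambda>x. \<Sum>i\<in>I. A i (C i (X (D i (B i x)))))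
    \<le> m * sqrt (onorm (\<lambda>x. \<Sum>i\<in>I. A i (adj (A i) x))) * sqrt (onorm (\<lambda>x. \<Sum>i\<in>I. adj (B i) (B i x))) * onorm X"
proof -
  have "onorm (\<lambda>x. \<Sum>i\<in>I. A i (C i (X (D i (B i x)))))
    \<le> (m * onorm X) * sqrt (onorm (\<lambda>x. \<Sum>i\<in>I. A i (adj (A i) x))) * sqrt (onorm (\<lambda>x. \<Sum>i\<in>I. adj (B i) (B i x)))"
  proof (rule onorm_row_diag_column_le[where G = "\<lambda>i y. C i (X (D i y))", OF bops(1)])
    show "0 \<le> sqrt (onorm (\<lambda>x. \<Sum>i\<in>I. A i (adj (A i) x)))"
      using bop_onorm_pos[OF pos_op_bop[OF pos_op_gram[OF ball_bop_adj[OF ball(1)]]]] by (simp add: adj_adj[OF bops(1)])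
    show "0 \<le> sqrt (onorm (\<lambda>x. \<Sum>i\<in>I. adj (B i) (B i x)))"
      using bop_onorm_pos[OF pos_op_bop[OF pos_op_gram[OF ball(2)]]] by simp
    show "0 \<le> m * onorm X" using m(2) bop_onorm_pos[OF X] by simp
  qed (rule row_norm_sq_le_onorm_gram[OF ball(1)] column_norm_sq_le_onorm_gram[OF ball(2)]
      middle_factor_bound[OF X m(1)] | assumption)+
  then show ?thesis by (simp add: algebra_simps)
qed

text \<open>The inverse roots are absorbed into the outer families: the row with entries
  \<open>?R A i\<close> and the column with entries \<open>B i ?S\<close> are contractions, so only
  the diagonal factor contributes.\<close>

lemma onorm_regularized_le:
  assumes X: "bop X" and m: "\<And>i. i \<in> I \<Longrightarrow> onorm (C i) * onorm (D i) \<le> m" "0 \<le> m"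
    and pos: "0 < \<eta>" "0 < \<zeta>"
  shows "onorm (inv (row_sqrt I \<eta> A) \<circ> (\<lambda>x. \<Sum>i\<in>I. A i (C i (X (D i (B i x))))) \<circ> inv (col_sqrt I \<zeta> B))
    \<le> m * onorm X"
proof -
  let ?R = "inv (row_sqrt I \<eta> A)" and ?S = "inv (col_sqrt I \<zeta> B)"
  note R = bop_inv_row_sqrt[OF ball(1) pos(1)]
  have "?R \<circ> (\<lambda>x. \<Sum>i\<in>I. A i (C i (X (D i (B i x))))) \<circ> ?S
      = (\<lambda>x. \<Sum>i\<in>I. ?R (A i (C i (X (D i (B i (?S x)))))))"
    by (simp add: fun_eq_iff bop_sum[OF R])
  moreover have "onorm (\<lambda>x. \<Sum>i\<in>I. ?R (A i (C i (X (D i (B i (?S x))))))) \<le> (m * onorm X) * 1 * 1"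
  proof (rule onorm_row_diag_column_le[where G = "\<lambda>i y. C i (X (D i y))" and A = "\<lambda>i y. ?R (A i y)"
        and B = "\<lambda>i y. B i (?S y)"])
    show "bop (\<lambda>y. ?R (A i y))" if "i \<in> I" for i by (rule bop_compose[OF R bops(1)[OF that]])
    have "adj (\<lambda>y. ?R (A i y)) = (\<lambda>y. adj (A i) (?R y))" if "i \<in> I" for i
      by (simp add: adj_compose[OF R bops(1)[OF that]] adj_inv_row_sqrt[OF ball(1) pos(1)])
    then show "(\<Sum>i\<in>I. (norm (adj (\<lambda>y. ?R (A i y)) y))\<^sup>2) \<le> 1\<^sup>2 * (norm y)\<^sup>2" for y
      using row_inv_row_sqrt_le[OF ball(1) pos(1), of y] by simp
    show "(\<Sum>i\<in>I. (norm (B i (?S y)))\<^sup>2) \<le> 1\<^sup>2 * (norm y)\<^sup>2" for y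
      using column_inv_col_sqrt_le[OF ball(2) pos(2), of y] by simp
    show "0 \<le> m * onorm X" using m(2) bop_onorm_pos[OF X] by simp
  qed (use middle_factor_bound[OF X m(1)] in auto)
  ultimately show ?thesis by simp
qed

lemma hs_norm_elementary_le_column:
  assumes X: "hs_class X" and m: "\<And>i. i \<in> I \<Longrightarrow> onorm (A i) \<le> m" "0 \<le> m"
    and k: "\<And>i. i \<in> I \<Longrightarrow> onorm (D i) \<le> k" "0 \<le> k"
  shows "hs_norm (\<lambda>x. \<Sum>i\<in>I. A i (C i (X (D i (B i x)))))
    \<le> m * k * sqrt (onorm (\<lambda>x. \<Sum>i\<in>I. adj (B i) (B i x))) * hs_norm (col_sqrt I 0 C \<circ> X)"
proof (rule hs_norm_column_mult_le[where A = A and D = D and B = B and T = "\<lambda>i x. C i (X x)", OF I])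
  show "hs_class (col_sqrt I 0 C \<circ> X)"
    using hs_class_comp_left[OF pos_op_bop[OF pos_op_col_sqrt[OF ball(3)]] X, of 0] by (simp add: comp_def)
  show "bop (\<lambda>x. C i (X x))" if "i \<in> I" for i by (rule bop_compose[OF bops(3)[OF that] hs_class_bop[OF X]])
  show "(\<Sum>i\<in>I. (norm (C i (X x)))\<^sup>2) \<le> (norm ((col_sqrt I 0 C \<circ> X) x))\<^sup>2" for x
    by (simp add: norm_col_sqrt_0[OF ball(3)])
  show "0 \<le> sqrt (onorm (\<lambda>x. \<Sum>i\<in>I. adj (B i) (B i x)))"
    using bop_onorm_pos[OF pos_op_bop[OF pos_op_gram[OF ball(2)]]] by simp
qed (use bops m k column_norm_sq_le_onorm_gram[OF ball(2)] in auto)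

lemma hs_norm_regularized_le_column:
  assumes X: "hs_class X" and m: "\<And>i. i \<in> I \<Longrightarrow> onorm (A i) \<le> m" "0 \<le> m"
    and k: "\<And>i. i \<in> I \<Longrightarrow> onorm (D i) \<le> k" "0 \<le> k" and pos: "0 < \<eta>" "0 < \<zeta>"
  shows "hs_norm (\<lambda>x. \<Sum>i\<in>I. A i (C i (inv (col_sqrt I \<eta> C) (X (D i (B i (inv (col_sqrt I \<zeta> B) x)))))))
    \<le> m * k * hs_norm X"
proof -
  let ?R = "inv (col_sqrt I \<eta> C)" and ?S = "inv (col_sqrt I \<zeta> B)"
  note R = bop_inv_col_sqrt[OF ball(3) pos(1)] and S = bop_inv_col_sqrt[OF ball(2) pos(2)]
  have "hs_norm (\<lambda>x. \<Sum>i\<in>I. A i (C i (?R (X (D i (B i (?S x))))))) \<le> m * k * 1 * hs_norm X"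
  proof (rule hs_norm_column_mult_le[where A = A and D = D and T = "\<lambda>i x. C i (?R (X x))" and B = "\<lambda>i y. B i (?S y)", OF I X])
    show "bop (\<lambda>x. C i (?R (X x)))" if "i \<in> I" for i
      by (rule bop_compose[OF bops(3)[OF that] bop_compose[OF R hs_class_bop[OF X]]])
    show "bop (\<lambda>y. B i (?S y))" if "i \<in> I" for i by (rule bop_compose[OF bops(2)[OF that] S])
    show "(\<Sum>i\<in>I. (norm (C i (?R (X x))))\<^sup>2) \<le> (norm (X x))\<^sup>2" for x
      by (rule column_inv_col_sqrt_le[OF ball(3) pos(1)])
    show "(\<Sum>i\<in>I. (norm (B i (?S y)))\<^sup>2) \<le> 1\<^sup>2 * (norm y)\<^sup>2" for y
      using column_inv_col_sqrt_le[OF ball(2) pos(2), of y] by simp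
  qed (use bops m k in auto)
  then show ?thesis by simp
qed

lemma hs_norm_elementary_le_row:
  assumes X: "hs_class X" and m: "\<And>i. i \<in> I \<Longrightarrow> onorm (B i) \<le> m" "0 \<le> m"
    and k: "\<And>i. i \<in> I \<Longrightarrow> onorm (C i) \<le> k" "0 \<le> k"
  shows "hs_norm (\<lambda>x. \<Sum>i\<in>I. A i (C i (X (D i (B i x)))))
    \<le> m * k * sqrt (onorm (\<lambda>x. \<Sum>i\<in>I. A i (adj (A i) x))) * hs_norm (X \<circ> row_sqrt I 0 D)"
proof (rule hs_norm_row_mult_le[where B = B and C = C and A = A and T = "\<lambda>i x. X (D i x)", OF I])
  note bX = hs_class_bop[OF X]
  have p: "pos_op (row_sqrt I 0 D)" by (rule pos_op_row_sqrt[OF ball(4)]) auto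
  show "hs_class (X \<circ> row_sqrt I 0 D)"
    using hs_class_comp_right[OF pos_op_bop[OF p] X] by (simp add: comp_def)
  show "bop (\<lambda>x. X (D i x))" if "i \<in> I" for i by (rule bop_compose[OF bX bops(4)[OF that]])
  have "adj (\<lambda>x. X (D i x)) = (\<lambda>x. adj (D i) (adj X x))" if "i \<in> I" for i
    by (rule adj_compose[OF bX bops(4)[OF that]])
  moreover have "adj (X \<circ> row_sqrt I 0 D) = (\<lambda>x. row_sqrt I 0 D (adj X x))"
    using adj_compose[OF bX pos_op_bop[OF p]] by (simp add: comp_def adj_pos_op[OF p])
  ultimately show "(\<Sum>i\<in>I. (norm (adj (\<lambda>x. X (D i x)) x))\<^sup>2) \<le> (norm (adj (X \<circ> row_sqrt I 0 D) x))\<^sup>2" for x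
    by (simp add: norm_row_sqrt_0[OF ball(4)])
  show "0 \<le> sqrt (onorm (\<lambda>x. \<Sum>i\<in>I. A i (adj (A i) x)))"
    using bop_onorm_pos[OF pos_op_bop[OF pos_op_gram[OF ball_bop_adj[OF ball(1)]]]] by (simp add: adj_adj[OF bops(1)])
qed (use bops m k row_norm_sq_le_onorm_gram[OF ball(1)] in auto)

lemma hs_norm_regularized_le_row:
  assumes X: "hs_class X" and m: "\<And>i. i \<in> I \<Longrightarrow> onorm (B i) \<le> m" "0 \<le> m"
    and k: "\<And>i. i \<in> I \<Longrightarrow> onorm (C i) \<le> k" "0 \<le> k" and pos: "0 < \<eta>" "0 < \<theta>"
  shows "hs_norm (inv (row_sqrt I \<eta> A) \<circ> (\<lambda>x. \<Sum>i\<in>I. A i (C i (X (inv (row_sqrt I \<theta> D) (D i (B i x)))))))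
    \<le> m * k * hs_norm X"
proof -
  note bX = hs_class_bop[OF X]
  let ?R = "inv (row_sqrt I \<eta> A)" and ?S = "inv (row_sqrt I \<theta> D)"
  note R = bop_inv_row_sqrt[OF ball(1) pos(1)] and S = bop_inv_row_sqrt[OF ball(4) pos(2)]
  note aR = adj_inv_row_sqrt[OF ball(1) pos(1)] and aS = adj_inv_row_sqrt[OF ball(4) pos(2)]
  have "?R \<circ> (\<lambda>x. \<Sum>i\<in>I. A i (C i (X (?S (D i (B i x))))))
      = (\<lambda>x. \<Sum>i\<in>I. ?R (A i (C i (X (?S (D i (B i x)))))))"
    by (simp add: fun_eq_iff bop_sum[OF R])
  moreover have "hs_norm (\<lambda>x. \<Sum>i\<in>I. ?R (A i (C i (X (?S (D i (B i x))))))) \<le> m * k * 1 * hs_norm X"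
  proof (rule hs_norm_row_mult_le[where B = B and C = C and T = "\<lambda>i x. X (?S (D i x))" and A = "\<lambda>i y. ?R (A i y)", OF I X])
    show "bop (\<lambda>y. ?R (A i y))" if "i \<in> I" for i by (rule bop_compose[OF R bops(1)[OF that]])
    have bSD: "bop (\<lambda>x. ?S (D i x))" if "i \<in> I" for i by (rule bop_compose[OF S bops(4)[OF that]])
    show "bop (\<lambda>x. X (?S (D i x)))" if "i \<in> I" for i by (rule bop_compose[OF bX bSD[OF that]])
    have "adj (\<lambda>y. ?R (A i y)) = (\<lambda>y. adj (A i) (?R y))" if "i \<in> I" for i
      by (simp add: adj_compose[OF R bops(1)[OF that]] aR)
    then show "(\<Sum>i\<in>I. (norm (adj (\<lambda>y. ?R (A i y)) y))\<^sup>2) \<le> 1\<^sup>2 * (norm y)\<^sup>2" for y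
      using row_inv_row_sqrt_le[OF ball(1) pos(1), of y] by simp
    have "adj (\<lambda>x. X (?S (D i x))) = (\<lambda>x. adj (D i) (?S (adj X x)))" if "i \<in> I" for i
      by (simp add: adj_compose[OF bX bSD[OF that]] adj_compose[OF S bops(4)[OF that]] aS)
    then show "(\<Sum>i\<in>I. (norm (adj (\<lambda>x. X (?S (D i x))) y))\<^sup>2) \<le> (norm (adj X y))\<^sup>2" for y
      using row_inv_row_sqrt_le[OF ball(4) pos(2), of "adj X y"] by simp
  qed (use bops m k in auto)
  ultimately show ?thesis by simp
qed

text \<open>The inverse roots turn the \<open>C i\<close> into a contractive column and the
  \<open>D i\<close> into a contractive row, exactly the data \<open>T\<close> and \<open>S\<close>
  of the dual bound.\<close>

lemma tr_norm_regularized_le: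
  assumes X: "trace_class X" and m: "\<And>i. i \<in> I \<Longrightarrow> onorm (A i) * onorm (B i) \<le> m" "0 \<le> m"
    and pos: "0 < \<eta>" "0 < \<theta>"
  shows "tr_norm (\<lambda>x. \<Sum>i\<in>I. A i (C i (inv (col_sqrt I \<eta> C) (X (inv (row_sqrt I \<theta> D) (D i (B i x)))))))
    \<le> m * tr_norm X"
proof (rule tr_norm_le_dualI)
  have bX: "bop X" using X by (simp add: trace_class_def)
  let ?R = "inv (col_sqrt I \<eta> C)" and ?S = "inv (row_sqrt I \<theta> D)"
  note R = bop_inv_col_sqrt[OF ball(3) pos(1)] and S = bop_inv_row_sqrt[OF ball(4) pos(2)]
  have bCR: "bop (\<lambda>x. C i (?R x))" if "i \<in> I" for i by (rule bop_compose[OF bops(3)[OF that] R])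
  have bSD: "bop (\<lambda>x. ?S (D i x))" if "i \<in> I" for i by (rule bop_compose[OF S bops(4)[OF that]])
  show "bop (\<lambda>x. \<Sum>i\<in>I. A i (C i (?R (X (?S (D i (B i x)))))))"
    by (rule bop_Sum, rule bop_compose[OF bops(1) bop_compose[OF bCR bop_compose[OF bX bop_compose[OF bSD bops(2)]]]])
  have adjSD: "adj (\<lambda>x. ?S (D i x)) = (\<lambda>x. adj (D i) (?S x))" if "i \<in> I" for i
    by (simp add: adj_compose[OF S bops(4)[OF that]] adj_inv_row_sqrt[OF ball(4) pos(2)])
  fix E :: "'a set" and V :: "'a \<Rightarrow> 'a"
  assume EV: "finite E" "orthonormal E" "bop V" "\<And>x. norm (V x) \<le> norm x"
  show "(\<Sum>e\<in>E. Re (cinner (\<Sum>i\<in>I. A i (C i (?R (X (?S (D i (B i e))))))) (V e))) \<le> m * tr_norm X"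
  proof (rule trace_dual_bound[where T = "\<lambda>i x. C i (?R x)" and S = "\<lambda>i x. ?S (D i x)",
        OF I X bops(1,2) bSD bCR _ _ m EV])
    show "(\<Sum>i\<in>I. (norm (C i (?R x)))\<^sup>2) \<le> (norm x)\<^sup>2" for x
      by (rule column_inv_col_sqrt_le[OF ball(3) pos(1)])
    show "(\<Sum>i\<in>I. (norm (adj (\<lambda>x. ?S (D i x)) x))\<^sup>2) \<le> (norm x)\<^sup>2" for x
      using row_inv_row_sqrt_le[OF ball(4) pos(2), of x] by (simp add: adjSD)
  qed
qed

text \<open>With \<open>c\<close>, \<open>d\<close> the square roots of the two Gram operators, put \<open>T\<^sub>i = C\<^sub>i (\<eta> I + c)\<^sup>-\<^sup>1\<close> and
  \<open>S\<^sub>i = (\<eta> I + d)\<^sup>-\<^sup>1 D\<^sub>i\<close>.  Then \<open>C\<^sub>i = T\<^sub>i c + \<eta> T\<^sub>i\<close> and \<open>D\<^sub>i = d S\<^sub>i + \<eta> S\<^sub>i\<close>, so the dual bound for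
  \<open>c X d\<close> gives the claim up to an error of order \<open>\<eta>\<close>.\<close>

lemma tr_norm_elementary_le:
  assumes X: "trace_class X" and m: "\<And>i. i \<in> I \<Longrightarrow> onorm (A i) * onorm (B i) \<le> m" "0 \<le> m"
  shows "tr_norm (\<lambda>x. \<Sum>i\<in>I. A i (C i (X (D i (B i x)))))
    \<le> m * tr_norm (col_sqrt I 0 C \<circ> X \<circ> row_sqrt I 0 D)"
proof (rule tr_norm_le_dualI)
  have bX: "bop X" using X by (simp add: trace_class_def)
  define c where "c = col_sqrt I 0 C"
  define d where "d = row_sqrt I 0 D"
  have pc: "pos_op c" unfolding c_def by (rule pos_op_col_sqrt[OF ball(3)]) auto
  have pd: "pos_op d" unfolding d_def by (rule pos_op_row_sqrt[OF ball(4)]) auto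
  note bc = pos_op_bop[OF pc] and bd = pos_op_bop[OF pd]
  define Z where "Z = (\<lambda>x. c (X (d x)))"
  have Z: "trace_class Z" unfolding Z_def by (rule trace_class_comp[OF X bc bd])
  have Zeq: "col_sqrt I 0 C \<circ> X \<circ> row_sqrt I 0 D = Z" by (simp add: Z_def c_def d_def comp_def)
  show "bop (\<lambda>x. \<Sum>i\<in>I. A i (C i (X (D i (B i x)))))"
    by (rule bop_Sum, rule bop_compose[OF bops(1) bop_compose[OF bops(3) bop_compose[OF bX bop_compose[OF bops(4,2)]]]])
  fix E :: "'a set" and V :: "'a \<Rightarrow> 'a"
  assume EV: "finite E" "orthonormal E" "bop V" "\<And>x. norm (V x) \<le> norm x"
  \<comment> \<open>Bounds \<open>A i\<close> applied to the coefficient of \<open>\<eta>\<close> in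
    the expansion below, with \<open>T i\<close> and \<open>S i\<close> estimated by 1. It is
    therefore independent of \<open>\<eta>\<close>, as is \<open>M\<close>.\<close>
  define r where "r i e = onorm (A i) * (onorm c * (onorm X * norm (B i e)) + onorm X * norm (D i (B i e)))" for i e
  define M where "M = (\<Sum>e\<in>E. \<Sum>i\<in>I. r i e)"
  have M0: "0 \<le> M"
    unfolding M_def r_def using bops
    by (intro sum_nonneg mult_nonneg_nonneg add_nonneg_nonneg) (auto intro: bop_onorm_pos bc bX)
  have main: "(\<Sum>e\<in>E. Re (cinner (\<Sum>i\<in>I. A i (C i (X (D i (B i e))))) (V e))) \<le> m * tr_norm Z + \<eta> * M"
    if \<eta>: "\<eta> > 0" for \<eta>
  proof -
    obtain W where W: "bop W" "\<And>x. W (c x) + \<eta> *\<^sub>R W x = x" "\<And>x. norm (c (W x)) \<le> norm x"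
      by (rule pos_op_resolvent[OF pc \<eta>]) blast
    obtain R where R: "bop R" "\<And>x y. cinner (R x) y = cinner x (R y)"
      "\<And>x. d (R x) + \<eta> *\<^sub>R R x = x" "\<And>x. norm (d (R x)) \<le> norm x"
      by (rule pos_op_resolvent[OF pd \<eta>]) blast
    define T where "T i x = C i (W x)" for i x
    define S where "S i x = R (D i x)" for i x
    have bT: "bop (T i)" if "i \<in> I" for i unfolding T_def by (rule bop_compose[OF bops(3)[OF that] W(1)])
    have bS: "bop (S i)" if "i \<in> I" for i unfolding S_def by (rule bop_compose[OF R(1) bops(4)[OF that]])
    have adjS: "adj (S i) = (\<lambda>x. adj (D i) (R x))" if "i \<in> I" for i
      unfolding S_def using adj_compose[OF R(1) bops(4)[OF that]] adj_unique[of R R, OF R(2)] by simp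
    have T1: "(\<Sum>i\<in>I. (norm (T i x))\<^sup>2) \<le> (norm x)\<^sup>2" for x
      using power_mono[OF W(3)[of x] norm_ge_zero, of 2]
      by (simp add: T_def c_def norm_col_sqrt_0[OF ball(3)])
    have S1: "(\<Sum>i\<in>I. (norm (adj (S i) x))\<^sup>2) \<le> (norm x)\<^sup>2" for x
      using power_mono[OF R(4)[of x] norm_ge_zero, of 2]
      by (simp add: d_def norm_row_sqrt_0[OF ball(4)] adjS)
    \<comment> \<open>Although \<open>T i\<close> and \<open>S i\<close> depend on
      \<open>\<eta>\<close>, their norms are at most 1 for every \<open>\<eta>\<close>; this keeps
      the error uniform.\<close>
    have Tn: "norm (T i x) \<le> norm x" if "i \<in> I" for i x
    proof -
      have "(norm (T i x))\<^sup>2 \<le> (norm x)\<^sup>2"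
        by (rule order_trans[OF member_le_sum[of i I "\<lambda>i. (norm (T i x))\<^sup>2"] T1]) (use that I in auto)
      then show ?thesis by simp
    qed
    have Sn: "norm (S i x) \<le> norm x" if "i \<in> I" for i x
    proof -
      have "norm (adj (S i) x) \<le> 1 * norm x" for x
      proof -
        have "(norm (adj (S i) x))\<^sup>2 \<le> (norm x)\<^sup>2"
          by (rule order_trans[OF member_le_sum[of i I "\<lambda>i. (norm (adj (S i) x))\<^sup>2"] S1]) (use that I in auto)
        then show ?thesis by simp
      qed
      then have "onorm (adj (S i)) \<le> 1" by (intro onorm_bound) auto
      then have "onorm (adj (S i)) * norm x \<le> 1 * norm x" by (intro mult_right_mono) auto
      then show ?thesis
        using norm_adj_le[OF bop_adj[OF bS[OF that]], of x] by (simp add: adj_adj[OF bS[OF that]])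
    qed
    have split: "Re (cinner (A i (C i (X (D i (B i e))))) (V e))
        \<le> Re (cinner (A i (T i (Z (S i (B i e))))) (V e)) + \<eta> * r i e" if i: "i \<in> I" and e: "e \<in> E" for i e
    proof -
      let ?b = "B i e"
      \<comment> \<open>\<open>C i\<close> is expanded first, and \<open>D i\<close> only inside the
        main term \<open>T i c X D i\<close>; hence the error keeps one unexpanded
        \<open>D i\<close> and has no quadratic term in \<open>\<eta>\<close>.\<close>
      let ?q = "T i (c (X (S i ?b))) + T i (X (D i ?b))"
      have Ci: "C i y = T i (c y) + \<eta> *\<^sub>R T i y" for y
        using arg_cong[OF W(2)[of y], of "C i"]
        by (simp add: T_def bop_add[OF bops(3)[OF i]] bop_scaleR[OF bops(3)[OF i]])
      have Di: "D i y = d (S i y) + \<eta> *\<^sub>R S i y" for y using R(3)[of "D i y"] by (simp add: S_def)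
      have "C i (X (D i ?b)) = T i (c (X (d (S i ?b) + \<eta> *\<^sub>R S i ?b))) + \<eta> *\<^sub>R T i (X (D i ?b))"
        using Ci[of "X (D i ?b)"] Di[of ?b] by simp
      also have "\<dots> = T i (Z (S i ?b)) + \<eta> *\<^sub>R ?q"
        by (simp add: Z_def bop_add[OF bX] bop_scaleR[OF bX] bop_add[OF bc] bop_scaleR[OF bc]
            bop_add[OF bT[OF i]] bop_scaleR[OF bT[OF i]] algebra_simps)
      finally have eq: "A i (C i (X (D i ?b))) = A i (T i (Z (S i ?b))) + \<eta> *\<^sub>R A i ?q"
        by (simp only: bop_add[OF bops(1)[OF i]] bop_scaleR[OF bops(1)[OF i]])
      have "norm (T i (c (X (S i ?b)))) \<le> onorm c * (onorm X * norm ?b)"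
      proof -
        have "norm (T i (c (X (S i ?b)))) \<le> norm (c (X (S i ?b)))" by (rule Tn[OF i])
        also have "\<dots> \<le> onorm c * norm (X (S i ?b))" by (rule bop_norm_le[OF bc])
        also have "\<dots> \<le> onorm c * (onorm X * norm (S i ?b))"
          by (intro mult_left_mono bop_norm_le[OF bX] bop_onorm_pos[OF bc])
        also have "\<dots> \<le> onorm c * (onorm X * norm ?b)"
          by (intro mult_left_mono Sn[OF i] bop_onorm_pos[OF bX] bop_onorm_pos[OF bc])
        finally show ?thesis .
      qed
      moreover have "norm (T i (X (D i ?b))) \<le> onorm X * norm (D i ?b)"
        using Tn[OF i] bop_norm_le[OF bX] by (rule order_trans)
      ultimately have "norm ?q \<le> onorm c * (onorm X * norm ?b) + onorm X * norm (D i ?b)"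
        by (rule norm_triangle_mono)
      then have "norm (A i ?q) \<le> r i e"
        unfolding r_def using bop_norm_le[OF bops(1)[OF i], of ?q] bop_onorm_pos[OF bops(1)[OF i]]
        by (meson mult_left_mono order_trans)
      moreover have "norm (V e) \<le> 1" using EV(4)[of e] EV(2) e by (simp add: orthonormal_def)
      ultimately have "norm (A i ?q) * norm (V e) \<le> r i e * 1"
        by (intro mult_mono) (auto intro: order_trans[OF norm_ge_zero])
      then have "Re (cinner (A i ?q) (V e)) \<le> r i e" using Re_cinner_le[of "A i ?q" "V e"] by simp
      then show ?thesis unfolding eq using \<eta> by (simp add: cinner_add_left cinner_scaleR_left)
    qed
    have "(\<Sum>e\<in>E. Re (cinner (\<Sum>i\<in>I. A i (C i (X (D i (B i e))))) (V e)))
        \<le> (\<Sum>e\<in>E. \<Sum>i\<in>I. Re (cinner (A i (T i (Z (S i (B i e))))) (V e)) + \<eta> * r i e)"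
      unfolding cinner.sum_left Re_sum by (intro sum_mono split)
    also have "\<dots> = (\<Sum>e\<in>E. Re (cinner (\<Sum>i\<in>I. A i (T i (Z (S i (B i e))))) (V e))) + \<eta> * M"
      by (simp add: sum.distrib M_def sum_distrib_left cinner.sum_left)
    also have "\<dots> \<le> m * tr_norm Z + \<eta> * M"
      by (intro add_mono order_refl trace_dual_bound[OF I Z bops(1,2) bS bT T1 S1 m EV])
    finally show ?thesis .
  qed
  show "(\<Sum>e\<in>E. Re (cinner (\<Sum>i\<in>I. A i (C i (X (D i (B i e))))) (V e)))
      \<le> m * tr_norm (col_sqrt I 0 C \<circ> X \<circ> row_sqrt I 0 D)"
    unfolding Zeq
  proof (rule field_le_epsilon)
    fix k :: real assume k: "k > 0"
    have "k / (M + 1) * M \<le> k" using k M0 by (simp add: field_simps)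
    then show "(\<Sum>e\<in>E. Re (cinner (\<Sum>i\<in>I. A i (C i (X (D i (B i e))))) (V e))) \<le> m * tr_norm Z + k"
      using main[of "k / (M + 1)"] k M0 by simp
  qed
qed

end

section \<open>Translation of weighted sums into rows and columns\<close>

lemma reg_sqrt_eq_col_sqrt:
  "reg_sqrt c N (\<lambda>_. 1) (\<lambda>n. adj (K n) \<circ> K n) = col_sqrt {1..N} c K"
  by (simp add: reg_sqrt_def col_sqrt_def)

text \<open>Nonnegativity makes the two factors \<open>sqrt r\<close>, one from \<open>K\<close> and
  one from its adjoint, multiply to the weight \<open>r\<close>.\<close>

lemma scaled_row_gram:
  fixes K :: "'a::{complex_inner, complete_space} \<Rightarrow> 'a"
  assumes "bop K" "0 \<le> r"
  shows "sqrt r *\<^sub>R K (adj (\<lambda>x. sqrt r *\<^sub>R K x) x) = r *\<^sub>R K (adj K x)"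
  using assms by (simp add: adj_scaleR bop_scaleR)

lemma reg_sqrt_eq_row_sqrt:
  fixes K :: "nat \<Rightarrow> 'a::{complex_inner, complete_space} \<Rightarrow> 'a"
  assumes "\<forall>n\<in>{1..N}. bop (K n)" "\<forall>n\<in>{1..N}. 0 \<le> w n"
  shows "reg_sqrt c N w (\<lambda>n. K n \<circ> adj (K n)) = row_sqrt {1..N} c (\<lambda>n x. sqrt (w n) *\<^sub>R K n x)"
  using assms by (simp add: reg_sqrt_def row_sqrt_def scaled_row_gram cong: sum.cong_simp)

text \<open>Only an inequality, since on the zero space the norm of the identity is 0.\<close>

lemma onorm_identity_le_1: "onorm (\<lambda>x::'a::real_normed_vector. x) \<le> 1"
  by (rule onorm_bound) auto

lemma bop_scaleR_compose:
  assumes "bop A" "bop C" "bop X" "bop R"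
  shows "A (C (X (R (s *\<^sub>R y)))) = s *\<^sub>R A (C (X (R y)))"
  using assms by (simp add: bop_scaleR)

theorem theorem2p9:
  fixes A B C D :: "nat \<Rightarrow> ('a::{complex_inner, complete_space} \<Rightarrow> 'a)"
    and lam w :: "nat \<Rightarrow> real"
    and N :: nat
  assumes sep: "separable_space TYPE('a)"
    and N: "N \<ge> 1"
    and ops: "\<forall>n\<in>{1..N}. bop (A n) \<and> bop (B n) \<and> bop (C n) \<and> bop (D n)"
    and lam: "\<forall>n\<in>{1..N}. lam n \<ge> 0"
    and w: "\<forall>n\<in>{1..N}. w n \<ge> 0"
  shows
   "(\<forall>(\<epsilon>::real) (\<zeta>::real) (\<eta>::real) (\<theta>::real). \<epsilon> > 0 \<longrightarrow> \<zeta> > 0 \<longrightarrow> \<eta> > 0 \<longrightarrow> \<theta> > 0 \<longrightarrow>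
      (let Aeta = reg_sqrt \<eta> N lam (\<lambda>n. A n \<circ> adj (A n));
           Bzeta = reg_sqrt \<zeta> N (\<lambda>_. 1) (\<lambda>n. adj (B n) \<circ> B n);
           Ceta = reg_sqrt \<eta> N (\<lambda>_. 1) (\<lambda>n. adj (C n) \<circ> C n);
           Dtheta = reg_sqrt \<theta> N w (\<lambda>n. D n \<circ> adj (D n))
       in
        \<comment> \<open>(1)\<close>
        (\<forall>X. bop X \<longrightarrow>
           onorm (inv Aeta \<circ> (\<lambda>x. \<Sum>n = 1..N. sqrt (lam n) *\<^sub>R A n (C n (X (D n (B n x))))) \<circ> inv Bzeta)
           \<le> Max ((\<lambda>n. onorm (C n) * onorm (D n)) ` {1..N}) * onorm X) \<and>
        \<comment> \<open>(2)\<close>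
        (\<forall>X. hs_class X \<longrightarrow>
           hs_norm (\<lambda>x. \<Sum>n = 1..N. A n (C n (inv Ceta (X (D n (B n (inv Bzeta x)))))))
           \<le> Max ((\<lambda>n. onorm (A n)) ` {1..N}) * Max ((\<lambda>n. onorm (D n)) ` {1..N}) * hs_norm X) \<and>
        \<comment> \<open>(3)\<close>
        (\<forall>X. hs_class X \<longrightarrow>
           hs_norm (inv Aeta \<circ> (\<lambda>x. \<Sum>n = 1..N. (sqrt (lam n) * sqrt (w n)) *\<^sub>R
                        A n (C n (X (inv Dtheta (D n (B n x)))))))
           \<le> Max ((\<lambda>n. onorm (B n)) ` {1..N}) * Max ((\<lambda>n. onorm (C n)) ` {1..N}) * hs_norm X) \<and>
        \<comment> \<open>(4)\<close>
        (\<forall>X. trace_class X \<longrightarrow>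
           tr_norm (\<lambda>x. \<Sum>n = 1..N. sqrt (w n) *\<^sub>R
                        A n (C n (inv Ceta (X (inv Dtheta (D n (B n x)))))))
           \<le> Max ((\<lambda>n. onorm (A n) * onorm (B n)) ` {1..N}) * tr_norm X)))
   \<and>
    \<comment> \<open>(1')\<close>
    (\<forall>X. bop X \<longrightarrow>
       onorm (\<lambda>x. \<Sum>n = 1..N. sqrt (lam n) *\<^sub>R A n (C n (X (D n (B n x)))))
       \<le> Max ((\<lambda>n. onorm (C n) * onorm (D n)) ` {1..N})
         * sqrt (onorm (\<lambda>x. \<Sum>n = 1..N. lam n *\<^sub>R A n (adj (A n) x)))
         * sqrt (onorm (\<lambda>x. \<Sum>n = 1..N. adj (B n) (B n x))) * onorm X) \<and>
    \<comment> \<open>(2')\<close>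
    (\<forall>X. hs_class X \<longrightarrow>
       hs_norm (\<lambda>x. \<Sum>n = 1..N. A n (C n (X (D n (B n x)))))
       \<le> Max ((\<lambda>n. onorm (A n)) ` {1..N}) * Max ((\<lambda>n. onorm (D n)) ` {1..N})
         * sqrt (onorm (\<lambda>x. \<Sum>n = 1..N. adj (B n) (B n x)))
         * hs_norm (sqrt_op (\<lambda>x. \<Sum>n = 1..N. adj (C n) (C n x)) \<circ> X)) \<and>
    \<comment> \<open>(3')\<close>
    (\<forall>X. hs_class X \<longrightarrow>
       hs_norm (\<lambda>x. \<Sum>n = 1..N. (sqrt (lam n) * sqrt (w n)) *\<^sub>R A n (C n (X (D n (B n x)))))
       \<le> Max ((\<lambda>n. onorm (B n)) ` {1..N}) * Max ((\<lambda>n. onorm (C n)) ` {1..N})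
         * sqrt (onorm (\<lambda>x. \<Sum>n = 1..N. lam n *\<^sub>R A n (adj (A n) x)))
         * hs_norm (X \<circ> sqrt_op (\<lambda>x. \<Sum>n = 1..N. w n *\<^sub>R D n (adj (D n) x)))) \<and>
    \<comment> \<open>(4')\<close>
    (\<forall>X. trace_class X \<longrightarrow>
       tr_norm (\<lambda>x. \<Sum>n = 1..N. sqrt (w n) *\<^sub>R A n (C n (X (D n (B n x)))))
       \<le> Max ((\<lambda>n. onorm (A n) * onorm (B n)) ` {1..N})
         * tr_norm (sqrt_op (\<lambda>x. \<Sum>n = 1..N. adj (C n) (C n x)) \<circ> X
                    \<circ> sqrt_op (\<lambda>x. \<Sum>n = 1..N. w n *\<^sub>R D n (adj (D n) x))))
   \<and>
   (\<forall>(\<epsilon>::real) (\<zeta>::real) (\<eta>::real) (\<theta>::real). \<epsilon> > 0 \<longrightarrow> \<zeta> > 0 \<longrightarrow> \<eta> > 0 \<longrightarrow> \<theta> > 0 \<longrightarrow>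
      (let Aeta = reg_sqrt \<eta> N lam (\<lambda>n. A n \<circ> adj (A n));
           Bzeta = reg_sqrt \<zeta> N (\<lambda>_. 1) (\<lambda>n. adj (B n) \<circ> B n);
           Aeps = reg_sqrt \<epsilon> N (\<lambda>_. 1) (\<lambda>n. adj (A n) \<circ> A n);
           Btheta = reg_sqrt \<theta> N w (\<lambda>n. B n \<circ> adj (B n))
       in
        \<comment> \<open>(5)\<close>
        (\<forall>X. bop X \<longrightarrow>
           onorm (inv Aeta \<circ> (\<lambda>x. \<Sum>n = 1..N. sqrt (lam n) *\<^sub>R A n (X (B n x))) \<circ> inv Bzeta)
           \<le> onorm X) \<and>
        \<comment> \<open>(6)\<close>
        (\<forall>X. hs_class X \<longrightarrow>
           hs_norm (\<lambda>x. \<Sum>n = 1..N. A n (inv Aeps (X (B n (inv Bzeta x))))) \<le> hs_norm X) \<and>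
        \<comment> \<open>(7)\<close>
        (\<forall>X. hs_class X \<longrightarrow>
           hs_norm (inv Aeta \<circ> (\<lambda>x. \<Sum>n = 1..N. (sqrt (lam n) * sqrt (w n)) *\<^sub>R
                        A n (X (inv Btheta (B n x)))))
           \<le> hs_norm X) \<and>
        \<comment> \<open>(8)\<close>
        (\<forall>X. trace_class X \<longrightarrow>
           tr_norm (\<lambda>x. \<Sum>n = 1..N. sqrt (w n) *\<^sub>R A n (inv Aeps (X (inv Btheta (B n x)))))
           \<le> tr_norm X)))"
proof -
  let ?I = "{1..N}"
  \<comment> \<open>Roots of the weights are moved into the row operators. \<open>w\<close> belongs
    to \<open>D\<close> in the general bounds and to \<open>B\<close> in the specialised ones, where
    \<open>B\<close> takes over the part of \<open>D\<close>.\<close>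
  define A' where "A' n x = sqrt (lam n) *\<^sub>R A n x" for n x
  define B' where "B' n x = sqrt (w n) *\<^sub>R B n x" for n x
  define D' where "D' n x = sqrt (w n) *\<^sub>R D n x" for n x
  have bA: "\<forall>n\<in>?I. bop (A n)" and bB: "\<forall>n\<in>?I. bop (B n)" and bC: "\<forall>n\<in>?I. bop (C n)"
    and bD: "\<forall>n\<in>?I. bop (D n)" using ops by auto
  have bA': "\<forall>n\<in>?I. bop (A' n)" and bB': "\<forall>n\<in>?I. bop (B' n)" and bD': "\<forall>n\<in>?I. bop (D' n)"
    unfolding A'_def B'_def D'_def using bA bB bD by (auto intro: bop_scale)
  have bId: "\<forall>n\<in>?I. bop (\<lambda>x::'a. x)" by (simp add: bop_id)
  have regA: "reg_sqrt c N lam (\<lambda>n. A n \<circ> adj (A n)) = row_sqrt ?I c A'" for c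
    unfolding A'_def by (rule reg_sqrt_eq_row_sqrt[OF bA lam])
  have regB: "reg_sqrt c N w (\<lambda>n. B n \<circ> adj (B n)) = row_sqrt ?I c B'" for c
    unfolding B'_def by (rule reg_sqrt_eq_row_sqrt[OF bB w])
  have regD: "reg_sqrt c N w (\<lambda>n. D n \<circ> adj (D n)) = row_sqrt ?I c D'" for c
    unfolding D'_def by (rule reg_sqrt_eq_row_sqrt[OF bD w])
  have gramA: "(\<lambda>x. \<Sum>n = 1..N. lam n *\<^sub>R A n (adj (A n) x)) = (\<lambda>x. \<Sum>n = 1..N. A' n (adj (A' n) x))"
    unfolding A'_def using bA lam by (intro ext sum.cong) (auto simp: scaled_row_gram)
  have rootC: "sqrt_op (\<lambda>x. \<Sum>n = 1..N. adj (C n) (C n x)) = col_sqrt ?I 0 C"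
    by (simp add: col_sqrt_def)
  have rootD: "sqrt_op (\<lambda>x. \<Sum>n = 1..N. w n *\<^sub>R D n (adj (D n) x)) = row_sqrt ?I 0 D'"
    unfolding D'_def row_sqrt_def using bD w
    by (intro arg_cong[of _ _ sqrt_op] ext) (simp add: scaled_row_gram cong: sum.cong_simp)
  have Max_bound: "f n \<le> Max (f ` ?I)" if "n \<in> ?I" for f :: "nat \<Rightarrow> real" and n
    using that by (intro Max_ge) auto
  \<comment> \<open>\<open>N \<ge> 1\<close> puts the index 1 in range, so the maximum dominates the
    nonnegative value there.\<close>
  have Max_nonneg: "0 \<le> Max (f ` ?I)" if "\<And>n. n \<in> ?I \<Longrightarrow> 0 \<le> f n" for f :: "nat \<Rightarrow> real"
    by (rule order_trans[OF that[of 1] Max_bound[of 1 f]]) (use N in auto)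
  have oA: "0 \<le> onorm (A n)" and oB: "0 \<le> onorm (B n)" and oC: "0 \<le> onorm (C n)"
    and oD: "0 \<le> onorm (D n)" if "n \<in> ?I" for n
    using that ops by (auto intro: bop_onorm_pos)
  have id1: "onorm (\<lambda>x::'a. x) \<le> 1" by (rule onorm_identity_le_1)
  have id11: "onorm (\<lambda>x::'a. x) * onorm (\<lambda>x::'a. x) \<le> 1"
    using id1 bop_onorm_pos[OF bop_id] by (intro mult_le_one) auto
  note mCD = Max_bound[of _ "\<lambda>n. onorm (C n) * onorm (D n)"] Max_nonneg[of "\<lambda>n. onorm (C n) * onorm (D n)"]
  note mAB = Max_bound[of _ "\<lambda>n. onorm (A n) * onorm (B n)"] Max_nonneg[of "\<lambda>n. onorm (A n) * onorm (B n)"]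
  note mA = Max_bound[of _ "\<lambda>n. onorm (A n)"] Max_nonneg[of "\<lambda>n. onorm (A n)", OF oA]
  note mB = Max_bound[of _ "\<lambda>n. onorm (B n)"] Max_nonneg[of "\<lambda>n. onorm (B n)", OF oB]
  note mC = Max_bound[of _ "\<lambda>n. onorm (C n)"] Max_nonneg[of "\<lambda>n. onorm (C n)", OF oC]
  note mD = Max_bound[of _ "\<lambda>n. onorm (D n)"] Max_nonneg[of "\<lambda>n. onorm (D n)", OF oD]
  have nCD: "0 \<le> Max ((\<lambda>n. onorm (C n) * onorm (D n)) ` ?I)" using mCD(2) oC oD by simp
  have nAB: "0 \<le> Max ((\<lambda>n. onorm (A n) * onorm (B n)) ` ?I)" using mAB(2) oA oB by simp
  \<comment> \<open>\<open>sqrt (lam n)\<close> stays with \<open>A n\<close>, while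
    \<open>sqrt (w n)\<close> passes inward through the linear maps to \<open>D n\<close>.
    \<open>R\<close> is an inverse root in the regularised case and the identity in the plain
    one.\<close>
  have pull_AD: "(\<lambda>x. \<Sum>n = 1..N. (sqrt (lam n) * sqrt (w n)) *\<^sub>R A n (C n (X (R (D n (B n x))))))
      = (\<lambda>x. \<Sum>n = 1..N. A' n (C n (X (R (D' n (B n x))))))" if "bop X" "bop R" for X R
    unfolding A'_def D'_def using bA bC that by (intro ext sum.cong) (auto simp: bop_scaleR_compose)
  have pull_D: "(\<lambda>x. \<Sum>n = 1..N. sqrt (w n) *\<^sub>R A n (C n (S (X (R (D n (B n x)))))))
      = (\<lambda>x. \<Sum>n = 1..N. A n (C n (S (X (R (D' n (B n x)))))))" if "bop S" "bop X" "bop R" for S X R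
    unfolding D'_def using bA bC that by (intro ext sum.cong) (auto simp: bop_scaleR)
  have pull_AB: "(\<lambda>x. \<Sum>n = 1..N. (sqrt (lam n) * sqrt (w n)) *\<^sub>R A n (X (R (B n x))))
      = (\<lambda>x. \<Sum>n = 1..N. A' n (X (R (B' n x))))" if "bop X" "bop R" for X R
    unfolding A'_def B'_def using bA that by (intro ext sum.cong) (auto simp: bop_scaleR)
  have pull_B: "(\<lambda>x. \<Sum>n = 1..N. sqrt (w n) *\<^sub>R A n (S (X (R (B n x)))))
      = (\<lambda>x. \<Sum>n = 1..N. A n (S (X (R (B' n x)))))" if "bop S" "bop X" "bop R" for S X R
    unfolding B'_def using bA that by (intro ext sum.cong) (auto simp: bop_scaleR)
  note I = finite_atLeastAtMost[of 1 N]
  note hsb = hs_class_bop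
  have trb: "bop X" if "trace_class X" for X :: "'a \<Rightarrow> 'a" using that by (simp add: trace_class_def)

  have f1: "onorm (inv (row_sqrt ?I \<eta> A') \<circ> (\<lambda>x. \<Sum>n = 1..N. sqrt (lam n) *\<^sub>R A n (C n (X (D n (B n x)))))
        \<circ> inv (col_sqrt ?I \<zeta> B)) \<le> Max ((\<lambda>n. onorm (C n) * onorm (D n)) ` ?I) * onorm X"
    if "bop X" "\<eta> > 0" "\<zeta> > 0" for X \<eta> \<zeta>
    using onorm_regularized_le[OF I bA' bB bC bD that(1) mCD(1) nCD that(2,3)] by (simp add: A'_def)
  have f2: "hs_norm (\<lambda>x. \<Sum>n = 1..N. A n (C n (inv (col_sqrt ?I \<eta> C) (X (D n (B n (inv (col_sqrt ?I \<zeta> B) x)))))))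
      \<le> Max ((\<lambda>n. onorm (A n)) ` ?I) * Max ((\<lambda>n. onorm (D n)) ` ?I) * hs_norm X"
    if "hs_class X" "\<eta> > 0" "\<zeta> > 0" for X \<eta> \<zeta>
    by (rule hs_norm_regularized_le_column[OF I bA bB bC bD that(1) mA mD that(2,3)])
  have f3: "hs_norm (inv (row_sqrt ?I \<eta> A') \<circ> (\<lambda>x. \<Sum>n = 1..N. (sqrt (lam n) * sqrt (w n)) *\<^sub>R
        A n (C n (X (inv (row_sqrt ?I \<theta> D') (D n (B n x)))))))
      \<le> Max ((\<lambda>n. onorm (B n)) ` ?I) * Max ((\<lambda>n. onorm (C n)) ` ?I) * hs_norm X"
    if "hs_class X" "\<eta> > 0" "\<theta> > 0" for X \<eta> \<theta>
    unfolding pull_AD[OF hsb[OF that(1)] bop_inv_row_sqrt[OF bD' that(3)]]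
    by (rule hs_norm_regularized_le_row[OF I bA' bB bC bD' that(1) mB mC that(2,3)])
  have f4: "tr_norm (\<lambda>x. \<Sum>n = 1..N. sqrt (w n) *\<^sub>R
        A n (C n (inv (col_sqrt ?I \<eta> C) (X (inv (row_sqrt ?I \<theta> D') (D n (B n x)))))))
      \<le> Max ((\<lambda>n. onorm (A n) * onorm (B n)) ` ?I) * tr_norm X"
    if "trace_class X" "\<eta> > 0" "\<theta> > 0" for X \<eta> \<theta>
    unfolding pull_D[OF bop_inv_col_sqrt[OF bC that(2)] trb[OF that(1)] bop_inv_row_sqrt[OF bD' that(3)]]
    by (rule tr_norm_regularized_le[OF I bA bB bC bD' that(1) mAB(1) nAB that(2,3)])
  have f1e: "onorm (\<lambda>x. \<Sum>n = 1..N. sqrt (lam n) *\<^sub>R A n (C n (X (D n (B n x)))))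
       \<le> Max ((\<lambda>n. onorm (C n) * onorm (D n)) ` ?I)
         * sqrt (onorm (\<lambda>x. \<Sum>n = 1..N. A' n (adj (A' n) x)))
         * sqrt (onorm (\<lambda>x. \<Sum>n = 1..N. adj (B n) (B n x))) * onorm X" if "bop X" for X
    using onorm_elementary_le[OF I bA' bB bC bD that mCD(1) nCD] unfolding A'_def .
  have f2e: "hs_norm (\<lambda>x. \<Sum>n = 1..N. A n (C n (X (D n (B n x)))))
       \<le> Max ((\<lambda>n. onorm (A n)) ` ?I) * Max ((\<lambda>n. onorm (D n)) ` ?I)
         * sqrt (onorm (\<lambda>x. \<Sum>n = 1..N. adj (B n) (B n x))) * hs_norm (col_sqrt ?I 0 C \<circ> X)"
    if "hs_class X" for X
    by (rule hs_norm_elementary_le_column[OF I bA bB bC bD that mA mD])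
  have f3e: "hs_norm (\<lambda>x. \<Sum>n = 1..N. (sqrt (lam n) * sqrt (w n)) *\<^sub>R A n (C n (X (D n (B n x)))))
       \<le> Max ((\<lambda>n. onorm (B n)) ` ?I) * Max ((\<lambda>n. onorm (C n)) ` ?I)
         * sqrt (onorm (\<lambda>x. \<Sum>n = 1..N. A' n (adj (A' n) x))) * hs_norm (X \<circ> row_sqrt ?I 0 D')"
    if "hs_class X" for X
    unfolding pull_AD[OF hsb[OF that] bop_id]
    by (rule hs_norm_elementary_le_row[OF I bA' bB bC bD' that mB mC])
  have f4e: "tr_norm (\<lambda>x. \<Sum>n = 1..N. sqrt (w n) *\<^sub>R A n (C n (X (D n (B n x)))))
       \<le> Max ((\<lambda>n. onorm (A n) * onorm (B n)) ` ?I) * tr_norm (col_sqrt ?I 0 C \<circ> X \<circ> row_sqrt ?I 0 D')"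
    if "trace_class X" for X
    unfolding pull_D[OF bop_id trb[OF that] bop_id]
    by (rule tr_norm_elementary_le[OF I bA bB bC bD' that mAB(1) nAB])
  \<comment> \<open>This and the next three bounds put identities into two of the four slots, so the
    maxima become 1: the slots \<open>C\<close>, \<open>D\<close> here; \<open>A\<close>,
    \<open>D\<close> in \<open>f6\<close>, with \<open>A\<close> moved to slot \<open>C\<close>;
    \<open>B\<close>, \<open>C\<close> in \<open>f7\<close>, with \<open>B'\<close> in slot
    \<open>D\<close>; \<open>A\<close>, \<open>B\<close> in \<open>f8\<close>, with \<open>A\<close>
    and \<open>B'\<close> inside.\<close>
  have f5: "onorm (inv (row_sqrt ?I \<eta> A') \<circ> (\<lambda>x. \<Sum>n = 1..N. sqrt (lam n) *\<^sub>R A n (X (B n x)))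
        \<circ> inv (col_sqrt ?I \<zeta> B)) \<le> onorm X"
    if "bop X" "\<eta> > 0" "\<zeta> > 0" for X \<eta> \<zeta>
    using onorm_regularized_le[OF I bA' bB bId bId that(1) id11 _ that(2,3)] by (simp add: A'_def)
  have f6: "hs_norm (\<lambda>x. \<Sum>n = 1..N. A n (inv (col_sqrt ?I \<epsilon> A) (X (B n (inv (col_sqrt ?I \<zeta> B) x)))))
      \<le> hs_norm X"
    if "hs_class X" "\<epsilon> > 0" "\<zeta> > 0" for X \<epsilon> \<zeta>
    using hs_norm_regularized_le_column[OF I bId bB bA bId that(1) id1 _ id1 _ that(2,3)] by simp
  have f7: "hs_norm (inv (row_sqrt ?I \<eta> A') \<circ> (\<lambda>x. \<Sum>n = 1..N. (sqrt (lam n) * sqrt (w n)) *\<^sub>R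
        A n (X (inv (row_sqrt ?I \<theta> B') (B n x))))) \<le> hs_norm X"
    if "hs_class X" "\<eta> > 0" "\<theta> > 0" for X \<eta> \<theta>
    unfolding pull_AB[OF hsb[OF that(1)] bop_inv_row_sqrt[OF bB' that(3)]]
    using hs_norm_regularized_le_row[OF I bA' bId bId bB' that(1) id1 _ id1 _ that(2,3)] by simp
  have f8: "tr_norm (\<lambda>x. \<Sum>n = 1..N. sqrt (w n) *\<^sub>R
        A n (inv (col_sqrt ?I \<epsilon> A) (X (inv (row_sqrt ?I \<theta> B') (B n x))))) \<le> tr_norm X"
    if "trace_class X" "\<epsilon> > 0" "\<theta> > 0" for X \<epsilon> \<theta>
    unfolding pull_B[OF bop_inv_col_sqrt[OF bA that(2)] trb[OF that(1)] bop_inv_row_sqrt[OF bB' that(3)]]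
    using tr_norm_regularized_le[OF I bId bId bA bB' that(1) id11 _ that(2,3)] by simp
  show ?thesis
    unfolding Let_def regA regB regD reg_sqrt_eq_col_sqrt gramA rootC rootD
    by (intro conjI allI impI) (simp_all only: f1 f2 f3 f4 f1e f2e f3e f4e f5 f6 f7 f8)
qed

end
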